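(* Let $1<p\le2$, let $n\in\mathbb{N}$, let $\Omega\subset\mathbb{R}^n$ be an open bounded $C^{1,1}$ domain, let $M\in\mathbb{R}^{n\times n}$, and let $K=K(\theta)\subset\mathbb{R}^{n\times n}$, for some fixed $\theta\in\mathbb{R}_+$, be the set of energy wells defined in the context. For $\epsilon>0$ let $$E_{\epsilon,p}=\min_{\nabla u=M \text{ a.e. in } \mathbb{R}^n\setminus\overline{\Omega}}\left\{\int_{\Omega}\operatorname{dist}^2(\nabla u,K)\,dx+\epsilon^p\,\|\nabla^2u\|_{L^p(\Omega)}^p\right\}.$$ Assume that there exist constants $C_p>1$, $\epsilon_0>0$ and $\mu\in(0,\tfrac12)$ such that for all $\epsilon\in(0,\epsilon_0)$ $$\epsilon^{2\mu}\le C_p\,E_{\epsilon,p}.$$ Suppose that $u:\mathbb{R}^n\to\mathbb{R}^n$ is a solution to $$\nabla u\in K \ \text{ a.e. in } \Omega,\qquad \nabla u=M\ \text{ a.e. in } \mathbb{R}^n\setminus\overline{\Omega}.$$ If, for some $b\in\mathbb{R}^n$ and $s\in\mathbb{R}$, the function $v(x)=u(x)-Mx-b$ satisfies $v\in W^{1+s,p}(\mathbb{R}^n)$, $\operatorname{supp}(v)\subset\overline{\Omega}$ and $\nabla v\in L^{\infty}(\mathbb{R}^n)$, then $s\le\frac{2\mu}{p}$.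
   Context: Energy wells: for $\theta\in\mathbb{R}_+$ and a fixed critical temperature $\theta_c\in\mathbb{R}_+$, $$K(\theta)=\begin{cases}\alpha(\theta)\,SO(n) & \text{if }\theta>\theta_c,\\ \bigcup_{j=1}^{m}SO(n)\,U_j(\theta) & \text{if }\theta\le\theta_c,\end{cases}$$ where $\alpha:\mathbb{R}_+\to\mathbb{R}_+$ is a given function, $m\in\mathbb{N}$, and $U_j(\theta)=U_j(\theta)^t\in\mathbb{R}^{n\times n}$, $j=1,\dots,m$, are given symmetric matrices. $\operatorname{dist}(\cdot,K)$ is the Euclidean (Frobenius) distance to $K$ in $\mathbb{R}^{n\times n}$. The minimum (read as an infimum) defining the energy is over maps $u:\mathbb{R}^n\to\mathbb{R}^n$ in $H^1_{loc}(\mathbb{R}^n;\mathbb{R}^n)$ with $\nabla u=M$ a.e. in $\mathbb{R}^n\setminus\overline{\Omega}$ and $\nabla^2u\in L^p(\Omega)$ (second distributional derivative in $\Omega$). Fractional Sobolev spaces: for $r=k+\sigma>0$ with $k\in\mathbb{N}\cup\{0\}$ and $\sigma\in(0,1)$, $W^{r,p}(\mathbb{R}^n)$ is defined by the norm $$\|f\|_{W^{r,p}(\mathbb{R}^n)}^p=\|f\|_{L^p(\mathbb{R}^n)}^p+\|\nabla^kf\|_{L^p(\mathbb{R}^n)}^p+\int_{\mathbb{R}^n}\int_{\mathbb{R}^n}\frac{|\nabla^kf(x)-\nabla^kf(y)|^p}{|x-y|^{n+\sigma p}}\,dy\,dx;$$ for non-negative integer $r$ it is the usual Sobolev space, and for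 negative $r$ it is understood in the usual sense (dual of $W^{-r,p'}(\mathbb{R}^n)$, $1/p+1/p'=1$). Vector-valued functions are treated componentwise. *)

theory Defs
  imports "HOL-Analysis.Analysis"
begin

definition pderiv_dir :: "'n \<Rightarrow> (real^'n \<Rightarrow> real) \<Rightarrow> real^'n \<Rightarrow> real" where
  "pderiv_dir i f x = frechet_derivative f (at x) (axis i 1)"

primrec iter_pderiv :: "'n list \<Rightarrow> (real^'n \<Rightarrow> real) \<Rightarrow> real^'n \<Rightarrow> real" where
  "iter_pderiv [] f = f"
| "iter_pderiv (i # is) f = pderiv_dir i (iter_pderiv is f)"

definition smooth_fun :: "(real^'n \<Rightarrow> real) \<Rightarrow> bool" where
  "smooth_fun f \<longleftrightarrow> (\<forall>is x. iter_pderiv is f differentiable (at x))"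

definition test_fun :: "(real^'n) set \<Rightarrow> (real^'n \<Rightarrow> real) \<Rightarrow> bool" where
  "test_fun S \<phi> \<longleftrightarrow> smooth_fun \<phi> \<and> compact (closure {x. \<phi> x \<noteq> 0}) \<and> closure {x. \<phi> x \<noteq> 0} \<subseteq> S"

definition loc_integrable :: "(real^'n) set \<Rightarrow> (real^'n \<Rightarrow> real) \<Rightarrow> bool" where
  "loc_integrable S f \<longleftrightarrow> (\<forall>C. compact C \<and> C \<subseteq> S \<longrightarrow> set_integrable lebesgue C f)"

text \<open>The iterated weak derivative of a function along a list of coordinate directions, on an
  open set. No lower-order weak derivatives are required to exist.\<close>

definition weak_deriv :: "(real^'n) set \<Rightarrow> 'n list \<Rightarrow> (real^'n \<Rightarrow> real) \<Rightarrow> (real^'n \<Rightarrow> real) \<Rightarrow> bool" where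
  "weak_deriv S is f g \<longleftrightarrow> loc_integrable S f \<and> loc_integrable S g \<and>
     (\<forall>\<phi>. test_fun S \<phi> \<longrightarrow>
        (LINT x:S|lebesgue. f x * iter_pderiv is \<phi> x)
          = (-1) ^ length is * (LINT x:S|lebesgue. g x * \<phi> x))"

text \<open>Row index = component, further indices = directions: the entry \<open>i, j\<close> of the gradient is the
  derivative of component \<open>i\<close> in direction \<open>j\<close>.\<close>

definition weak_gradient :: "(real^'n) set \<Rightarrow> (real^'n \<Rightarrow> real^'n) \<Rightarrow> (real^'n \<Rightarrow> real^'n^'n) \<Rightarrow> bool" where
  "weak_gradient S u G \<longleftrightarrow> (\<forall>i j. weak_deriv S [j] (\<lambda>x. u x $ i) (\<lambda>x. G x $ i $ j))"

definition weak_hessian :: "(real^'n) set \<Rightarrow> (real^'n \<Rightarrow> real^'n) \<Rightarrow> (real^'n \<Rightarrow> real^'n^'n^'n) \<Rightarrow> bool" where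
  "weak_hessian S u D \<longleftrightarrow>
     (\<forall>i j k. weak_deriv S [j, k] (\<lambda>x. u x $ i) (\<lambda>x. D x $ i $ j $ k))"

text \<open>The \<open>p\<close>-th power of the norm of \<open>L\<^sup>p(S)\<close>; the norm on \<open>real^'n^'n\<close> and \<open>real^'n^'n^'n\<close> is the
  Euclidean (Frobenius) norm.\<close>

definition Lp_pow :: "(real^'n) set \<Rightarrow> real \<Rightarrow> (real^'n \<Rightarrow> 'b::real_normed_vector) \<Rightarrow> ennreal" where
  "Lp_pow S p f = (\<integral>\<^sup>+x\<in>S. ennreal (norm (f x) powr p) \<partial>lebesgue)"

definition in_Lp :: "(real^'n) set \<Rightarrow> real \<Rightarrow> (real^'n \<Rightarrow> 'b::real_normed_vector) \<Rightarrow> bool" where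
  "in_Lp S p f \<longleftrightarrow> set_borel_measurable lebesgue S f \<and> Lp_pow S p f < \<infinity>"

definition in_Linf :: "(real^'n \<Rightarrow> 'b::real_normed_vector) \<Rightarrow> bool" where
  "in_Linf f \<longleftrightarrow> f \<in> borel_measurable lebesgue \<and> (\<exists>C. AE x in lebesgue. norm (f x) \<le> C)"

text \<open>The support of a function that is only determined up to null sets.\<close>

definition ess_supp :: "(real^'n \<Rightarrow> 'b::zero) \<Rightarrow> (real^'n) set" where
  "ess_supp f = - \<Union>{U. open U \<and> (AE x in lebesgue. x \<in> U \<longrightarrow> f x = 0)}"

text \<open>A \<open>k\<close>-th order gradient is represented by its entries, indexed by lists of directions of
  length \<open>k\<close>.\<close>

definition tensor_norm :: "nat \<Rightarrow> ('n::finite list \<Rightarrow> real) \<Rightarrow> real" where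
  "tensor_norm k T = L2_set T {is. length is = k}"

definition gagliardo_pow :: "nat \<Rightarrow> real \<Rightarrow> real \<Rightarrow> ('n::finite list \<Rightarrow> real^'n \<Rightarrow> real) \<Rightarrow> ennreal" where
  "gagliardo_pow k \<sigma> p g =
     (\<integral>\<^sup>+x. (\<integral>\<^sup>+y. ennreal (tensor_norm k (\<lambda>is. g is x - g is y) powr p
         / norm (x - y) powr (real CARD('n) + \<sigma> * p)) \<partial>lebesgue) \<partial>lebesgue)"

text \<open>The \<open>p\<close>-th power of the norm of \<open>W\<^sup>r\<^sup>,\<^sup>p\<close> on the whole space, for \<open>r \<ge> 0\<close>. Weak derivatives
  are unique up to null sets, so the infimum is over equal values; it is \<open>\<infinity>\<close> if the required
  weak derivatives do not exist.\<close>

definition sobolev_pow :: "real \<Rightarrow> real \<Rightarrow> (real^'n \<Rightarrow> real) \<Rightarrow> ennreal" where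
  "sobolev_pow r p f =
     (let k = nat \<lfloor>r\<rfloor>; \<sigma> = frac r in
      if \<sigma> = 0 then
        (INF g \<in> {g. \<forall>is. length is \<le> k \<longrightarrow> weak_deriv UNIV is f (g is)}.
           \<Sum>j\<le>k. Lp_pow UNIV p (\<lambda>x. tensor_norm j (\<lambda>is. g is x)))
      else
        (INF g \<in> {g. \<forall>is. length is = k \<longrightarrow> weak_deriv UNIV is f (g is)}.
           Lp_pow UNIV p f + Lp_pow UNIV p (\<lambda>x. tensor_norm k (\<lambda>is. g is x))
             + gagliardo_pow k \<sigma> p g))"

text \<open>For \<open>r < 0\<close>: a locally integrable \<open>f\<close> belongs to the dual of \<open>W\<^sup>-\<^sup>r\<^sup>,\<^sup>q\<close>, with \<open>q\<close> the dual
  exponent, iff testing against \<open>f\<close> is bounded in the norm of \<open>W\<^sup>-\<^sup>r\<^sup>,\<^sup>q\<close> (test functions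
  being dense there).\<close>

definition sobolev_space :: "real \<Rightarrow> real \<Rightarrow> (real^'n \<Rightarrow> real) set" where
  "sobolev_space r p =
     (if 0 \<le> r then {f. f \<in> borel_measurable lebesgue \<and> sobolev_pow r p f < \<infinity>}
      else (let q = p / (p - 1) in
        {f. loc_integrable UNIV f \<and>
            (\<exists>C. \<forall>\<phi>. test_fun UNIV \<phi> \<longrightarrow>
               ennreal (\<bar>LINT x|lebesgue. f x * \<phi> x\<bar> powr q)
                 \<le> ennreal C * sobolev_pow (- r) q \<phi>)}))"

definition C11_fun :: "(real^'n \<Rightarrow> real) \<Rightarrow> bool" where
  "C11_fun \<gamma> \<longleftrightarrow> (\<exists>g L. (\<forall>x. (\<gamma> has_derivative (\<lambda>h. g x \<bullet> h)) (at x)) \<and>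
     L-lipschitz_on UNIV (g :: real^'n \<Rightarrow> real^'n))"

text \<open>Near each boundary point the set is the strict epigraph, in some direction \<open>\<nu>\<close>, of a \<open>C\<^sup>1\<^sup>,\<^sup>1\<close>
  function of the coordinates orthogonal to \<open>\<nu>\<close>. Connectedness is not required.\<close>

definition C11_domain :: "(real^'n) set \<Rightarrow> bool" where
  "C11_domain \<Omega> \<longleftrightarrow> open \<Omega> \<and>
     (\<forall>x0 \<in> frontier \<Omega>. \<exists>r > 0. \<exists>\<nu> \<gamma>. norm \<nu> = 1 \<and> C11_fun \<gamma> \<and>
        \<Omega> \<inter> ball x0 r = {y \<in> ball x0 r. \<gamma> (y - (y \<bullet> \<nu>) *\<^sub>R \<nu>) < y \<bullet> \<nu>})"

definition energy_wells ::
  "(real \<Rightarrow> real) \<Rightarrow> real \<Rightarrow> nat \<Rightarrow> (nat \<Rightarrow> real \<Rightarrow> real^'n^'n) \<Rightarrow> real \<Rightarrow> (real^'n^'n) set" where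
  "energy_wells \<alpha> \<theta>c m U \<theta> =
     (if \<theta> > \<theta>c then (\<lambda>Q. \<alpha> \<theta> *\<^sub>R Q) ` {Q. rotation_matrix Q}
      else (\<Union>j\<in>{1..m}. (\<lambda>Q. Q ** U j \<theta>) ` {Q. rotation_matrix Q}))"

text \<open>A competitor is given by the map \<open>u\<close>, its weak gradient \<open>G\<close> on the whole space, which lies in
  \<open>L\<^sup>2\<close> locally together with \<open>u\<close>, and its weak Hessian \<open>D\<close> in \<open>\<Omega>\<close>.\<close>

definition admissible ::
  "(real^'n) set \<Rightarrow> real^'n^'n \<Rightarrow> real \<Rightarrow> (real^'n \<Rightarrow> real^'n) \<Rightarrow> (real^'n \<Rightarrow> real^'n^'n)
     \<Rightarrow> (real^'n \<Rightarrow> real^'n^'n^'n) \<Rightarrow> bool" where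
  "admissible \<Omega> M p u G D \<longleftrightarrow>
     weak_gradient UNIV u G \<and>
     (\<forall>C. compact C \<longrightarrow> in_Lp C 2 u \<and> in_Lp C 2 G) \<and>
     (AE x in lebesgue. x \<notin> closure \<Omega> \<longrightarrow> G x = M) \<and>
     weak_hessian \<Omega> u D \<and> in_Lp \<Omega> p D"

definition energy_inf ::
  "(real^'n) set \<Rightarrow> real^'n^'n \<Rightarrow> (real^'n^'n) set \<Rightarrow> real \<Rightarrow> real \<Rightarrow> ennreal" where
  "energy_inf \<Omega> M K p \<epsilon> =
     (INF (u, G, D) \<in> {(u, G, D). admissible \<Omega> M p u G D}.
        (\<integral>\<^sup>+x\<in>\<Omega>. ennreal ((infdist (G x) K)\<^sup>2) \<partial>lebesgue) + ennreal (\<epsilon> powr p) * Lp_pow \<Omega> p D)"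

end

theory Submission
  imports Defs
begin

text \<open>
  Suppose \<open>s > 2\<mu>/p\<close>. If \<open>s \<ge> 1\<close>, then \<open>v\<close> has weak second derivatives in \<open>L\<^sup>p\<close> (lower order derivatives
  are recovered from higher ones by integrating along lines, as \<open>v\<close> has compact support), so \<open>u\<close> is a
  competitor and \<open>E\<^sub>\<epsilon>\<^sub>,\<^sub>p \<le> C \<epsilon>\<^sup>p\<close>. If \<open>s < 1\<close>, mollify \<open>v\<close> at scale \<open>\<epsilon>\<close> and cut off in a boundary layer of
  width of order \<open>\<epsilon>\<close>. Away from the layer, the Gagliardo seminorm bounds both \<open>\<nabla>v\<^sub>\<epsilon> - \<nabla>v\<close> and
  \<open>\<epsilon> \<nabla>\<^sup>2v\<^sub>\<epsilon>\<close> in \<open>L\<^sup>p\<close> by \<open>C \<epsilon>\<^sup>s\<close>, and boundedness of \<open>\<nabla>v\<close> turns the exponent \<open>p\<close> into 2 in the elastic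
  term. The layer has measure \<open>O(\<epsilon>)\<close> and the integrands are bounded there, so the energy is at most
  \<open>C (\<epsilon>\<^sup>s\<^sup>p + \<epsilon>)\<close>. Since \<open>2\<mu> < 1\<close>, both regimes contradict \<open>\<epsilon>\<^sup>2\<^sup>\<mu> \<le> C\<^sub>p E\<^sub>\<epsilon>\<^sub>,\<^sub>p\<close> as \<open>\<epsilon>\<close> tends to 0.
\<close>

subsection \<open>Smooth functions and test functions\<close>

text \<open>The Gagliardo seminorm controls increments of the gradient, not its values. It becomes
  usable because the mollifier has mean 1 and its partial derivatives have mean 0: in both
  convolutions \<open>f y\<close> may be replaced by \<open>f y - f x\<close>, and on the support of
  the kernel the singular weight is bounded below by a negative power of \<epsilon>. The obstacle is
  the constraint outside the closure of \<Omega>: mollification pushes the support outward by order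
  \<epsilon>, while a competitor must have gradient exactly \<open>M\<close> there. Cutting off
  multiplies \<open>ve\<close> by derivatives of the cutoff of size 1/\<epsilon> and 1/\<epsilon>^2,
  which is affordable only if \<open>ve\<close> is O(\<epsilon>) in the layer. Exterior balls of
  radius comparable to \<epsilon> near every boundary point supply zeros of \<open>ve\<close>, and
  its Lipschitz bound carries them into the layer. The layer contributes at most order \<epsilon> to
  both energy terms; hence the exponent \<open>min (s * p) 1\<close>, which exceeds
  \<open>2 * \<mu>\<close> because \<mu> < 1/2. The construction is scalar, one component at a time,
  and the finitely many constants are merged at the end.\<close>

lemma pderiv_dirI: "(f has_derivative D) (at x) \<Longrightarrow> pderiv_dir i f x = D (axis i 1)"
  unfolding pderiv_dir_def using frechet_derivative_at[of f D x] by simp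

lemma iter_pderiv_append: "iter_pderiv (is @ js) f = iter_pderiv is (iter_pderiv js f)"
  by (induction "is") auto

lemma smooth_fun_iter_pderiv: "smooth_fun f \<Longrightarrow> smooth_fun (iter_pderiv is f)"
  unfolding smooth_fun_def by (auto simp: iter_pderiv_append[symmetric])

lemma smooth_fun_pderiv_dir: "smooth_fun f \<Longrightarrow> smooth_fun (pderiv_dir i f)"
  using smooth_fun_iter_pderiv[of f "[i]"] by simp

lemma smooth_fun_differentiable: "smooth_fun f \<Longrightarrow> f differentiable (at x)"
  unfolding smooth_fun_def using iter_pderiv.simps(1) by metis

lemma smooth_fun_continuous: "smooth_fun f \<Longrightarrow> continuous_on S f"
  by (meson continuous_at_imp_continuous_on differentiable_imp_continuous_within smooth_fun_differentiable)

lemma has_derivative_pderiv_dir: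
  fixes f :: "real^'n \<Rightarrow> real"
  assumes "f differentiable (at x)"
  shows "(f has_derivative (\<lambda>h. \<Sum>i\<in>UNIV. h $ i * pderiv_dir i f x)) (at x)"
proof -
  let ?D = "frechet_derivative f (at x)"
  have d: "(f has_derivative ?D) (at x)"
    using assms frechet_derivative_works by blast
  then interpret bounded_linear ?D by (rule has_derivative_bounded_linear)
  have "?D h = (\<Sum>i\<in>UNIV. h $ i * pderiv_dir i f x)" for h
  proof -
    have "h = (\<Sum>i\<in>UNIV. (h $ i) *\<^sub>R axis i 1)"
      using basis_expansion[of h] by (simp add: scalar_mult_eq_scaleR)
    then have "?D h = ?D (\<Sum>i\<in>UNIV. (h $ i) *\<^sub>R axis i 1)" by simp
    also have "\<dots> = (\<Sum>i\<in>UNIV. h $ i * pderiv_dir i f x)"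
      by (simp add: sum scaleR pderiv_dir_def)
    finally show ?thesis .
  qed
  then have "?D = (\<lambda>h. \<Sum>i\<in>UNIV. h $ i * pderiv_dir i f x)" by blast
  with d show ?thesis by simp
qed

lemma pderiv_dir_add:
  assumes "f differentiable (at x)" "g differentiable (at x)"
  shows "pderiv_dir i (\<lambda>x. f x + g x) x = pderiv_dir i f x + pderiv_dir i g x"
proof -
  note * = assms[unfolded frechet_derivative_works]
  show ?thesis using pderiv_dirI[OF has_derivative_add[OF *]] by (simp add: pderiv_dir_def)
qed

lemma pderiv_dir_mult:
  fixes f g :: "real^'n \<Rightarrow> real"
  assumes "f differentiable (at x)" "g differentiable (at x)"
  shows "pderiv_dir i (\<lambda>x. f x * g x) x = f x * pderiv_dir i g x + pderiv_dir i f x * g x"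
proof -
  note * = assms[unfolded frechet_derivative_works]
  show ?thesis using pderiv_dirI[OF has_derivative_mult[OF *]] by (simp add: pderiv_dir_def)
qed

lemma pderiv_dir_cong:
  assumes "open S" "x \<in> S" "\<And>y. y \<in> S \<Longrightarrow> f y = g y"
  shows "pderiv_dir i f x = pderiv_dir i g x"
proof -
  have "(f has_derivative D) (at x) \<longleftrightarrow> (g has_derivative D) (at x)" for D
    using assms has_derivative_transform_within_open[of f D x UNIV S g]
      has_derivative_transform_within_open[of g D x UNIV S f] by auto
  then show ?thesis unfolding pderiv_dir_def frechet_derivative_def by simp
qed

lemma iter_pderiv_cong:
  assumes "open S" "x \<in> S" "\<And>y. y \<in> S \<Longrightarrow> f y = g y"
  shows "iter_pderiv is f x = iter_pderiv is g x"
  using assms(2)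
proof (induction "is" arbitrary: x)
  case Nil then show ?case using assms by simp
next
  case (Cons i "is")
  show ?case using pderiv_dir_cong[OF assms(1) Cons.prems Cons.IH] by simp
qed

inductive_set ring_closure :: "(real^'n \<Rightarrow> real) set \<Rightarrow> (real^'n \<Rightarrow> real) set" for B where
  base: "f \<in> B \<Longrightarrow> f \<in> ring_closure B"
| add: "f \<in> ring_closure B \<Longrightarrow> g \<in> ring_closure B \<Longrightarrow> (\<lambda>x. f x + g x) \<in> ring_closure B"
| mult: "f \<in> ring_closure B \<Longrightarrow> g \<in> ring_closure B \<Longrightarrow> (\<lambda>x. f x * g x) \<in> ring_closure B"

text \<open>The sum and product rules keep every iterated partial derivative inside the ring
  generated by \<open>B\<close>, and members of the ring are differentiable. Smoothness is thereby
  reduced to first derivatives of generators, and no higher Leibniz formula is needed.\<close>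

lemma smooth_fun_ring_closure:
  assumes f: "f \<in> ring_closure B"
    and diff: "\<And>g x. g \<in> B \<Longrightarrow> g differentiable (at x)"
    and deriv: "\<And>g i. g \<in> B \<Longrightarrow> pderiv_dir i g \<in> ring_closure B"
  shows "smooth_fun f"
proof -
  have d: "(\<forall>x. g differentiable (at x)) \<and> (\<forall>i. pderiv_dir i g \<in> ring_closure B)"
    if "g \<in> ring_closure B" for g
    using that
  proof (induction rule: ring_closure.induct)
    case (base f) then show ?case using diff deriv by blast
  next
    case (add f g)
    have "pderiv_dir i (\<lambda>x. f x + g x) = (\<lambda>x. pderiv_dir i f x + pderiv_dir i g x)" for i
      using add.IH by (auto simp: pderiv_dir_add)
    then show ?case using add by (auto intro: ring_closure.add)
  next
    case (mult f g)
    have "pderiv_dir i (\<lambda>x. f x * g x) = (\<lambda>x. f x * pderiv_dir i g x + pderiv_dir i f x * g x)" for i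
      using mult.IH by (auto simp: pderiv_dir_mult)
    then show ?case using mult by (auto intro!: ring_closure.add intro: ring_closure.mult)
  qed
  have "iter_pderiv is f \<in> ring_closure B" for "is"
    using f d by (induction "is") auto
  then show ?thesis unfolding smooth_fun_def using d by blast
qed

lemma smooth_fun_mult:
  fixes f g :: "real^'n \<Rightarrow> real"
  assumes "smooth_fun f" "smooth_fun g"
  shows "smooth_fun (\<lambda>x. f x * g x)"
proof (rule smooth_fun_ring_closure[where B = "Collect smooth_fun"])
  show "(\<lambda>x. f x * g x) \<in> ring_closure (Collect smooth_fun)"
    using assms by (intro ring_closure.mult ring_closure.base) auto
qed (auto intro: smooth_fun_differentiable smooth_fun_pderiv_dir ring_closure.base)

lemma pderiv_dir_const [simp]: "pderiv_dir i (\<lambda>x. c) = (\<lambda>x. 0)"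
  by (rule ext) (simp add: pderiv_dirI[OF has_derivative_const])

lemma smooth_fun_const: "smooth_fun (\<lambda>x::real^'n. c)"
proof (rule smooth_fun_ring_closure[where B = "range (\<lambda>c x. c)"])
  show "pderiv_dir i g \<in> ring_closure (range (\<lambda>c x. c))" if "g \<in> range (\<lambda>c x. c)" for g :: "real^'n \<Rightarrow> real" and i
    using that by (auto intro: ring_closure.base)
qed (auto intro: ring_closure.base)

lemma smooth_fun_prod:
  assumes "\<And>i. i \<in> I \<Longrightarrow> smooth_fun (f i)"
  shows "smooth_fun (\<lambda>x. \<Prod>i\<in>I. f i x)"
  using assms by (induction I rule: infinite_finite_induct) (auto intro: smooth_fun_const smooth_fun_mult)

section \<open>Explicit smooth bump functions\<close>

definition flat_exp :: "nat \<Rightarrow> real \<Rightarrow> real" where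
  "flat_exp n t = (if t > 0 then exp (- 1 / t) / t ^ n else 0)"

text \<open>This is \<open>exp y \<ge> (y / m) ^ m\<close> for \<open>y = 1 / t\<close> and
  \<open>m = n + 2\<close>. The surplus power 2 makes difference quotients at 0 tend to 0.\<close>

lemma flat_exp_bound: "\<bar>flat_exp n t\<bar> \<le> real (n + 2) ^ (n + 2) * t\<^sup>2"
proof (cases "t > 0")
  case True
  let ?m = "n + 2"
  have "(1 / t / real ?m) ^ ?m \<le> (1 + 1 / t / real ?m) ^ ?m"
    using True by (intro power_mono) auto
  also have "\<dots> \<le> exp (1 / t)"
    using True by (intro exp_ge_one_plus_x_over_n_power_n) (auto intro: order_trans[of _ 0])
  finally have "exp (- 1 / t) * (1 / t / real ?m) ^ ?m \<le> exp (- 1 / t) * exp (1 / t)"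
    by (intro mult_left_mono) auto
  also have "\<dots> = 1" by (simp add: exp_minus)
  finally have "exp (- 1 / t) \<le> real ?m ^ ?m * t ^ ?m"
    using True by (simp only: power_divide) (simp add: pos_divide_le_eq field_simps del: power_Suc of_nat_add)
  then have "exp (- 1 / t) / t ^ n \<le> real ?m ^ ?m * t\<^sup>2"
    using True unfolding power_add[of t n 2]
    by (simp add: pos_divide_le_eq ac_simps)
  with True show ?thesis by (simp add: flat_exp_def del: of_nat_add)
qed (auto simp: flat_exp_def)

text \<open>The powers of \<open>t\<close> in the denominator of \<open>flat_exp\<close> are there
  so that the family, up to linear combinations, is closed under differentiation. At 0 the quadratic
  bound \<open>flat_exp_bound\<close> takes the place of calculus.\<close>

lemma flat_exp_has_derivative:
  "(flat_exp n has_real_derivative (flat_exp (n + 2) t - n * flat_exp (n + 1) t)) (at t)"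
proof (cases t "0::real" rule: linorder_cases)
  case less
  have "((\<lambda>x. 0) has_real_derivative 0) (at t)" by simp
  then have "(flat_exp n has_real_derivative 0) (at t)"
    by (rule DERIV_cong_ev[THEN iffD1, rotated -1])
      (use less in \<open>auto simp: flat_exp_def eventually_nhds intro!: exI[of _ "{..<0}"]\<close>)
  then show ?thesis using less by (simp add: flat_exp_def)
next
  case greater
  have "((\<lambda>x. exp (- 1 / x) / x ^ n) has_real_derivative (flat_exp (n + 2) t - n * flat_exp (n + 1) t)) (at t)"
    using greater by (auto intro!: derivative_eq_intros simp: flat_exp_def field_simps power2_eq_square)
      (cases n; simp add: field_simps)
  then show ?thesis
    by (rule DERIV_cong_ev[THEN iffD1, rotated -1])
      (use greater in \<open>auto simp: flat_exp_def eventually_nhds intro!: exI[of _ "{0<..}"]\<close>)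
next
  case equal
  have "((\<lambda>h. flat_exp n h / h) \<longlongrightarrow> 0) (at 0)"
  proof (rule Lim_null_comparison)
    show "\<forall>\<^sub>F h in at 0. norm (flat_exp n h / h) \<le> real (n + 2) ^ (n + 2) * \<bar>h\<bar>"
      using flat_exp_bound[of n]
      by (auto simp: eventually_at_filter divide_simps power2_eq_square abs_mult[symmetric] mult.assoc intro!: always_eventually)
    show "((\<lambda>h::real. real (n + 2) ^ (n + 2) * \<bar>h\<bar>) \<longlongrightarrow> 0) (at 0)"
      by (auto intro!: tendsto_eq_intros)
  qed
  then show ?thesis using equal by (simp add: DERIV_def flat_exp_def)
qed

lemma smooth_fun_flat_exp: "smooth_fun (\<lambda>x::real^'n. flat_exp n (a * x $ i + c))"
proof -
  define B where "B = {g. \<exists>n d. g = (\<lambda>x::real^'n. d * flat_exp n (a * x $ i + c))}"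
  have der: "((\<lambda>x::real^'n. d * flat_exp n (a * x $ i + c)) has_derivative
     (\<lambda>h. d * (a * h $ i * (flat_exp (n + 2) (a * x $ i + c) - n * flat_exp (n + 1) (a * x $ i + c))))) (at x)" for n d x
  proof -
    have "((\<lambda>x::real^'n. a * x $ i + c) has_derivative (\<lambda>h. a * h $ i)) (at x)"
      by (auto intro!: derivative_eq_intros bounded_linear.has_derivative[OF bounded_linear_vec_nth])
    from has_derivative_compose[OF this flat_exp_has_derivative[unfolded has_field_derivative_def]]
    show ?thesis by (auto intro!: derivative_eq_intros simp: mult.commute)
  qed
  show ?thesis
  proof (rule smooth_fun_ring_closure)
    show "(\<lambda>x::real^'n. flat_exp n (a * x $ i + c)) \<in> ring_closure B"
      by (rule ring_closure.base) (simp add: B_def, rule exI[of _ n], rule exI[of _ 1], simp)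
    show "g differentiable (at x)" if "g \<in> B" for g x
      using that der unfolding B_def differentiable_def by blast
    show "pderiv_dir j g \<in> ring_closure B" if "g \<in> B" for g j
    proof -
      obtain n d where g: "g = (\<lambda>x::real^'n. d * flat_exp n (a * x $ i + c))"
        using \<open>g \<in> B\<close> by (auto simp: B_def)
      have eq: "pderiv_dir j g = (\<lambda>x. (d * a * axis j 1 $ i) * flat_exp (n + 2) (a * x $ i + c)
          + (- d * a * axis j 1 $ i * n) * flat_exp (n + 1) (a * x $ i + c))"
        unfolding g by (rule ext) (subst pderiv_dirI[OF der], simp add: algebra_simps)
      have "(\<lambda>x::real^'n. d' * flat_exp n' (a * x $ i + c)) \<in> ring_closure B" for d' n'
        by (rule ring_closure.base) (auto simp: B_def)
      then show ?thesis unfolding eq by (intro ring_closure.add)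
    qed
  qed
qed

text \<open>Since \<open>flat_exp 0 (k t)\<close> is the \<open>k\<close>-th root of \<open>flat_exp 0 t\<close>, these bumps increase to the indicator
  of the open box as \<open>k\<close> tends to infinity.\<close>

definition box_bump :: "nat \<Rightarrow> real^'n \<Rightarrow> real^'n \<Rightarrow> real^'n \<Rightarrow> real" where
  "box_bump k a b x = (\<Prod>i\<in>UNIV. flat_exp 0 (k * (x $ i - a $ i)) * flat_exp 0 (k * (b $ i - x $ i)))"

lemma flat_exp_0_bounds: "0 \<le> flat_exp 0 t" "flat_exp 0 t \<le> 1" "flat_exp 0 t \<noteq> 0 \<longleftrightarrow> t > 0"
  by (auto simp: flat_exp_def)

lemma box_bump_bounds: "0 \<le> box_bump k a b x" "box_bump k a b x \<le> 1"
  unfolding box_bump_def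
  by (auto intro!: prod_nonneg prod_le_1 mult_le_one mult_nonneg_nonneg simp: flat_exp_0_bounds)

lemma box_bump_nonzero: "k > 0 \<Longrightarrow> box_bump k a b x \<noteq> 0 \<longleftrightarrow> x \<in> box a b"
  by (auto simp: box_bump_def mem_box_cart flat_exp_0_bounds zero_less_mult_iff)

lemma box_bump_tendsto: "(\<lambda>k. box_bump k a b x) \<longlonglongrightarrow> indicator (box a b) x"
proof (cases "x \<in> box a b")
  case True
  have lim: "(\<lambda>k. flat_exp 0 (real k * t)) \<longlonglongrightarrow> 1" if "t > 0" for t
  proof (rule Lim_transform_eventually)
    show "(\<lambda>k. exp (- (1 / t) * inverse (real k))) \<longlonglongrightarrow> 1"

    proof -
      have "(\<lambda>k. exp (- (1 / t) * inverse (real k))) \<longlonglongrightarrow> exp (- (1 / t) * 0)"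
        by (intro tendsto_exp tendsto_mult tendsto_const lim_inverse_n)
      then show ?thesis by simp
    qed
    show "\<forall>\<^sub>F k in sequentially. exp (- (1 / t) * inverse (real k)) = flat_exp 0 (real k * t)"
      by (rule eventually_mono[OF eventually_gt_at_top[of 0]]) (use that in \<open>auto simp: flat_exp_def field_simps\<close>)
  qed
  have "(\<lambda>k. box_bump k a b x) \<longlonglongrightarrow> (\<Prod>i\<in>(UNIV::'a set). 1 * 1)"
    unfolding box_bump_def using True by (intro tendsto_prod tendsto_mult lim) (auto simp: mem_box_cart)
  then show ?thesis using True by simp
next
  case False
  then have "box_bump k a b x = 0" if "k > 0" for k
    using box_bump_nonzero[OF that] by blast
  then show ?thesis using False
    by (intro tendsto_eventually eventually_mono[OF eventually_gt_at_top[of 0]]) auto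
qed

lemma smooth_fun_box_bump: "smooth_fun (box_bump k a b)"
proof -
  have "smooth_fun (\<lambda>x. flat_exp 0 (k * (x $ i - a $ i)) * flat_exp 0 (k * (b $ i - x $ i)))" for i
    using smooth_fun_mult[OF smooth_fun_flat_exp[of 0 k i "- k * a $ i"] smooth_fun_flat_exp[of 0 "- k" i "k * b $ i"]]
    by (simp add: algebra_simps)
  then show ?thesis unfolding box_bump_def by (intro smooth_fun_prod)
qed

section \<open>Test functions\<close>

lemma test_funI:
  assumes "smooth_fun \<phi>" "compact C" "C \<subseteq> S" "\<And>x. x \<notin> C \<Longrightarrow> \<phi> x = 0"
  shows "test_fun S \<phi>"
proof -
  have "closure {x. \<phi> x \<noteq> 0} \<subseteq> C"
    using assms by (intro closure_minimal compact_imp_closed) auto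
  then show ?thesis
    unfolding test_fun_def using assms compact_closure bounded_subset[OF compact_imp_bounded[OF assms(2)]]
    by (meson closure_subset order_trans)
qed

text \<open>A single compact set serves all derivatives at once: off the closed support the function
  vanishes on an open set, so each of its derivatives does too.\<close>

lemma test_funE:
  assumes "test_fun S \<phi>"
  obtains C where "smooth_fun \<phi>" "compact C" "C \<subseteq> S" "\<And>is x. x \<notin> C \<Longrightarrow> iter_pderiv is \<phi> x = 0"
proof (rule that[of "closure {x. \<phi> x \<noteq> 0}"])
  let ?C = "closure {x. \<phi> x \<noteq> 0}"
  show "iter_pderiv is \<phi> x = 0" if "x \<notin> ?C" for "is" x
  proof -
    have 0: "iter_pderiv is (\<lambda>x. 0) = (\<lambda>x. 0)" by (induction "is") auto
    have "iter_pderiv is \<phi> x = iter_pderiv is (\<lambda>x. 0) x"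
      using that by (intro iter_pderiv_cong[of "- ?C"]) (use closure_subset[of "{x. \<phi> x \<noteq> 0}"] in auto)
    then show ?thesis by (simp add: 0)
  qed
qed (use assms in \<open>auto simp: test_fun_def\<close>)

lemma test_fun_iter_pderiv: "test_fun S \<phi> \<Longrightarrow> test_fun S (iter_pderiv is \<phi>)"
  by (erule test_funE) (rule test_funI, auto intro: smooth_fun_iter_pderiv)

lemma test_fun_pderiv_dir: "test_fun S \<phi> \<Longrightarrow> test_fun S (pderiv_dir i \<phi>)"
  using test_fun_iter_pderiv[of S \<phi> "[i]"] by simp

lemma test_fun_smooth: "test_fun S \<phi> \<Longrightarrow> smooth_fun \<phi>"
  by (simp add: test_fun_def)

lemma test_fun_mono: "test_fun S \<phi> \<Longrightarrow> S \<subseteq> T \<Longrightarrow> test_fun T \<phi>"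
  by (auto simp: test_fun_def)

lemma test_fun_mult: "smooth_fun f \<Longrightarrow> test_fun S g \<Longrightarrow> test_fun S (\<lambda>x. f x * g x)"
  by (erule test_funE, rule test_funI) (auto intro: smooth_fun_mult, metis iter_pderiv.simps(1))

lemma test_fun_bounded:
  assumes "test_fun S \<phi>" obtains B where "B > 0" "\<And>x. \<bar>\<phi> x\<bar> \<le> B"
proof -
  obtain C where C: "smooth_fun \<phi>" "compact C" "\<And>is x. x \<notin> C \<Longrightarrow> iter_pderiv is \<phi> x = 0"
    using test_funE[OF assms] by metis
  have "bounded (\<phi> ` C)"
    using C by (intro compact_imp_bounded compact_continuous_image smooth_fun_continuous)
  then obtain B where B: "B > 0" "\<And>x. x \<in> C \<Longrightarrow> \<bar>\<phi> x\<bar> \<le> B"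
    unfolding bounded_pos by auto
  show ?thesis
  proof (rule that[OF B(1)])
    show "\<bar>\<phi> x\<bar> \<le> B" for x
      using B C(3)[of x "[]"] by (cases "x \<in> C") auto
  qed
qed

lemma test_fun_box_bump: "k > 0 \<Longrightarrow> test_fun UNIV (box_bump k a b)"
  using box_bump_nonzero[of k a b] box_subset_cbox[of a b]
  by (intro test_funI[where C = "cbox a b"] smooth_fun_box_bump) auto

lemma abs_pderiv_sum_le:
  fixes h :: "real^'n"
  assumes "\<And>i. \<bar>d i\<bar> \<le> B"
  shows "\<bar>\<Sum>i\<in>UNIV. h $ i * d i\<bar> \<le> real CARD('n) * B * norm h"
proof -
  have "\<bar>\<Sum>i\<in>UNIV. h $ i * d i\<bar> \<le> (\<Sum>i\<in>(UNIV::'n set). norm h * B)"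
    using assms component_le_norm_cart[of h]
    by (intro order_trans[OF sum_abs] sum_mono) (auto simp: abs_mult intro!: mult_mono)
  then show ?thesis by (simp add: ac_simps)
qed

lemma lipschitz_of_pderiv_bound:
  fixes f :: "real^'n \<Rightarrow> real"
  assumes "\<And>x. f differentiable (at x)" "\<And>i x. \<bar>pderiv_dir i f x\<bar> \<le> B"
  shows "\<bar>f x - f y\<bar> \<le> real CARD('n) * B * norm (x - y)"
proof -
  have "norm (f x - f y) \<le> (real CARD('n) * B) * norm (x - y)"
  proof (rule differentiable_bound[of UNIV f "\<lambda>x h. \<Sum>i\<in>UNIV. h $ i * pderiv_dir i f x"])
    show "onorm (\<lambda>h. \<Sum>i\<in>UNIV. h $ i * pderiv_dir i f x) \<le> real CARD('n) * B" for x
      by (rule onorm_le) (use abs_pderiv_sum_le[of "\<lambda>i. pderiv_dir i f x" B] assms in auto)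
  qed (use has_derivative_pderiv_dir[OF assms(1)] in auto)
  then show ?thesis by simp
qed

text \<open>Bounded second partials make the first partials Lipschitz, and the mean value theorem
  along the segment from \<open>x\<close> to \<open>x + h\<close> gives the remainder. That
  \<open>C\<close> is uniform in \<open>x\<close> is what permits differentiation under the integral
  in convolutions.\<close>

lemma test_fun_taylor:
  fixes \<phi> :: "real^'n \<Rightarrow> real"
  assumes "test_fun S \<phi>"
  obtains C where "C \<ge> 0"
    "\<And>x h. \<bar>\<phi> (x + h) - \<phi> x - (\<Sum>i\<in>UNIV. h $ i * pderiv_dir i \<phi> x)\<bar> \<le> C * (norm h)\<^sup>2"
proof -
  have "\<exists>B>0. \<forall>x. \<bar>pderiv_dir j (pderiv_dir i \<phi>) x\<bar> \<le> B" for i j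
    using test_fun_bounded[OF test_fun_pderiv_dir[OF test_fun_pderiv_dir[OF assms]]] by metis
  then have "\<exists>B. \<forall>i j. B i j > 0 \<and> (\<forall>x. \<bar>pderiv_dir j (pderiv_dir i \<phi>) x\<bar> \<le> B i j)"
    by (intro choice allI) auto
  then obtain B where B: "\<And>i j. B i j > 0" "\<And>i j x. \<bar>pderiv_dir j (pderiv_dir i \<phi>) x\<bar> \<le> B i j"
    by auto
  define M where "M = (\<Sum>i\<in>UNIV. \<Sum>j\<in>UNIV. B i j)"
  have BM: "B i j \<le> M" for i j
  proof -
    have "B i j \<le> (\<Sum>j\<in>UNIV. B i j)" using B(1) by (intro member_le_sum) (auto intro: less_imp_le)
    also have "\<dots> \<le> M" unfolding M_def
      using B(1) by (intro member_le_sum[where f = "\<lambda>i. \<Sum>j\<in>UNIV. B i j"] sum_nonneg) (auto intro: less_imp_le)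
    finally show ?thesis .
  qed
  have lip: "\<bar>pderiv_dir i \<phi> x - pderiv_dir i \<phi> y\<bar> \<le> real CARD('n) * M * norm (x - y)" for i x y
    using assms order_trans[OF B(2) BM] by (intro lipschitz_of_pderiv_bound smooth_fun_differentiable smooth_fun_pderiv_dir)
      (auto simp: test_fun_def)
  show ?thesis
  proof (rule that[of "real CARD('n) * (real CARD('n) * M)"])
    have "0 < M" using B(1) BM less_le_trans by blast
    then show "0 \<le> real CARD('n) * (real CARD('n) * M)" by simp
    fix x h :: "real^'n"
    have "\<exists>t\<in>{0<..<1}. \<phi> (x + 1 *\<^sub>R h) - \<phi> (x + 0 *\<^sub>R h) = (\<Sum>i\<in>UNIV. (1 - 0) * h $ i * pderiv_dir i \<phi> (x + t *\<^sub>R h))"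
    proof (rule mvt)
      show "((\<lambda>t. \<phi> (x + t *\<^sub>R h)) has_derivative (\<lambda>s. \<Sum>i\<in>UNIV. s * h $ i * pderiv_dir i \<phi> (x + t *\<^sub>R h))) (at t)" for t
      proof -
        have "((\<lambda>t. x + t *\<^sub>R h) has_derivative (\<lambda>s. s *\<^sub>R h)) (at t)"
          by (auto intro!: derivative_eq_intros)
        from has_derivative_compose[OF this has_derivative_pderiv_dir[OF smooth_fun_differentiable[OF test_fun_smooth[OF assms]]]]
        show ?thesis by simp
      qed
      show "continuous_on {0..1} (\<lambda>t. \<phi> (x + t *\<^sub>R h))"
        by (intro continuous_on_compose2[OF smooth_fun_continuous[OF test_fun_smooth[OF assms], of UNIV]] continuous_intros) auto
    qed auto
    then obtain t where t: "t \<in> {0<..<1}" "\<phi> (x + h) - \<phi> x = (\<Sum>i\<in>UNIV. h $ i * pderiv_dir i \<phi> (x + t *\<^sub>R h))"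
      by auto
    have "\<bar>pderiv_dir i \<phi> (x + t *\<^sub>R h) - pderiv_dir i \<phi> x\<bar> \<le> real CARD('n) * M * norm h" for i
    proof -
      have "norm (t *\<^sub>R h) \<le> norm h" using t(1) by (simp add: mult_left_le_one_le)
      then show ?thesis using lip[of i "x + t *\<^sub>R h" x] \<open>0 < M\<close>
        by (smt (verit) add_diff_cancel_left' mult_left_mono mult_nonneg_nonneg of_nat_0_le_iff)
    qed
    from abs_pderiv_sum_le[OF this, of h]
    show "\<bar>\<phi> (x + h) - \<phi> x - (\<Sum>i\<in>UNIV. h $ i * pderiv_dir i \<phi> x)\<bar> \<le> real CARD('n) * (real CARD('n) * M) * (norm h)\<^sup>2"
      unfolding t(2) by (simp add: sum_subtractf[symmetric] right_diff_distrib power2_eq_square ac_simps)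
  qed
qed

subsection \<open>Convolution with test functions\<close>

lemma smooth_fun_borel [measurable_dest]: "smooth_fun f \<Longrightarrow> f \<in> borel_measurable borel"
  by (intro borel_measurable_continuous_onI smooth_fun_continuous)

text \<open>The measure space and the map \<open>T\<close> are left general so that one calculus
  covers both ordinary convolution (\<open>T\<close> the identity on \<open>lborel\<close>) and
  averaging over translates along a segment (an interval, with \<open>T t\<close> a multiple of a
  unit vector).\<close>

definition conv :: "'a measure \<Rightarrow> ('a \<Rightarrow> real^'n) \<Rightarrow> ('a \<Rightarrow> real) \<Rightarrow> (real^'n \<Rightarrow> real) \<Rightarrow> real^'n \<Rightarrow> real" where
  "conv M T f \<phi> x = (\<integral>y. f y * \<phi> (x - T y) \<partial>M)"

lemma integrable_conv:
  fixes T :: "'a \<Rightarrow> real^'n"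
  assumes f: "integrable M f" and T [measurable]: "T \<in> borel_measurable M" and \<phi>: "test_fun S \<phi>"
  shows "integrable M (\<lambda>y. f y * \<phi> (x - T y))"
proof -
  obtain B where B: "B > 0" "\<And>x. \<bar>\<phi> x\<bar> \<le> B" using test_fun_bounded[OF \<phi>] by blast
  have [measurable]: "\<phi> \<in> borel_measurable borel" "f \<in> borel_measurable M"
    using test_fun_smooth[OF \<phi>] smooth_fun_borel f by auto
  show ?thesis
  proof (rule Bochner_Integration.integrable_bound)
    show "integrable M (\<lambda>y. B * f y)" using f by simp
    show "AE y in M. norm (f y * \<phi> (x - T y)) \<le> norm (B * f y)"
      using B by (auto simp: abs_mult mult.commute[of B] intro!: AE_I2 mult_left_mono)
  qed measurable
qed

text \<open>The uniform quadratic Taylor remainder of the test function integrates to at most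
  \<open>C * (norm h)\<^sup>2\<close> times the integral of \<open>\<bar>f\<bar>\<close>, so the
  derivative may be taken under the integral sign.\<close>

lemma conv_has_derivative:
  fixes T :: "'a \<Rightarrow> real^'n"
  assumes f: "integrable M f" and T [measurable]: "T \<in> borel_measurable M" and \<phi>: "test_fun S \<phi>"
  shows "(conv M T f \<phi> has_derivative (\<lambda>h. \<Sum>i\<in>UNIV. h $ i * conv M T f (pderiv_dir i \<phi>) x)) (at x)"
proof -
  obtain C where C: "C \<ge> 0"
    "\<And>x h. \<bar>\<phi> (x + h) - \<phi> x - (\<Sum>i\<in>UNIV. h $ i * pderiv_dir i \<phi> x)\<bar> \<le> C * (norm h)\<^sup>2"
    using test_fun_taylor[OF \<phi>] by blast
  note int = integrable_conv[OF f T \<phi>] integrable_conv[OF f T test_fun_pderiv_dir[OF \<phi>]]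
  let ?I = "\<integral>y. \<bar>f y\<bar> \<partial>M"
  have est: "\<bar>conv M T f \<phi> (x + h) - conv M T f \<phi> x - (\<Sum>i\<in>UNIV. h $ i * conv M T f (pderiv_dir i \<phi>) x)\<bar>
      \<le> C * (norm h)\<^sup>2 * ?I" for h
  proof -
    let ?e = "\<lambda>y. \<phi> (x - T y + h) - \<phi> (x - T y) - (\<Sum>i\<in>UNIV. h $ i * pderiv_dir i \<phi> (x - T y))"
    have i1: "integrable M (\<lambda>y. h $ i * (f y * pderiv_dir i \<phi> (x - T y)))" for i
      using int(2) by simp
    have i2: "integrable M (\<lambda>y. f y * \<phi> (x + h - T y))" "integrable M (\<lambda>y. f y * \<phi> (x - T y))"
      by (rule int)+
    have eq: "f y * ?e y = f y * \<phi> (x + h - T y) - f y * \<phi> (x - T y) - (\<Sum>i\<in>UNIV. h $ i * (f y * pderiv_dir i \<phi> (x - T y)))" for y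
      by (simp add: algebra_simps sum_distrib_left)
    have int_e: "integrable M (\<lambda>y. f y * ?e y)"
      unfolding eq by (intro Bochner_Integration.integrable_diff Bochner_Integration.integrable_sum i1 i2)
    have "conv M T f \<phi> (x + h) - conv M T f \<phi> x - (\<Sum>i\<in>UNIV. h $ i * conv M T f (pderiv_dir i \<phi>) x)
        = (\<integral>y. f y * ?e y \<partial>M)"
      unfolding eq conv_def using i1 i2
      by (simp add: Bochner_Integration.integral_diff Bochner_Integration.integral_sum
          Bochner_Integration.integrable_diff Bochner_Integration.integrable_sum)
    also have "\<bar>\<dots>\<bar> \<le> (\<integral>y. C * (norm h)\<^sup>2 * \<bar>f y\<bar> \<partial>M)"
    proof (rule order_trans[OF integral_abs_bound integral_mono])
      show "integrable M (\<lambda>y. \<bar>f y * ?e y\<bar>)" using int_e by (rule integrable_abs)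
      show "integrable M (\<lambda>y. C * (norm h)\<^sup>2 * \<bar>f y\<bar>)" using f by simp
      show "\<bar>f y * ?e y\<bar> \<le> C * (norm h)\<^sup>2 * \<bar>f y\<bar>" for y
        using C(2)[of "x - T y" h] by (simp only: abs_mult mult.commute[of "\<bar>f y\<bar>"] mult_right_mono abs_ge_zero)
    qed
    finally show ?thesis using f by simp
  qed
  show ?thesis
  proof (rule has_derivativeI_sandwich[where e = 1 and H = "\<lambda>y. C * ?I * norm (y - x)"])
    show "bounded_linear (\<lambda>h. \<Sum>i\<in>UNIV. h $ i * conv M T f (pderiv_dir i \<phi>) x)"
      by (intro bounded_linear_sum bounded_linear_mult_const bounded_linear_vec_nth)
    show "norm (conv M T f \<phi> y - conv M T f \<phi> x - (\<Sum>i\<in>UNIV. (y - x) $ i * conv M T f (pderiv_dir i \<phi>) x)) / norm (y - x)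
        \<le> C * ?I * norm (y - x)" if "y \<noteq> x" for y
      using est[of "y - x"] that by (simp add: pos_divide_le_eq power2_eq_square mult_ac)
    show "((\<lambda>y. C * ?I * norm (y - x)) \<longlongrightarrow> 0) (at x)"
      by (auto intro!: tendsto_eq_intros)
  qed simp
qed

lemma
  fixes T :: "'a \<Rightarrow> real^'n"
  assumes f: "integrable M f" and T: "T \<in> borel_measurable M" and \<phi>: "test_fun S \<phi>"
  shows iter_pderiv_conv: "iter_pderiv is (conv M T f \<phi>) = conv M T f (iter_pderiv is \<phi>)"
    and smooth_fun_conv: "smooth_fun (conv M T f \<phi>)"
proof -
  show *: "iter_pderiv is (conv M T f \<phi>) = conv M T f (iter_pderiv is \<phi>)" for "is"
  proof (induction "is")
    case (Cons i "is")
    show ?case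
    proof
      fix x
      show "iter_pderiv (i # is) (conv M T f \<phi>) x = conv M T f (iter_pderiv (i # is) \<phi>) x"
        using pderiv_dirI[OF conv_has_derivative[OF f T test_fun_iter_pderiv[OF \<phi>, of "is"]], of i x]
        by (simp add: Cons.IH axis_def if_distrib[of "\<lambda>x. x * _"] cong: if_cong)
    qed
  qed simp
  show "smooth_fun (conv M T f \<phi>)"
    unfolding smooth_fun_def * using conv_has_derivative[OF f T test_fun_iter_pderiv[OF \<phi>]]
    by (auto simp: differentiable_def)
qed

section \<open>Translations, reflections and integration by parts\<close>

lemma distr_lborel_affine:
  fixes a :: "real^'n"
  assumes "\<bar>c\<bar> = 1"
  shows "distr lborel borel (\<lambda>x. a + c *\<^sub>R x) = lborel"
proof -
  have "c \<noteq> 0" using assms by auto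
  from lborel_affine[OF this, of a] assms show ?thesis by (simp add: density_1)
qed

text \<open>The two relevant values are \<open>c = 1\<close>, a translation, and
  \<open>c = -1\<close>, the substitution \<open>y \<mapsto> x - y\<close> in convolution
  kernels.\<close>

lemma nn_integral_lborel_affine:
  fixes a :: "real^'n" and c :: real
  assumes "f \<in> borel_measurable borel" "\<bar>c\<bar> = 1"
  shows "(\<integral>\<^sup>+x. f (a + c *\<^sub>R x) \<partial>lborel) = (\<integral>\<^sup>+x. f x \<partial>lborel)"
proof -
  have "(\<integral>\<^sup>+x. f x \<partial>lborel) = (\<integral>\<^sup>+x. f x \<partial>distr lborel borel (\<lambda>x. a + c *\<^sub>R x))"
    by (simp add: distr_lborel_affine assms)
  also have "\<dots> = (\<integral>\<^sup>+x. f (a + c *\<^sub>R x) \<partial>lborel)"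
    using assms by (intro nn_integral_distr) auto
  finally show ?thesis by simp
qed

lemma
  fixes a :: "real^'n" and f :: "real^'n \<Rightarrow> real" and c :: real
  assumes f: "f \<in> borel_measurable borel" and c: "\<bar>c\<bar> = 1"
  shows integral_lborel_affine: "(\<integral>x. f (a + c *\<^sub>R x) \<partial>lborel) = (\<integral>x. f x \<partial>lborel)"
    and integrable_lborel_affine: "integrable lborel (\<lambda>x. f (a + c *\<^sub>R x)) \<longleftrightarrow> integrable lborel f"
proof -
  note d = distr_lborel_affine[OF c, of a]
  have T: "(\<lambda>x::real^'n. a + c *\<^sub>R x) \<in> measurable lborel borel" by measurable
  show "(\<integral>x. f (a + c *\<^sub>R x) \<partial>lborel) = (\<integral>x. f x \<partial>lborel)"
    using integral_distr[OF T f] by (simp add: d)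
  show "integrable lborel (\<lambda>x. f (a + c *\<^sub>R x)) \<longleftrightarrow> integrable lborel f"
    using integrable_distr_eq[OF T f] by (simp add: d)
qed

lemma integrable_compact_support:
  fixes f :: "real^'n \<Rightarrow> real"
  assumes "continuous_on UNIV f" "compact C" "\<And>x. x \<notin> C \<Longrightarrow> f x = 0"
  shows "integrable lborel f"
proof -
  have "integrable lborel (\<lambda>x. indicator C x *\<^sub>R f x)"
    using assms by (intro borel_integrable_compact continuous_on_subset[OF assms(1)]) auto
  moreover have "(\<lambda>x. indicator C x *\<^sub>R f x) = f"
    using assms(3) by (auto simp: fun_eq_iff indicator_def)
  ultimately show ?thesis by simp
qed

lemma pderiv_dir_eq_0_outside:
  assumes "closed C" "\<And>x. x \<notin> C \<Longrightarrow> f x = 0" "x \<notin> C"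
  shows "pderiv_dir i f x = 0"
proof -
  have "pderiv_dir i f x = pderiv_dir i (\<lambda>x. 0) x"
    using assms by (intro pderiv_dir_cong[of "- C"]) auto
  then show ?thesis by simp
qed

text \<open>Difference quotients in direction \<open>i\<close> have integral 0 by translation
  invariance. The mean value theorem bounds them uniformly, and dominated convergence passes this to
  the partial derivative.\<close>

lemma integral_pderiv_dir_eq_0:
  fixes f :: "real^'n \<Rightarrow> real"
  assumes diff: "\<And>x. f differentiable (at x)" and cont: "continuous_on UNIV (pderiv_dir i f)"
    and C: "compact C" "\<And>x. x \<notin> C \<Longrightarrow> f x = 0"
  shows "(\<integral>x. pderiv_dir i f x \<partial>lborel) = 0"
proof -
  let ?e = "axis i 1 :: real^'n"
  define t where "t n = inverse (real (Suc n))" for n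
  have t: "t n > 0" "t n \<le> 1" for n unfolding t_def by (auto simp: divide_simps)
  define D where "D n x = (f (t n *\<^sub>R ?e + x) - f x) / t n" for n x
  have f_cont: "continuous_on UNIV f"
    using diff by (simp add: continuous_at_imp_continuous_on differentiable_imp_continuous_within)
  have [measurable]: "f \<in> borel_measurable borel" "pderiv_dir i f \<in> borel_measurable borel"
    using f_cont cont by (auto intro: borel_measurable_continuous_onI)
  have f_int: "integrable lborel f" using f_cont C by (rule integrable_compact_support)
  have "bounded (pderiv_dir i f ` C)"
    using C cont by (intro compact_imp_bounded compact_continuous_image) (auto intro: continuous_on_subset)
  then obtain B where B: "B > 0" "\<And>x. x \<in> C \<Longrightarrow> \<bar>pderiv_dir i f x\<bar> \<le> B"
    unfolding bounded_pos by auto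
  have B': "\<bar>pderiv_dir i f x\<bar> \<le> B" for x
  proof (cases "x \<in> C")
    case False
    have "pderiv_dir i f x = 0"
      by (rule pderiv_dir_eq_0_outside[OF compact_imp_closed[OF C(1)] _ False]) (rule C(2))
    then show ?thesis using B by simp
  qed (use B in auto)
  have line: "((\<lambda>s. f (x + s *\<^sub>R ?e)) has_real_derivative pderiv_dir i f (x + s *\<^sub>R ?e)) (at s)" for x s
  proof -
    have "((\<lambda>s. x + s *\<^sub>R ?e) has_derivative (\<lambda>s. s *\<^sub>R ?e)) (at s)"
      by (auto intro!: derivative_eq_intros)
    from has_derivative_compose[OF this has_derivative_pderiv_dir[OF diff]]
    show ?thesis unfolding has_field_derivative_def
      by (simp add: axis_def if_distrib[of "\<lambda>x. _ * x"] if_distrib[of "\<lambda>x. x * _"] mult.commute[of "pderiv_dir i f _"] mult_commute_abs cong: if_cong)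
  qed
  have D_bound: "\<bar>D n x\<bar> \<le> B" for n x
  proof -
    have "\<exists>z>0. z < t n \<and> f (x + t n *\<^sub>R ?e) - f (x + 0 *\<^sub>R ?e) = (t n - 0) * pderiv_dir i f (x + z *\<^sub>R ?e)"
      using t(1) line by (intro MVT2) auto
    then show ?thesis unfolding D_def using t(1)[of n] B' by (auto simp: add.commute abs_mult)
  qed
  obtain R where R: "\<And>x. x \<in> C \<Longrightarrow> norm x \<le> R"
    using C(1) compact_imp_bounded bounded_iff by metis
  \<comment> \<open>Since the steps \<open>t n\<close> are at most 1, enlarging the radius by 1 puts
    all difference quotients into one ball, which yields an integrable majorant.\<close>
  have D_supp: "D n x = 0" if "x \<notin> cball 0 (R + 1)" for n x
  proof -
    have "norm x \<le> norm (t n *\<^sub>R ?e + x) + norm (t n *\<^sub>R ?e)"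
      by (metis add_diff_cancel_left' norm_triangle_ineq4)
    then have "x \<notin> C" "t n *\<^sub>R ?e + x \<notin> C"
      using that t[of n] R[of x] R[of "t n *\<^sub>R ?e + x"] by (auto simp: norm_axis_1)
    then show ?thesis unfolding D_def using C(2) by simp
  qed
  have "(\<lambda>n. \<integral>x. D n x \<partial>lborel) \<longlonglongrightarrow> (\<integral>x. pderiv_dir i f x \<partial>lborel)"
  proof (rule integral_dominated_convergence)
    show "integrable lborel (\<lambda>x::real^'n. B * indicator (cball 0 (R + 1)) x)"
      using borel_integrable_compact[of "cball 0 (R+1)" "\<lambda>x::real^'n. B"] by (simp add: mult.commute)
    show "AE x in lborel. (\<lambda>n. D n x) \<longlonglongrightarrow> pderiv_dir i f x"
    proof (intro AE_I2)
      fix x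
      have "((\<lambda>h. (f (x + (0 + h) *\<^sub>R ?e) - f (x + 0 *\<^sub>R ?e)) / h) \<longlongrightarrow> pderiv_dir i f x) (at 0)"
        using line[of x 0] unfolding DERIV_def by simp
      moreover have "filterlim t (at 0) sequentially"
        unfolding filterlim_at t_def using LIMSEQ_inverse_real_of_nat by (auto simp del: of_nat_Suc)
      ultimately have "(\<lambda>n. (f (x + (0 + t n) *\<^sub>R ?e) - f (x + 0 *\<^sub>R ?e)) / t n) \<longlonglongrightarrow> pderiv_dir i f x"
        by (rule filterlim_compose)
      then show "(\<lambda>n. D n x) \<longlonglongrightarrow> pderiv_dir i f x" by (simp add: D_def add.commute)
    qed
    show "AE x in lborel. norm (D n x) \<le> B * indicator (cball 0 (R + 1)) x" for n
      using D_bound D_supp by (auto simp: indicator_def)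
  qed (auto simp: D_def)
  moreover have "(\<integral>x. D n x \<partial>lborel) = 0" for n
    using f_int integrable_lborel_affine[of f 1 "t n *\<^sub>R ?e"] integral_lborel_affine[of f 1 "t n *\<^sub>R ?e"]
    unfolding D_def by (simp add: Bochner_Integration.integral_diff)
  ultimately show ?thesis by (simp add: LIMSEQ_const_iff)
qed

subsection \<open>Weak derivatives\<close>

lemma loc_integrable_continuous:
  assumes "continuous_on UNIV f"
  shows "loc_integrable S f"
  unfolding loc_integrable_def set_integrable_def
proof safe
  fix C :: "(real^'a) set" assume C: "compact C"
  have "integrable lborel (\<lambda>x. indicator C x *\<^sub>R f x)"
    by (rule borel_integrable_compact[OF C continuous_on_subset[OF assms]]) auto
  then show "integrable lebesgue (\<lambda>x. indicator C x *\<^sub>R f x)"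
    by (subst integrable_completion) (auto dest: borel_measurable_integrable)
qed

lemma set_integral_test_fun:
  assumes "test_fun S \<phi>"
  shows "(LINT x:S|M. f x * iter_pderiv is \<phi> x) = (LINT x|M. f x * iter_pderiv is \<phi> x)"
    and "(LINT x:S|M. f x * \<phi> x) = (LINT x|M. f x * \<phi> x)"
proof -
  obtain C where C: "C \<subseteq> S" "\<And>is x. x \<notin> C \<Longrightarrow> iter_pderiv is \<phi> x = 0"
    using test_funE[OF assms] by metis
  show *: "(LINT x:S|M. f x * iter_pderiv is \<phi> x) = (LINT x|M. f x * iter_pderiv is \<phi> x)" for "is"
    unfolding set_lebesgue_integral_def using C
    by (intro Bochner_Integration.integral_cong) (auto simp: indicator_def)
  from *[of "[]"] show "(LINT x:S|M. f x * \<phi> x) = (LINT x|M. f x * \<phi> x)" by simp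
qed

text \<open>Integration by parts: the product of \<open>w\<close> with a test function has compact
  support, so its partial derivative integrates to 0.\<close>

lemma weak_deriv_classical:
  fixes w :: "real^'n \<Rightarrow> real"
  assumes diff: "\<And>x. w differentiable (at x)" and cont: "continuous_on UNIV (pderiv_dir i w)"
  shows "weak_deriv S [i] w (pderiv_dir i w)"
  unfolding weak_deriv_def
proof (intro conjI allI impI loc_integrable_continuous cont)
  show w: "continuous_on UNIV w"
    using diff by (simp add: continuous_at_imp_continuous_on differentiable_imp_continuous_within)
  fix \<phi> assume \<phi>: "test_fun S \<phi>"
  obtain C where C: "smooth_fun \<phi>" "compact C" "\<And>is x. x \<notin> C \<Longrightarrow> iter_pderiv is \<phi> x = 0"
    using test_funE[OF \<phi>] by metis
  have \<phi>0: "\<phi> x = 0" "pderiv_dir i \<phi> x = 0" if "x \<notin> C" for x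
    using C(3)[OF that, of "[]"] C(3)[OF that, of "[i]"] by auto
  have c\<phi>: "continuous_on UNIV \<phi>" "continuous_on UNIV (pderiv_dir i \<phi>)"
    using C(1) smooth_fun_continuous smooth_fun_pderiv_dir by blast+
  have prod: "pderiv_dir i (\<lambda>x. w x * \<phi> x) = (\<lambda>x. w x * pderiv_dir i \<phi> x + pderiv_dir i w x * \<phi> x)"
    using diff smooth_fun_differentiable[OF C(1)] by (auto simp: pderiv_dir_mult)
  have "(\<integral>x. w x * pderiv_dir i \<phi> x + pderiv_dir i w x * \<phi> x \<partial>lborel) = 0"
    by (rule integral_pderiv_dir_eq_0[of "\<lambda>x. w x * \<phi> x" i C, unfolded prod])
      (use \<phi>0 C diff smooth_fun_differentiable[OF C(1)] w cont c\<phi> in \<open>auto intro!: continuous_intros derivative_intros\<close>)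
  moreover have int: "integrable lborel (\<lambda>x. w x * pderiv_dir i \<phi> x)" "integrable lborel (\<lambda>x. pderiv_dir i w x * \<phi> x)"
    using \<phi>0 w cont c\<phi> by (auto intro!: integrable_compact_support[OF _ C(2)] continuous_intros)
  ultimately have "(\<integral>x. w x * pderiv_dir i \<phi> x \<partial>lborel) = - (\<integral>x. pderiv_dir i w x * \<phi> x \<partial>lborel)"
    by simp
  then show "(LINT x:S|lebesgue. w x * iter_pderiv [i] \<phi> x) = (- 1) ^ length [i] * (LINT x:S|lebesgue. pderiv_dir i w x * \<phi> x)"
    unfolding set_integral_test_fun[OF \<phi>] using borel_measurable_integrable[OF int(1)] borel_measurable_integrable[OF int(2)]
    by (simp add: integral_completion)
qed

text \<open>The derivative of a test function along \<open>js\<close> is again a test function and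
  may be inserted into the identity for \<open>is\<close>; the signs multiply.\<close>

lemma weak_deriv_append:
  assumes "weak_deriv S is w g" "weak_deriv S js g h"
  shows "weak_deriv S (is @ js) w h"
  using assms test_fun_iter_pderiv[of S]
  unfolding weak_deriv_def by (simp add: iter_pderiv_append power_add)

section \<open>The fundamental lemma and uniqueness of weak derivatives\<close>

lemma loc_integrable_borel:
  fixes f :: "real^'n \<Rightarrow> real"
  assumes "loc_integrable UNIV f"
  shows "f \<in> borel_measurable lebesgue"
proof -
  have m: "(\<lambda>x. indicator (cball 0 (real n)) x *\<^sub>R f x) \<in> borel_measurable lebesgue" for n
    using assms unfolding loc_integrable_def set_integrable_def by (intro borel_measurable_integrable) auto
  show ?thesis
  proof (rule borel_measurable_LIMSEQ_metric[OF m])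
    fix x :: "real^'n"
    have "\<forall>\<^sub>F n in sequentially. norm x \<le> real n" by (rule eventually_ge_at_top[THEN filterlim_real_sequentially[THEN filterlim_iff[THEN iffD1], rule_format]])
    then show "(\<lambda>n. indicator (cball 0 (real n)) x *\<^sub>R f x) \<longlonglongrightarrow> f x"
      by (intro tendsto_eventually) (erule eventually_mono, auto)
  qed
qed

lemma loc_integrable_mult_test_fun:
  assumes f: "loc_integrable UNIV f" and \<phi>: "test_fun S \<phi>"
  shows "integrable lebesgue (\<lambda>x. f x * \<phi> x)"
proof -
  obtain C where C: "compact C" "\<And>is x. x \<notin> C \<Longrightarrow> iter_pderiv is \<phi> x = 0"
    using test_funE[OF \<phi>] by metis
  obtain B where B: "B > 0" "\<And>x. \<bar>\<phi> x\<bar> \<le> B" using test_fun_bounded[OF \<phi>] by blast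
  note [measurable] = loc_integrable_borel[OF f] smooth_fun_borel[OF test_fun_smooth[OF \<phi>]]
  have [measurable]: "\<phi> \<in> borel_measurable lebesgue"
    by (rule measurable_completion) simp
  have i: "integrable lebesgue (\<lambda>x. indicator C x *\<^sub>R f x)"
    using f C(1) unfolding loc_integrable_def set_integrable_def by simp
  show ?thesis
  proof (rule Bochner_Integration.integrable_bound[OF integrable_mult_right[OF i, of B]])
    show "AE x in lebesgue. norm (f x * \<phi> x) \<le> norm (B * (indicator C x *\<^sub>R f x))"
    proof (intro AE_I2)
      fix x
      have "norm (f x * \<phi> x) \<le> \<bar>f x\<bar> * B" using B(2)[of x] by (simp add: abs_mult mult_left_mono)
      then show "norm (f x * \<phi> x) \<le> norm (B * (indicator C x *\<^sub>R f x))"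
        using C(2)[of x "[]"] B(1) by (cases "x \<in> C") (auto simp: abs_mult mult.commute)
    qed
  qed measurable
qed

text \<open>Box bumps converge to indicators of open boxes, so a Borel representative
  \<open>g\<close> integrates to 0 over every box. Boxes form an intersection-stable generator of
  the Borel sets; hence the measures with densities the positive and the negative part of
  \<open>g\<close> coincide, and so do the densities.\<close>

lemma AE_eq_0_if_test_fun_integrals_eq_0:
  fixes f :: "real^'n \<Rightarrow> real"
  assumes f: "loc_integrable UNIV f"
    and 0: "\<And>\<phi>. test_fun UNIV \<phi> \<Longrightarrow> (\<integral>x. f x * \<phi> x \<partial>lebesgue) = 0"
  shows "AE x in lebesgue. f x = 0"
proof -
  obtain g where g [measurable]: "g \<in> borel_measurable lborel" and fg: "AE x in lborel. f x = g x"
    using completion_ex_borel_measurable_real[OF loc_integrable_borel[OF f]] by blast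
  have fg': "AE x in lebesgue. f x = g x" using fg by (rule AE_completion)
  note fm [measurable] = loc_integrable_borel[OF f] measurable_completion[OF g]
  have int: "integrable lborel (\<lambda>x. indicator C x * g x)" if "compact C" for C
  proof -
    have "integrable lebesgue (\<lambda>x. indicator C x *\<^sub>R f x)"
      using f that unfolding loc_integrable_def set_integrable_def by simp
    moreover have "C \<in> sets borel" using that by (simp add: borel_compact)
    ultimately have "integrable lebesgue (\<lambda>x. indicator C x *\<^sub>R g x)"
      using fg' by (elim integrable_cong_AE_imp) (auto intro: borel_measurable_indicator measurable_completion)
    then show ?thesis using \<open>C \<in> sets borel\<close> by (simp add: integrable_completion)
  qed
  have box0: "(\<integral>x. indicator (box a b) x * g x \<partial>lborel) = 0" for a b :: "real^'n"
  proof -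
    have "(\<lambda>k. \<integral>x. box_bump (Suc k) a b x * g x \<partial>lborel) \<longlonglongrightarrow> (\<integral>x. indicator (box a b) x * g x \<partial>lborel)"
    proof (rule integral_dominated_convergence)
      show "integrable lborel (\<lambda>x. \<bar>indicator (cbox a b) x * g x\<bar>)"
        by (intro integrable_abs int compact_cbox)
      show "(\<lambda>x. box_bump (Suc k) a b x * g x) \<in> borel_measurable lborel" for k
        using smooth_fun_borel[OF smooth_fun_box_bump] by measurable
      show "AE x in lborel. (\<lambda>k. box_bump (Suc k) a b x * g x) \<longlonglongrightarrow> indicator (box a b) x * g x"
        by (intro AE_I2 tendsto_mult tendsto_const LIMSEQ_Suc[OF box_bump_tendsto])
      show "AE x in lborel. norm (box_bump (Suc k) a b x * g x) \<le> \<bar>indicator (cbox a b) x * g x\<bar>" for k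
      proof (intro AE_I2)
        fix x
        show "norm (box_bump (Suc k) a b x * g x) \<le> \<bar>indicator (cbox a b) x * g x\<bar>"
          using box_bump_bounds[of "Suc k" a b x] box_bump_nonzero[of "Suc k" a b x] box_subset_cbox[of a b]
          by (cases "x \<in> cbox a b") (auto simp: abs_mult mult_left_le_one_le)
      qed
    qed measurable
    moreover have "(\<integral>x. box_bump (Suc k) a b x * g x \<partial>lborel) = 0" for k
    proof -
      note [measurable] = smooth_fun_borel[OF smooth_fun_box_bump]
      have [measurable]: "box_bump (Suc k) a b \<in> borel_measurable lebesgue"
        by (rule measurable_completion) simp
      have "(\<integral>x. box_bump (Suc k) a b x * g x \<partial>lborel) = (\<integral>x. box_bump (Suc k) a b x * g x \<partial>lebesgue)"
        by (rule integral_completion[symmetric]) measurable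
      also have "\<dots> = (\<integral>x. f x * box_bump (Suc k) a b x \<partial>lebesgue)"
        using fg' by (intro integral_cong_AE) auto
      also have "\<dots> = 0" by (intro 0 test_fun_box_bump) simp
      finally show ?thesis .
    qed
    ultimately show ?thesis by (simp add: LIMSEQ_const_iff)
  qed
  have int_box: "integrable lborel (\<lambda>x. indicator (box a b) x * g x)" for a b :: "real^'n"
    by (rule Bochner_Integration.integrable_bound[OF int[OF compact_cbox[of a b]]])
      (use box_subset_cbox[of a b] in \<open>auto simp: indicator_def\<close>)
  \<comment> \<open>As \<open>ennreal\<close> sends negative numbers to 0, \<open>?M 1\<close> has
    the positive part of \<open>g\<close> as density and \<open>?M (-1)\<close> the negative part.
    At most one of them is nonzero at a point, so equality forces \<open>g x = 0\<close>.\<close>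
  let ?M = "\<lambda>s. density lborel (\<lambda>x. ennreal (s * g x))"
  have fin: "(\<integral>\<^sup>+x. ennreal (s * g x) * indicator (box a b) x \<partial>lborel)
      = ennreal (\<integral>x. indicator (box a b) x * max 0 (s * g x) \<partial>lborel)" (is ?A)
    and int_s: "integrable lborel (\<lambda>x. indicator (box a b) x * max 0 (s * g x))" (is ?B) for s a b
  proof -
    show ?B
      using integrable_mult_right[OF int_box[of a b], of s]
      by (rule Bochner_Integration.integrable_bound)
        (auto simp: indicator_def abs_mult[symmetric] intro!: AE_I2)
    from nn_integral_eq_integral[OF this] show ?A
      by (auto simp: indicator_def ennreal_max_0 intro!: nn_integral_cong elim!: trans[rotated])
  qed
  have "?M 1 = ?M (-1)"
  proof (rule measure_eqI_generator_eq)
    let ?E = "range (\<lambda>(a, b). box a b::(real^'n) set)"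
    show "Int_stable ?E" by (auto simp: Int_stable_def box_Int_box)
    show "?E \<subseteq> Pow UNIV" "sets (?M 1) = sigma_sets UNIV ?E" "sets (?M (-1)) = sigma_sets UNIV ?E"
      by (simp_all add: borel_eq_box)
    let ?A = "\<lambda>n::nat. box (- (real n *\<^sub>R One)) (real n *\<^sub>R One) :: (real^'n) set"
    show "range ?A \<subseteq> ?E" "(\<Union>i. ?A i) = UNIV"
      unfolding UN_box_eq_UNIV by auto
    show "emeasure (?M 1) (?A i) \<noteq> \<infinity>" for i
      by (subst emeasure_density) (simp_all only: fin, auto)
    show "emeasure (?M 1) X = emeasure (?M (-1)) X" if XE: "X \<in> ?E" for X
    proof -
      obtain a b where X: "X = box a b" using XE by auto
      have "(\<integral>x. indicator X x * max 0 (1 * g x) \<partial>lborel) - (\<integral>x. indicator X x * max 0 ((-1) * g x) \<partial>lborel)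
        = (\<integral>x. indicator X x * max 0 (1 * g x) - indicator X x * max 0 ((-1) * g x) \<partial>lborel)"
        unfolding X by (rule Bochner_Integration.integral_diff[symmetric, OF int_s int_s])
      also have "\<dots> = (\<integral>x. indicator X x * g x \<partial>lborel)"
        by (intro Bochner_Integration.integral_cong) (auto simp: max_def indicator_def)
      finally show ?thesis unfolding X box0
        by (subst (1 2) emeasure_density) (auto simp only: fin, auto)
    qed
  qed
  then have "AE x in lborel. ennreal (1 * g x) = ennreal ((-1) * g x)"
    by (subst (asm) sigma_finite_measure.density_unique_iff[OF sigma_finite_lborel]) auto
  with fg have "AE x in lborel. f x = 0"
  proof eventually_elim
    case (elim x)
    then show ?case by (cases "g x" "0::real" rule: linorder_cases) (auto simp: ennreal_neg)
  qed
  then show ?thesis by (rule AE_completion)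
qed

lemma loc_integrable_diff:
  "loc_integrable S f \<Longrightarrow> loc_integrable S g \<Longrightarrow> loc_integrable S (\<lambda>x. f x - g x)"
  unfolding loc_integrable_def set_integrable_def
  by (auto simp: right_diff_distrib intro: Bochner_Integration.integrable_diff)

lemma weak_deriv_diff:
  assumes f: "weak_deriv UNIV is f f'" and g: "weak_deriv UNIV is g g'"
  shows "weak_deriv UNIV is (\<lambda>x. f x - g x) (\<lambda>x. f' x - g' x)"
  unfolding weak_deriv_def
proof (intro conjI allI impI loc_integrable_diff)
  show li: "loc_integrable UNIV f" "loc_integrable UNIV f'" "loc_integrable UNIV g" "loc_integrable UNIV g'"
    using f g by (auto simp: weak_deriv_def)
  fix \<phi> :: "real^'a \<Rightarrow> real" assume \<phi>: "test_fun UNIV \<phi>"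
  note i = loc_integrable_mult_test_fun[OF _ \<phi>] loc_integrable_mult_test_fun[OF _ test_fun_iter_pderiv[OF \<phi>]]
  have "(\<integral>x. f x * iter_pderiv is \<phi> x \<partial>lebesgue) = (-1) ^ length is * (\<integral>x. f' x * \<phi> x \<partial>lebesgue)"
    "(\<integral>x. g x * iter_pderiv is \<phi> x \<partial>lebesgue) = (-1) ^ length is * (\<integral>x. g' x * \<phi> x \<partial>lebesgue)"
    using f g \<phi> unfolding weak_deriv_def by (auto simp: set_lebesgue_integral_def)
  with i li show "(LINT x:UNIV|lebesgue. (f x - g x) * iter_pderiv is \<phi> x) =
          (- 1) ^ length is * (LINT x:UNIV|lebesgue. (f' x - g' x) * \<phi> x)"
    by (simp add: set_lebesgue_integral_def left_diff_distrib right_diff_distrib)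
qed

lemma weak_deriv_unique:
  assumes "weak_deriv UNIV is f g" "weak_deriv UNIV is f h"
  shows "AE x in lebesgue. g x = h x"
proof -
  have d: "weak_deriv UNIV is (\<lambda>x. f x - f x) (\<lambda>x. g x - h x)"
    using assms by (rule weak_deriv_diff)
  have "AE x in lebesgue. g x - h x = 0"
  proof (rule AE_eq_0_if_test_fun_integrals_eq_0)
    show "loc_integrable UNIV (\<lambda>x. g x - h x)" using d by (simp add: weak_deriv_def)
    show "(\<integral>x. (g x - h x) * \<phi> x \<partial>lebesgue) = 0" if "test_fun UNIV \<phi>" for \<phi>
      using d that unfolding weak_deriv_def by (auto simp: set_lebesgue_integral_def)
  qed
  then show ?thesis by simp
qed

lemma weak_deriv_cong_AE:
  assumes w: "weak_deriv UNIV is f g" and f: "AE x in lebesgue. f x = f' x" and g: "AE x in lebesgue. g x = g' x"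
    and m: "f' \<in> borel_measurable lebesgue" "g' \<in> borel_measurable lebesgue"
  shows "weak_deriv UNIV is f' g'"
proof -
  have *: "loc_integrable UNIV h'" if "loc_integrable UNIV h" "AE x in lebesgue. h x = h' x"
    "h' \<in> borel_measurable lebesgue" for h h' :: "real^'a \<Rightarrow> real"
    unfolding loc_integrable_def set_integrable_def
  proof safe
    fix C :: "(real^'a) set" assume C: "compact C"
    have [measurable]: "C \<in> sets lebesgue" using C by (simp add: borel_compact)
    note [measurable] = loc_integrable_borel[OF that(1)] that(3)
    show "integrable lebesgue (\<lambda>x. indicator C x *\<^sub>R h' x)"
    proof (rule integrable_cong_AE_imp)
      show "integrable lebesgue (\<lambda>x. indicator C x *\<^sub>R h x)"
        using that(1) C unfolding loc_integrable_def set_integrable_def by simp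
      show "AE x in lebesgue. indicator C x *\<^sub>R h x = indicator C x *\<^sub>R h' x"
        using that(2) by eventually_elim simp
    qed measurable
  qed
  have li: "loc_integrable UNIV f" "loc_integrable UNIV g" using w by (auto simp: weak_deriv_def)
  note [measurable] = m loc_integrable_borel[OF li(1)] loc_integrable_borel[OF li(2)]
  have eq: "(\<integral>x. h x * \<psi> x \<partial>lebesgue) = (\<integral>x. h' x * \<psi> x \<partial>lebesgue)"
    if "smooth_fun \<psi>" "AE x in lebesgue. h x = h' x" "h \<in> borel_measurable lebesgue" "h' \<in> borel_measurable lebesgue"
    for h h' \<psi> :: "real^'a \<Rightarrow> real"
  proof -
    note [measurable] = that(3,4)
    have "\<psi> \<in> borel_measurable lborel" using smooth_fun_borel[OF that(1)] by simp
    then have [measurable]: "\<psi> \<in> borel_measurable lebesgue" by (rule measurable_completion)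
    show ?thesis using that(2) by (intro integral_cong_AE) auto
  qed
  show ?thesis
    unfolding weak_deriv_def
  proof (intro conjI allI impI)
    show "loc_integrable UNIV f'" "loc_integrable UNIV g'" using * li f g m by blast+
    fix \<phi> :: "real^'a \<Rightarrow> real" assume \<phi>: "test_fun UNIV \<phi>"
    then have s: "smooth_fun \<phi>" "smooth_fun (iter_pderiv is \<phi>)"
      by (auto intro: test_fun_smooth smooth_fun_iter_pderiv)
    have "(\<integral>x. f x * iter_pderiv is \<phi> x \<partial>lebesgue) = (-1) ^ length is * (\<integral>x. g x * \<phi> x \<partial>lebesgue)"
      using w \<phi> unfolding weak_deriv_def by (auto simp: set_lebesgue_integral_def)
    then show "(LINT x:UNIV|lebesgue. f' x * iter_pderiv is \<phi> x) = (- 1) ^ length is * (LINT x:UNIV|lebesgue. g' x * \<phi> x)"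
      using eq[OF s(2) f] eq[OF s(1) g] by (simp add: set_lebesgue_integral_def)
  qed
qed

section \<open>Affine substitution and scaling\<close>

lemma sum_axis_mult: "(\<Sum>j\<in>UNIV. axis i 1 $ j * d j) = (d i :: real)"
  by (simp add: axis_def if_distrib[of "\<lambda>x. x * _"] cong: if_cong)

lemma
  fixes f :: "real^'n \<Rightarrow> real"
  assumes "smooth_fun f"
  shows iter_pderiv_affine: "iter_pderiv is (\<lambda>x. f (a + c *\<^sub>R x)) = (\<lambda>x. c ^ length is * iter_pderiv is f (a + c *\<^sub>R x))"
    and smooth_fun_affine: "smooth_fun (\<lambda>x. f (a + c *\<^sub>R x))"
proof -
  have der: "((\<lambda>x. d * iter_pderiv is f (a + c *\<^sub>R x)) has_derivative
      (\<lambda>h. \<Sum>i\<in>UNIV. h $ i * (d * c * pderiv_dir i (iter_pderiv is f) (a + c *\<^sub>R x)))) (at x)" for d "is" x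
  proof -
    have "((\<lambda>x. a + c *\<^sub>R x) has_derivative (\<lambda>h. c *\<^sub>R h)) (at x)"
      by (auto intro!: derivative_eq_intros)
    from has_derivative_compose[OF this has_derivative_pderiv_dir[OF smooth_fun_differentiable[OF smooth_fun_iter_pderiv[OF assms]]]]
    have "((\<lambda>x. d * iter_pderiv is f (a + c *\<^sub>R x)) has_derivative
      (\<lambda>h. d * (\<Sum>i\<in>UNIV. (c *\<^sub>R h) $ i * pderiv_dir i (iter_pderiv is f) (a + c *\<^sub>R x)))) (at x)"
      by (auto intro!: derivative_eq_intros)
    then show ?thesis by (simp add: sum_distrib_left ac_simps)
  qed
  show *: "iter_pderiv is (\<lambda>x. f (a + c *\<^sub>R x)) = (\<lambda>x. c ^ length is * iter_pderiv is f (a + c *\<^sub>R x))" for "is"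
  proof (induction "is")
    case (Cons i "is")
    show ?case
    proof
      fix x
      show "iter_pderiv (i # is) (\<lambda>x. f (a + c *\<^sub>R x)) x = c ^ length (i # is) * iter_pderiv (i # is) f (a + c *\<^sub>R x)"
        using pderiv_dirI[OF der[of "c ^ length is" "is"], of i x, unfolded sum_axis_mult]
        by (simp add: Cons.IH)
    qed
  qed simp
  show "smooth_fun (\<lambda>x. f (a + c *\<^sub>R x))"
    unfolding smooth_fun_def * using der by (auto simp: differentiable_def)
qed

lemma test_fun_affine:
  fixes \<phi> :: "real^'n \<Rightarrow> real"
  assumes "test_fun S \<phi>" "c \<noteq> 0"
  shows "test_fun UNIV (\<lambda>x. \<phi> (a + c *\<^sub>R x))"
proof -
  obtain C where C: "smooth_fun \<phi>" "compact C" "\<And>is x. x \<notin> C \<Longrightarrow> iter_pderiv is \<phi> x = 0"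
    using test_funE[OF assms(1)] by metis
  show ?thesis
  proof (rule test_funI[where C = "(\<lambda>x. (1 / c) *\<^sub>R (x - a)) ` C"])
    show "smooth_fun (\<lambda>x. \<phi> (a + c *\<^sub>R x))" using C(1) by (rule smooth_fun_affine)
    show "compact ((\<lambda>x. (1 / c) *\<^sub>R (x - a)) ` C)"
      by (intro compact_continuous_image continuous_intros C)
    show "\<phi> (a + c *\<^sub>R x) = 0" if "x \<notin> (\<lambda>x. (1 / c) *\<^sub>R (x - a)) ` C" for x
    proof -
      have "a + c *\<^sub>R x \<notin> C"
      proof
        assume "a + c *\<^sub>R x \<in> C"
        then have "(1 / c) *\<^sub>R ((a + c *\<^sub>R x) - a) \<in> (\<lambda>x. (1 / c) *\<^sub>R (x - a)) ` C" by blast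
        then show False using that assms(2) by simp
      qed
      then show ?thesis using C(3)[of _ "[]"] by simp
    qed
  qed simp
qed

lemma test_fun_cmult: "test_fun S \<phi> \<Longrightarrow> test_fun S (\<lambda>x. c * \<phi> x)"
  by (rule test_fun_mult[OF smooth_fun_const])

lemma iter_pderiv_cmult:
  assumes "smooth_fun f"
  shows "iter_pderiv is (\<lambda>x. c * f x) = (\<lambda>x. c * iter_pderiv is f x)"
proof (induction "is")
  case (Cons i "is")
  have "iter_pderiv is f differentiable at x" for x
    using assms by (intro smooth_fun_differentiable smooth_fun_iter_pderiv)
  then show ?case
    by (auto simp: Cons.IH pderiv_dir_mult)
qed simp

subsection \<open>Mollifiers and cutoff functions\<close>

text \<open>The bump lives on the cube of half-width \<epsilon>, not on a ball. Bounding the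
  Euclidean norm by the sum of the coordinates gives the support radius
  \<open>CARD('n) * \<epsilon>\<close>, the source of this factor in everything below. The summand
  \<open>0 +\<close> matches the affine form of \<open>test_fun_affine\<close>.\<close>

definition mollifier :: "real \<Rightarrow> real^'n \<Rightarrow> real" where
  "mollifier \<epsilon> x = box_bump 1 (vec (-1)) (vec 1) (0 + (1 / \<epsilon>) *\<^sub>R x)
     / (\<integral>y. box_bump 1 (vec (-1)) (vec 1) (0 + (1 / \<epsilon>) *\<^sub>R y :: real^'n) \<partial>lborel)"

lemma
  fixes x :: "real^'n"
  assumes "\<epsilon> > 0"
  shows mollifier_nonneg: "mollifier \<epsilon> x \<ge> 0"
    and test_fun_mollifier: "test_fun UNIV (mollifier \<epsilon> :: real^'n \<Rightarrow> real)"
    and mollifier_eq_0: "norm x \<ge> real CARD('n) * \<epsilon> \<Longrightarrow> mollifier \<epsilon> x = 0"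
    and iter_pderiv_mollifier_eq_0: "norm x > real CARD('n) * \<epsilon> \<Longrightarrow> iter_pderiv is (mollifier \<epsilon>) x = 0"
    and integral_mollifier: "(\<integral>y. mollifier \<epsilon> (y :: real^'n) \<partial>lborel) = 1"
    and integrable_mollifier: "integrable lborel (mollifier \<epsilon> :: real^'n \<Rightarrow> real)"
proof -
  let ?b = "box_bump 1 (vec (-1)) (vec 1) :: real^'n \<Rightarrow> real"
  let ?f = "\<lambda>x. ?b (0 + (1 / \<epsilon>) *\<^sub>R x)"
  have tb: "test_fun UNIV ?b" using test_fun_box_bump[of 1 "vec (-1)" "vec 1"] by simp
  have tf: "test_fun UNIV ?f" by (rule test_fun_affine[OF tb]) (use assms in simp)
  have m: "mollifier \<epsilon> = (\<lambda>x. (1 / (\<integral>y. ?f y \<partial>lborel)) * ?f x)"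
    by (auto simp: mollifier_def)
  show t: "test_fun UNIV (mollifier \<epsilon> :: real^'n \<Rightarrow> real)"
    unfolding m by (rule test_fun_cmult[OF tf])
  have int: "integrable lborel g" if g: "test_fun UNIV g" for g :: "real^'n \<Rightarrow> real"
  proof -
    obtain C where "smooth_fun g" "compact C" "\<And>is x. x \<notin> C \<Longrightarrow> iter_pderiv is g x = 0"
      using test_funE[OF g] by metis
    from this(1,2) this(3)[of _ "[]"] show ?thesis
      by (intro integrable_compact_support[OF smooth_fun_continuous]) auto
  qed
  show "integrable lborel (mollifier \<epsilon> :: real^'n \<Rightarrow> real)" using t by (rule int)
  have f: "?f y \<ge> 0" "?f y \<noteq> 0 \<longleftrightarrow> (1 / \<epsilon>) *\<^sub>R y \<in> box (vec (-1)) (vec 1)" for y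
    using box_bump_bounds(1)[of 1 "vec (-1)" "vec 1"] box_bump_nonzero[of 1 "vec (-1)" "vec 1"] by auto
  \<comment> \<open>A nonnegative function with integral 0 vanishes almost everywhere, and a
    continuous one then vanishes everywhere; but the bump is nonzero at the origin.\<close>
  have "(\<integral>y. ?f y \<partial>lborel) \<noteq> 0"
  proof
    assume "(\<integral>y. ?f y \<partial>lborel) = 0"
    then have "AE y in lborel. ?f y = 0"
      by (subst (asm) integral_nonneg_eq_0_iff_AE[OF int[OF tf]]) (use f in auto)
    then have "AE y in lebesgue. y \<in> {y. ?f y = 0}"
      by (intro AE_completion) simp
    moreover have "closed {y. ?f y = 0}"
      using smooth_fun_continuous[OF test_fun_smooth[OF tf]] by (intro closed_Collect_eq continuous_on_const)
    ultimately have "0 \<in> {y. ?f y = 0}" by (intro mem_closed_if_AE_lebesgue)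
    moreover have "0 \<in> (\<lambda>y::real^'n. (1 / \<epsilon>) *\<^sub>R y) -` box (vec (-1)) (vec 1)"
      by (auto simp: mem_box_cart)
    ultimately show False using f(2)[of 0] by simp
  qed
  then show "(\<integral>y. mollifier \<epsilon> (y :: real^'n) \<partial>lborel) = 1"
    unfolding m by simp
  show "mollifier \<epsilon> x \<ge> 0"
    unfolding m using f(1) by (intro mult_nonneg_nonneg) (auto intro!: Bochner_Integration.integral_nonneg)
  show 0: "mollifier \<epsilon> x = 0" if "norm x \<ge> real CARD('n) * \<epsilon>" for x :: "real^'n"
  proof -
    have "(1 / \<epsilon>) *\<^sub>R x \<notin> box (vec (-1)) (vec 1)"
    proof
      assume "(1 / \<epsilon>) *\<^sub>R x \<in> box (vec (-1)) (vec 1)"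
      then have "\<bar>x $ i\<bar> < \<epsilon>" for i
        using assms by (simp add: mem_box_cart field_simps abs_less_iff) (meson minus_less_iff)
      then have "(\<Sum>i\<in>UNIV. \<bar>x $ i\<bar>) < (\<Sum>i\<in>(UNIV::'n set). \<epsilon>)"
        by (intro sum_strict_mono) auto
      then show False using norm_le_l1_cart[of x] that by simp
    qed
    then show ?thesis using f(2)[of x] by (auto simp: m)
  qed
  show "iter_pderiv is (mollifier \<epsilon>) x = 0" if "norm x > real CARD('n) * \<epsilon>"
  proof -
    have 00: "iter_pderiv is (\<lambda>x. 0) = (\<lambda>x. 0)" by (induction "is") auto
    have "iter_pderiv is (mollifier \<epsilon>) x = iter_pderiv is (\<lambda>x. 0) x"
      using that 0 by (intro iter_pderiv_cong[of "- cball 0 (real CARD('n) * \<epsilon>)"]) (auto simp: dist_norm)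
    then show ?thesis by (simp add: 00)
  qed
qed

text \<open>Scaling: the normalising integral is proportional to
  \<open>\<epsilon> ^ CARD('n)\<close>, and each derivative contributes one more factor
  \<open>1 / \<epsilon>\<close>.\<close>

lemma iter_pderiv_mollifier_bound:
  obtains C where "C > 0"
    "\<And>\<epsilon> x. \<epsilon> > 0 \<Longrightarrow> \<bar>iter_pderiv is (mollifier \<epsilon>) (x :: real^'n)\<bar> \<le> C / \<epsilon> ^ (CARD('n) + length is)"
proof -
  let ?b = "box_bump 1 (vec (-1)) (vec 1) :: real^'n \<Rightarrow> real"
  have tb: "test_fun UNIV ?b" using test_fun_box_bump[of 1 "vec (-1)" "vec 1"] by simp
  then have sb: "smooth_fun ?b" by (rule test_fun_smooth)
  have [measurable]: "?b \<in> borel_measurable borel" using sb by (rule smooth_fun_borel)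
  obtain B where B: "B > 0" "\<And>x. \<bar>iter_pderiv is ?b x\<bar> \<le> B"
    using test_fun_bounded[OF test_fun_iter_pderiv[OF tb]] by metis
  let ?I = "\<lambda>\<epsilon>. \<integral>y. ?b (0 + (1 / \<epsilon>) *\<^sub>R y) \<partial>lborel"
  have I: "?I \<epsilon> = \<epsilon> ^ CARD('n) * ?I 1" if "\<epsilon> > 0" for \<epsilon>
  proof -
    have "?I \<epsilon> = (\<integral>y. ?b (0 + (1 / \<epsilon>) *\<^sub>R y) \<partial>density (distr lborel borel (\<lambda>x. 0 + \<epsilon> *\<^sub>R x)) (\<lambda>_. \<bar>\<epsilon>\<bar> ^ DIM(real^'n)))"
      using that lborel_affine[of \<epsilon> "0::real^'n"] by simp
    also have "\<dots> = \<epsilon> ^ CARD('n) * ?I 1"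
    proof -
      have "(\<lambda>y. ?b (0 + (1 / \<epsilon>) *\<^sub>R y)) \<in> borel_measurable borel" by measurable
      moreover have "(\<lambda>x::real^'n. 0 + \<epsilon> *\<^sub>R x) \<in> measurable lborel borel" by measurable
      ultimately show ?thesis
        using that by (subst integral_density) (simp_all add: integral_distr del: One_nat_def)
    qed
    finally show ?thesis .
  qed
  have I1: "?I 1 > 0"
  proof -
    have "?I 1 \<ge> 0" using box_bump_bounds(1) by (intro Bochner_Integration.integral_nonneg) auto
    \<comment> \<open>If the normalising integral were 0, division by zero would make the mollifier
      the zero function, contradicting its integral 1.\<close>
    moreover have "?I 1 \<noteq> 0" using integral_mollifier[of 1, where 'n='n] by (auto simp: mollifier_def)
    ultimately show ?thesis by simp
  qed
  show ?thesis
  proof (rule that[of "B / ?I 1"])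
    show "B / ?I 1 > 0" using B I1 by simp
    fix \<epsilon> :: real and x :: "real^'n" assume e: "\<epsilon> > 0"
    have m: "mollifier \<epsilon> = (\<lambda>x. (1 / ?I \<epsilon>) * ?b (0 + (1 / \<epsilon>) *\<^sub>R x))"
      by (auto simp: mollifier_def)
    have "iter_pderiv is (mollifier \<epsilon>) x = (1 / ?I \<epsilon>) * ((1 / \<epsilon>) ^ length is * iter_pderiv is ?b (0 + (1 / \<epsilon>) *\<^sub>R x))"
      unfolding m by (subst iter_pderiv_cmult[OF smooth_fun_affine[OF sb]]) (simp only: iter_pderiv_affine[OF sb])
    also have "\<bar>\<dots>\<bar> \<le> (1 / ?I \<epsilon>) * ((1 / \<epsilon>) ^ length is * B)"
      using e I1 B(2) by (subst I[OF e], subst I[OF e]) (auto simp: abs_mult intro!: mult_left_mono divide_right_mono)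
    also have "\<dots> = B / ?I 1 / \<epsilon> ^ (CARD('n) + length is)"
      by (subst I[OF e]) (simp add: power_add power_one_over field_simps)
    finally show "\<bar>iter_pderiv is (mollifier \<epsilon>) x\<bar> \<le> B / ?I 1 / \<epsilon> ^ (CARD('n) + length is)" .
  qed
qed

section \<open>Jensen's inequality\<close>

lemma powr_above_tangent:
  fixes x a p :: real
  assumes "x \<ge> 0" "a > 0" "p \<ge> 1"
  shows "a powr p + p * a powr (p - 1) * (x - a) \<le> x powr p"
proof (cases "x = 0")
  case True
  \<comment> \<open>Convexity is applied on the open half-line, so 0 is treated apart: there the
    tangent has the value \<open>(1 - p) * a powr p\<close>, which is not positive.\<close>
  have "a powr (p - 1) * a = a powr p" using assms by (simp add: powr_mult_base mult.commute)
  then show ?thesis using True assms mult_right_mono[of 1 p "a powr p"] by (simp add: algebra_simps)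
next
  case False
  have "p * a powr (p - 1) * (x - a) \<le> x powr p - a powr p"
  proof (rule convex_on_imp_above_tangent[where A = "{0<..}"])
    show "convex_on {0<..} (\<lambda>x. x powr p)" using assms(3) by (rule powr_convex)
    show "((\<lambda>x. x powr p) has_real_derivative p * a powr (p - 1)) (at a within {0<..})"
      using assms(2) by (auto intro!: derivative_eq_intros simp: powr_diff)
  qed (use assms False in \<open>auto simp: interior_open\<close>)
  then show ?thesis by simp
qed

text \<open>Jensen's inequality for a measure of arbitrary finite mass: the tangent of the
  \<open>p\<close>-th power at the mean of \<open>\<bar>h\<bar>\<close> is integrated, and undoing
  the normalisation leaves the factor mass to the power \<open>p - 1\<close>.\<close>

lemma (in finite_measure) powr_integral_le:
  fixes h :: "'a \<Rightarrow> real"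
  assumes h [measurable]: "h \<in> borel_measurable M" and p: "p \<ge> 1"
  shows "ennreal (\<bar>\<integral>x. h x \<partial>M\<bar> powr p) \<le> ennreal (measure M (space M) powr (p - 1)) * (\<integral>\<^sup>+x. ennreal (\<bar>h x\<bar> powr p) \<partial>M)"
proof (cases "(\<integral>x. \<bar>h x\<bar> \<partial>M) = 0")
  case True
  \<comment> \<open>This case includes nonintegrable \<open>h\<close>, whose Bochner integral is 0
    by convention.\<close>
  then have "(\<integral>x. h x \<partial>M) = 0"
    using integral_abs_bound[of M h] by simp
  then show ?thesis by simp
next
  case False
  let ?m = "measure M (space M)"
  let ?I = "\<integral>x. \<bar>h x\<bar> \<partial>M"
  have int: "integrable M (\<lambda>x. \<bar>h x\<bar>)" using False not_integrable_integral_eq by blast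
  have "?m \<noteq> 0"
  proof
    assume "?m = 0"
    then have "emeasure M (space M) = 0" by (simp add: emeasure_eq_measure)
    then have "AE x in M. \<bar>h x\<bar> = 0" by (intro AE_I[of _ _ "space M"]) auto
    from integral_eq_zero_AE[OF this] show False using False by simp
  qed
  then have m: "?m > 0" using measure_nonneg[of M "space M"] by linarith
  have I: "?I > 0" using False Bochner_Integration.integral_nonneg[of M "\<lambda>x. \<bar>h x\<bar>"] by linarith
  \<comment> \<open>The mean of \<open>\<bar>h\<bar>\<close>: at this point the linear part of the
    tangent integrates to 0.\<close>
  define a where "a = ?I / ?m"
  have a: "a > 0" using I m by (simp add: a_def)
  show ?thesis
  proof (cases "(\<integral>\<^sup>+x. ennreal (\<bar>h x\<bar> powr p) \<partial>M) = \<infinity>")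
    case True
    then show ?thesis using m by (simp add: ennreal_mult_top)
  next
    case False
    have int_p: "integrable M (\<lambda>x. \<bar>h x\<bar> powr p)"
      by (rule integrableI_nonneg) (use False in \<open>auto simp: top.not_eq_extremum\<close>)
    have "?m * a powr p = (\<integral>x. a powr p + p * a powr (p - 1) * (\<bar>h x\<bar> - a) \<partial>M)"
    proof -
      have "(\<integral>x. \<bar>h x\<bar> - a \<partial>M) = 0" using int m by (simp add: a_def)
      then show ?thesis using int by simp
    qed
    also have "\<dots> \<le> (\<integral>x. \<bar>h x\<bar> powr p \<partial>M)"
      using int int_p a p by (intro integral_mono powr_above_tangent) auto
    finally have 1: "?m * a powr p \<le> (\<integral>x. \<bar>h x\<bar> powr p \<partial>M)" .
    have "\<bar>\<integral>x. h x \<partial>M\<bar> powr p \<le> ?I powr p"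
      using integral_abs_bound[of M h] p by (intro powr_mono2) auto
    also have "\<dots> = ?m powr (p - 1) * (?m * a powr p)"
    proof -
      have "?I = ?m * a" using m by (simp add: a_def)
      then have "?I powr p = ?m powr p * a powr p" using m a by (simp add: powr_mult)
      also have "?m powr p = ?m powr (p - 1) * ?m" using m by (simp add: powr_mult_base mult.commute)
      finally show ?thesis by simp
    qed
    also have "\<dots> \<le> ?m powr (p - 1) * (\<integral>x. \<bar>h x\<bar> powr p \<partial>M)"
      using 1 by (intro mult_left_mono) auto
    finally have "ennreal (\<bar>\<integral>x. h x \<partial>M\<bar> powr p) \<le> ennreal (?m powr (p - 1) * (\<integral>x. \<bar>h x\<bar> powr p \<partial>M))"
      by (rule ennreal_leI)
    also have "\<dots> = ennreal (?m powr (p - 1)) * (\<integral>\<^sup>+x. ennreal (\<bar>h x\<bar> powr p) \<partial>M)"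
      by (subst nn_integral_eq_integral[OF int_p]) (auto intro: ennreal_mult)
    finally show ?thesis .
  qed
qed

text \<open>Convolving with the constant 1 averages the test function over translates by
  \<open>T t\<close>. Fubini moves the average onto \<open>g\<close>, with the opposite translation.
  For \<open>g\<close> the integral of a weak derivative along a line this is the formula needed
  later.\<close>

lemma integral_conv_const:
  fixes g \<phi> :: "real^'n \<Rightarrow> real" and T :: "'a \<Rightarrow> real^'n"
  assumes "finite_measure M" and T [measurable]: "T \<in> borel_measurable M" and T_bound: "\<And>t. t \<in> space M \<Longrightarrow> norm (T t) \<le> R"
    and g [measurable]: "g \<in> borel_measurable borel" and g_int: "\<And>C. compact C \<Longrightarrow> set_integrable lborel C g"
    and \<phi>: "test_fun S \<phi>"
  shows "(\<integral>x. g x * conv M T (\<lambda>_. 1) \<phi> x \<partial>lborel) = (\<integral>y. (\<integral>t. g (y + T t) \<partial>M) * \<phi> y \<partial>lborel)"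
    and "integrable lborel (\<lambda>y. (\<integral>t. g (y + T t) \<partial>M) * \<phi> y)"
proof -
  interpret finite_measure M by fact
  interpret P: pair_sigma_finite "lborel :: (real^'n) measure" M
    by (intro pair_sigma_finite.intro sigma_finite_lborel) unfold_locales
  obtain C where C: "smooth_fun \<phi>" "compact C" "\<And>is x. x \<notin> C \<Longrightarrow> iter_pderiv is \<phi> x = 0"
    using test_funE[OF \<phi>] by metis
  note [measurable] = smooth_fun_borel[OF C(1)]
  obtain B where B: "B > 0" "\<And>x. \<bar>\<phi> x\<bar> \<le> B" using test_fun_bounded[OF \<phi>] by blast
  obtain R1 where R1: "\<And>x. x \<in> C \<Longrightarrow> norm x \<le> R1"
    using C(2) compact_imp_bounded bounded_iff by metis
  \<comment> \<open>Contains every \<open>x\<close> for which some \<open>x - T t\<close> lies in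
    \<open>C\<close>; local integrability of \<open>g\<close> then suffices for Fubini.\<close>
  let ?K = "cball (0 :: real^'n) (R + R1)"
  let ?J = "\<integral>\<^sup>+x. ennreal (B * \<bar>indicator ?K x * g x\<bar>) \<partial>lborel"
  have J: "?J < \<infinity>"
    using integrable_mult_right[OF integrable_abs[OF g_int[OF compact_cball, of 0 "R + R1", unfolded set_integrable_def]], of B]
    unfolding integrable_iff_bounded using B(1) by (simp add: abs_mult)
  have bd: "\<bar>g x * \<phi> (x - T t)\<bar> \<le> B * \<bar>indicator ?K x * g x\<bar>" if "t \<in> space M" for x t
  proof (cases "x \<in> ?K")
    case True
    then show ?thesis using B(2)[of "x - T t"] by (simp add: abs_mult mult.commute[of B] mult_left_mono)
  next
    case False
    have "norm x \<le> norm (x - T t) + norm (T t)" using norm_triangle_ineq[of "x - T t" "T t"] by simp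
    then have "x - T t \<notin> C" using False R1[of "x - T t"] T_bound[OF that] by auto
    then show ?thesis using C(3)[of _ "[]"] B(1) by simp
  qed
  have A: "(\<integral>\<^sup>+t. \<integral>\<^sup>+x. ennreal \<bar>g x * \<phi> (x - T t)\<bar> \<partial>lborel \<partial>M) < \<infinity>"
  proof -
    have "(\<integral>\<^sup>+t. \<integral>\<^sup>+x. ennreal \<bar>g x * \<phi> (x - T t)\<bar> \<partial>lborel \<partial>M) \<le> (\<integral>\<^sup>+t. ?J \<partial>M)"
      by (intro nn_integral_mono ennreal_leI bd)
    also have "\<dots> < \<infinity>" using J by (simp add: ennreal_mult_less_top emeasure_eq_measure)
    finally show ?thesis .
  qed
  have int1: "integrable (lborel \<Otimes>\<^sub>M M) (\<lambda>(x, t). g x * \<phi> (x - T t))"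
  proof (rule integrableI_bounded)
    show "(\<integral>\<^sup>+z. norm (case z of (x, t) \<Rightarrow> g x * \<phi> (x - T t)) \<partial>(lborel \<Otimes>\<^sub>M M)) < \<infinity>"
      using A by (subst P.nn_integral_snd[symmetric]) auto
  qed measurable
  have shift: "(\<integral>\<^sup>+y. ennreal \<bar>g (y + T t) * \<phi> y\<bar> \<partial>lborel) = (\<integral>\<^sup>+x. ennreal \<bar>g x * \<phi> (x - T t)\<bar> \<partial>lborel)" for t
    using nn_integral_lborel_affine[of "\<lambda>x. ennreal \<bar>g x * \<phi> (x - T t)\<bar>" 1 "T t"] by (simp add: add.commute)
  have int2: "integrable (lborel \<Otimes>\<^sub>M M) (\<lambda>(y, t). g (y + T t) * \<phi> y)"
  proof (rule integrableI_bounded)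
    show "(\<integral>\<^sup>+z. norm (case z of (y, t) \<Rightarrow> g (y + T t) * \<phi> y) \<partial>(lborel \<Otimes>\<^sub>M M)) < \<infinity>"
      using A by (subst P.nn_integral_snd[symmetric]) (auto simp: shift)
  qed measurable
  have "(\<integral>x. g x * conv M T (\<lambda>_. 1) \<phi> x \<partial>lborel) = (\<integral>x. (\<integral>t. g x * \<phi> (x - T t) \<partial>M) \<partial>lborel)"
    by (simp add: conv_def)
  also have "\<dots> = (\<integral>t. (\<integral>x. g x * \<phi> (x - T t) \<partial>lborel) \<partial>M)"
    by (rule P.Fubini_integral[OF int1, symmetric])
  also have "\<dots> = (\<integral>t. (\<integral>y. g (y + T t) * \<phi> y \<partial>lborel) \<partial>M)"
    using integral_lborel_affine[of "\<lambda>x. g x * \<phi> (x - T t)" 1 "T t" for t] by (simp add: add.commute)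
  also have "\<dots> = (\<integral>y. (\<integral>t. g (y + T t) * \<phi> y \<partial>M) \<partial>lborel)"
    by (rule P.Fubini_integral[OF int2])
  finally show "(\<integral>x. g x * conv M T (\<lambda>_. 1) \<phi> x \<partial>lborel) = (\<integral>y. (\<integral>t. g (y + T t) \<partial>M) * \<phi> y \<partial>lborel)"
    by simp
  show "integrable lborel (\<lambda>y. (\<integral>t. g (y + T t) \<partial>M) * \<phi> y)"
    using P.integrable_fst'[OF int2] by simp
qed

section \<open>Cutoff functions as mollified indicators\<close>

definition cutoff :: "real \<Rightarrow> (real^'n) set \<Rightarrow> real^'n \<Rightarrow> real" where
  "cutoff \<epsilon> A = conv lborel (\<lambda>y. y) (indicator A) (mollifier \<epsilon>)"

lemma
  fixes A :: "(real^'n) set"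
  assumes e: "\<epsilon> > 0" and A [measurable]: "A \<in> sets borel" and bdd: "bounded A"
  shows integrable_indicator_bounded: "integrable lborel (indicator A :: real^'n \<Rightarrow> real)"
    and smooth_fun_cutoff: "smooth_fun (cutoff \<epsilon> A)"
    and cutoff_bounds: "0 \<le> cutoff \<epsilon> A x" "cutoff \<epsilon> A x \<le> 1"
    and cutoff_eq_1: "cball x (real CARD('n) * \<epsilon>) \<subseteq> A \<Longrightarrow> cutoff \<epsilon> A x = 1"
    and cutoff_eq_0: "cball x (real CARD('n) * \<epsilon>) \<inter> A = {} \<Longrightarrow> cutoff \<epsilon> A x = 0"
proof -
  show int: "integrable lborel (indicator A :: real^'n \<Rightarrow> real)"
    using emeasure_bounded_finite[OF bdd] by (intro integrable_real_indicator) auto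
  note m [measurable] = smooth_fun_borel[OF test_fun_smooth[OF test_fun_mollifier[OF e]]]
  show "smooth_fun (cutoff \<epsilon> A)"
    unfolding cutoff_def by (rule smooth_fun_conv[OF int _ test_fun_mollifier[OF e]]) simp
  have one: "(\<integral>y. mollifier \<epsilon> (x - y) \<partial>lborel) = 1"
    using integral_lborel_affine[OF m, of "-1" x] integral_mollifier[OF e, where 'n='n] by simp
  have int1: "integrable lborel (\<lambda>y. mollifier \<epsilon> (x - y))"
    using integrable_lborel_affine[OF m, of "-1" x] integrable_mollifier[OF e] by simp
  have int2: "integrable lborel (\<lambda>y. indicator A y * mollifier \<epsilon> (x - y))"
    by (rule integrable_conv[OF int _ test_fun_mollifier[OF e]]) simp
  show "0 \<le> cutoff \<epsilon> A x"
    unfolding cutoff_def conv_def using mollifier_nonneg[OF e]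
    by (intro Bochner_Integration.integral_nonneg mult_nonneg_nonneg) auto
  have "cutoff \<epsilon> A x \<le> (\<integral>y. mollifier \<epsilon> (x - y) \<partial>lborel)"
    unfolding cutoff_def conv_def using mollifier_nonneg[OF e] int1 int2
    by (intro integral_mono) (auto simp: indicator_def)
  then show "cutoff \<epsilon> A x \<le> 1" by (simp add: one)
  have far: "mollifier \<epsilon> (x - y) = 0" if "y \<notin> cball x (real CARD('n) * \<epsilon>)" for y
    using that by (intro mollifier_eq_0[OF e]) (auto simp: dist_norm)
  show "cutoff \<epsilon> A x = 1" if "cball x (real CARD('n) * \<epsilon>) \<subseteq> A"
  proof -
    have "cutoff \<epsilon> A x = (\<integral>y. mollifier \<epsilon> (x - y) \<partial>lborel)"
      unfolding cutoff_def conv_def using that far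
      by (intro Bochner_Integration.integral_cong) (auto simp: indicator_def subset_iff)
    then show ?thesis by (simp add: one)
  qed
  show "cutoff \<epsilon> A x = 0" if "cball x (real CARD('n) * \<epsilon>) \<inter> A = {}"
  proof -
    have "cutoff \<epsilon> A x = (\<integral>y. 0 \<partial>(lborel :: (real^'n) measure))"
      unfolding cutoff_def conv_def using that far
      by (intro Bochner_Integration.integral_cong) (auto simp: indicator_def disjoint_iff)
    then show ?thesis by simp
  qed
qed

text \<open>The support lies in the sum of \<open>closure A\<close> and a closed ball of radius
  \<open>CARD('n) * \<epsilon>\<close>. The doubled margin leaves room to replace a point of the
  closure by a nearby point of \<open>A\<close>.\<close>

lemma test_fun_cutoff:
  fixes A :: "(real^'n) set"
  assumes e: "\<epsilon> > 0" and A: "A \<in> sets borel" and bdd: "bounded A"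
    and S: "\<And>x y. x \<in> A \<Longrightarrow> norm (x - y) \<le> 2 * real CARD('n) * \<epsilon> \<Longrightarrow> y \<in> S"
  shows "test_fun S (cutoff \<epsilon> A)"
proof (rule test_funI[OF smooth_fun_cutoff[OF e A bdd]])
  let ?K = "(\<Union>x\<in>closure A. \<Union>y\<in>cball 0 (real CARD('n) * \<epsilon>). {x + y})"
  show "compact ?K"
    using bdd by (intro compact_sums') (auto simp: compact_closure)
  show "?K \<subseteq> S"
  proof safe
    fix x y :: "real^'n" assume xy: "x \<in> closure A" "y \<in> cball 0 (real CARD('n) * \<epsilon>)"
    obtain z where z: "z \<in> A" "dist z x < real CARD('n) * \<epsilon>"
      using xy(1) e closure_approachable[of x A] by (metis mult_pos_pos of_nat_0_less_iff zero_less_card_finite)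
    have "norm (z - (x + y)) \<le> norm (z - x) + norm y" by (metis diff_diff_eq norm_triangle_ineq4)
    also have "\<dots> \<le> 2 * real CARD('n) * \<epsilon>" using z xy by (simp add: dist_norm)
    finally show "x + y \<in> S" using S z by blast
  qed
  show "cutoff \<epsilon> A x = 0" if "x \<notin> ?K" for x
  proof (rule cutoff_eq_0[OF e A bdd])
    have False if "z \<in> cball x (real CARD('n) * \<epsilon>)" "z \<in> A" for z
    proof -
      have "z \<in> closure A" using that closure_subset by blast
      moreover have "x - z \<in> cball 0 (real CARD('n) * \<epsilon>)" using that by (simp add: dist_norm norm_minus_commute)
      ultimately have "z + (x - z) \<in> ?K" by blast
      then show False using \<open>x \<notin> ?K\<close> by simp
    qed
    then show "cball x (real CARD('n) * \<epsilon>) \<inter> A = {}" by blast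
  qed
qed

subsection \<open>Recovering lower order weak derivatives\<close>

text \<open>Integrating a weak derivative along its last direction: the antiderivative of a test function
  in direction \<open>i\<close> is again a test function once a translate that misses the support of \<open>v\<close> has been
  subtracted.\<close>

lemma weak_deriv_antiderivative:
  fixes v g :: "real^'n \<Rightarrow> real"
  assumes w: "weak_deriv UNIV (is @ [i]) v g" and g [measurable]: "g \<in> borel_measurable borel"
    and v0: "AE x in lebesgue. x \<notin> ball 0 r \<longrightarrow> v x = 0"
  obtains R \<kappa> where "test_fun UNIV \<kappa>" "\<And>x. 0 \<le> \<kappa> x" "\<And>x. \<kappa> x \<le> 1"
    "weak_deriv UNIV is v (\<lambda>y. \<kappa> y * (\<integral>t. g (y + (- t) *\<^sub>R axis i 1) \<partial>restrict_space lborel {0..R}))"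
proof -
  let ?e = "axis i 1 :: real^'n"
  define N where "N = real CARD('n)"
  \<comment> \<open>Test functions have arbitrary supports, but \<open>v\<close> lives in
    \<open>ball 0 r\<close>. Multiplying by \<kappa>, which is 1 on that ball, confines them to
    \<open>cball 0 R1\<close>, so one length \<open>R\<close> works for all of them.\<close>
  define \<kappa> where "\<kappa> = (cutoff 1 (cball 0 (\<bar>r\<bar> + N)) :: real^'n \<Rightarrow> real)"
  define R1 where "R1 = \<bar>r\<bar> + 3 * N"
  \<comment> \<open>Long enough that a shift by \<open>R\<close> in direction \<open>i\<close>
    carries every point of \<open>ball 0 r\<close> out of \<open>cball 0 R1\<close>, which contains
    the support of \<kappa>.\<close>
  define R where "R = \<bar>r\<bar> + R1 + 1"
  have N: "N \<ge> 1" unfolding N_def by (simp add: Suc_leI)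
  note cut = zero_less_one borel_closed[OF closed_cball] bounded_cball
  have R0: "R \<ge> 0" "R1 \<ge> 0" using N by (auto simp: R_def R1_def)
  have \<kappa>_test: "test_fun (cball 0 R1) \<kappa>" unfolding \<kappa>_def
  proof (rule test_fun_cutoff[OF cut])
    fix x y :: "real^'n" assume xy: "x \<in> cball 0 (\<bar>r\<bar> + N)" "norm (x - y) \<le> 2 * real CARD('n) * 1"
    have "norm y \<le> norm x + norm (x - y)" by (metis norm_triangle_sub norm_minus_commute)
    with xy show "y \<in> cball 0 R1" by (simp add: R1_def N_def)
  qed
  have \<kappa>_test': "test_fun UNIV \<kappa>" using test_fun_mono[OF \<kappa>_test] by blast
  have \<kappa>1: "\<kappa> x = 1" if "x \<in> ball 0 r" for x
    unfolding \<kappa>_def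
  proof (intro cutoff_eq_1[OF cut] subsetI)
    fix y assume y: "y \<in> cball x (real CARD('n) * 1)"
    have "norm y \<le> norm x + norm (x - y)" by (metis norm_triangle_sub norm_minus_commute)
    then show "y \<in> cball 0 (\<bar>r\<bar> + N)" using that y by (simp add: dist_norm N_def)
  qed
  have \<kappa>01: "0 \<le> \<kappa> x" "\<kappa> x \<le> 1" for x
    unfolding \<kappa>_def by (intro cutoff_bounds[OF cut])+
  define M where "M = restrict_space lborel {0..R}"
  define T :: "real \<Rightarrow> real^'n" where "T t = (- t) *\<^sub>R ?e" for t
  have fin: "finite_measure M"
    unfolding M_def by (intro finite_measureI) (simp add: emeasure_restrict_space space_restrict_space emeasure_lborel_Icc_eq)
  then interpret finite_measure M .
  have T [measurable]: "T \<in> borel_measurable M"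
    unfolding M_def T_def by (intro measurable_restrict_space1) measurable
  have T_bound: "norm (T t) \<le> R" if "t \<in> space M" for t
    using that unfolding M_def T_def by (simp add: space_restrict_space)
  have li: "loc_integrable UNIV v" "loc_integrable UNIV g"
    using w by (auto simp: weak_deriv_def)
  have g_int: "set_integrable lborel C g" if "compact C" for C
  proof -
    have "integrable lebesgue (\<lambda>x. indicator C x *\<^sub>R g x)"
      using li(2) that unfolding loc_integrable_def set_integrable_def by simp
    moreover have "C \<in> sets borel" using that by (simp add: borel_compact)
    ultimately show ?thesis unfolding set_integrable_def by (simp add: integrable_completion)
  qed
  define F where "F y = (\<integral>t. g (y + T t) \<partial>M)" for y
  note swap = integral_conv_const[OF fin T T_bound g g_int]
  have F_int: "integrable lborel (\<lambda>y. F y * \<phi> y)" if "test_fun UNIV \<phi>" for \<phi>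
    unfolding F_def using swap(2)[OF _ _ that] by blast
  have F_meas [measurable]: "F \<in> borel_measurable borel"
    unfolding F_def by measurable
  have main: "weak_deriv UNIV is v (\<lambda>y. \<kappa> y * F y)"
    unfolding weak_deriv_def
  proof (intro conjI allI impI li)
    have \<kappa>F: "integrable lborel (\<lambda>y. F y * \<kappa> y)" by (rule F_int[OF \<kappa>_test'])
    show "loc_integrable UNIV (\<lambda>y. \<kappa> y * F y)"
      unfolding loc_integrable_def set_integrable_def
    proof safe
      fix C :: "(real^'n) set" assume "compact C"
      then have [measurable]: "C \<in> sets borel" by (rule borel_compact)
      have "integrable lborel (\<lambda>y. indicator C y *\<^sub>R (F y * \<kappa> y))"
        using \<kappa>F by (intro integrable_mult_indicator) auto
      then show "integrable lebesgue (\<lambda>y. indicator C y *\<^sub>R (\<kappa> y * F y))"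
        by (subst integrable_completion) (auto simp: mult.commute dest: borel_measurable_integrable)
    qed
    fix \<zeta> :: "real^'n \<Rightarrow> real" assume \<zeta>: "test_fun UNIV \<zeta>"
    define \<phi> where "\<phi> x = \<kappa> x * \<zeta> x" for x
    have \<phi>: "test_fun UNIV \<phi>" unfolding \<phi>_def
      using test_fun_mult[OF test_fun_smooth[OF \<kappa>_test'] \<zeta>] .
    have \<kappa>0: "\<kappa> x = 0" if "norm x > R1" for x
      using that \<kappa>_test closure_subset[of "{x. \<kappa> x \<noteq> 0}"] unfolding test_fun_def by (fastforce simp: subset_iff)
    \<comment> \<open>\<psi> is the integral of \<phi> over the segment from \<open>x\<close> to
      \<open>x + R *\<^sub>R ?e\<close>. Its derivative in direction \<open>i\<close> is the
      difference of \<phi> at the endpoints, and for \<open>x\<close> in \<open>ball 0 r\<close> the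
      far endpoint contributes 0.\<close>
    define \<psi> where "\<psi> = conv M T (\<lambda>_. 1) \<phi>"
    have one: "integrable M (\<lambda>_. 1 :: real)" by simp
    have \<psi>_smooth: "smooth_fun \<psi>" unfolding \<psi>_def by (rule smooth_fun_conv[OF one T \<phi>])
    have \<psi>: "test_fun UNIV \<psi>"
    proof (rule test_funI[OF \<psi>_smooth, of "cball 0 (R1 + R)"])
      fix x :: "real^'n" assume x: "x \<notin> cball 0 (R1 + R)"
      have "\<phi> (x - T t) = 0" if "t \<in> space M" for t
      proof -
        have "norm x \<le> norm (x - T t) + norm (T t)" using norm_triangle_ineq[of "x - T t" "T t"] by simp
        then have "norm (x - T t) > R1" using x T_bound[OF that] by simp
        then show ?thesis by (simp add: \<phi>_def \<kappa>0)
      qed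
      then have "conv M T (\<lambda>_. 1) \<phi> x = (\<integral>t. 0 \<partial>M)"
        unfolding conv_def by (intro Bochner_Integration.integral_cong) auto
      then show "\<psi> x = 0" by (simp add: \<psi>_def)
    qed auto
    have \<psi>': "pderiv_dir i \<psi> x = \<phi> (x + R *\<^sub>R ?e) - \<phi> x" for x
    proof -
      have "pderiv_dir i \<psi> x = conv M T (\<lambda>_. 1) (pderiv_dir i \<phi>) x"
        using iter_pderiv_conv[OF one T \<phi>, of "[i]"] by (simp add: \<psi>_def)
      also have "\<dots> = (\<integral>t. indicator {0..R} t *\<^sub>R pderiv_dir i \<phi> (x + t *\<^sub>R ?e) \<partial>lborel)"
        unfolding conv_def M_def T_def by (subst integral_restrict_space) auto
      also have "\<dots> = \<phi> (x + R *\<^sub>R ?e) - \<phi> (x + 0 *\<^sub>R ?e)"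
      proof (rule integral_FTC_atLeastAtMost[OF R0(1)])
        fix t
        have "((\<lambda>t. x + t *\<^sub>R ?e) has_derivative (\<lambda>s. s *\<^sub>R ?e)) (at t)"
          by (auto intro!: derivative_eq_intros)
        from has_derivative_compose[OF this has_derivative_pderiv_dir[OF smooth_fun_differentiable[OF test_fun_smooth[OF \<phi>]]]]
        have "((\<lambda>t. \<phi> (x + t *\<^sub>R ?e)) has_derivative (\<lambda>s. s * (\<Sum>j\<in>UNIV. ?e $ j * pderiv_dir j \<phi> (x + t *\<^sub>R ?e)))) (at t)"
          by (simp add: sum_distrib_left mult.assoc)
        then show "((\<lambda>t. \<phi> (x + t *\<^sub>R ?e)) has_vector_derivative pderiv_dir i \<phi> (x + t *\<^sub>R ?e)) (at t within {0..R})"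
          unfolding sum_axis_mult has_vector_derivative_def by (auto intro: has_derivative_at_withinI)
        show "continuous_on {0..R} (\<lambda>t. pderiv_dir i \<phi> (x + t *\<^sub>R ?e))"
          by (intro continuous_on_compose2[OF smooth_fun_continuous[OF smooth_fun_pderiv_dir[OF test_fun_smooth[OF \<phi>]], of UNIV]] continuous_intros) auto
      qed
      finally show ?thesis by simp
    qed
    have \<psi>'': "iter_pderiv (is @ [i]) \<psi> x = - iter_pderiv is \<zeta> x" if "x \<in> ball 0 r" for x
    proof -
      have "pderiv_dir i \<psi> y = - 1 * \<zeta> y" if y: "y \<in> ball 0 r" for y
      proof -
        have "norm (R *\<^sub>R ?e) \<le> norm (y + R *\<^sub>R ?e) + norm y"
          by (metis add_diff_cancel_left' norm_triangle_ineq4)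
        then have "norm (y + R *\<^sub>R ?e) > R1" using y R0 by (simp add: R_def)
        then show ?thesis using \<psi>'[of y] \<kappa>1[OF y] by (simp add: \<phi>_def \<kappa>0)
      qed
      then have "iter_pderiv is (pderiv_dir i \<psi>) x = iter_pderiv is (\<lambda>y. - 1 * \<zeta> y) x"
        using that by (intro iter_pderiv_cong[of "ball 0 r"]) auto
      then show ?thesis using iter_pderiv_cmult[OF test_fun_smooth[OF \<zeta>], of "is" "-1"]
        by (simp add: iter_pderiv_append)
    qed
    note vm [measurable] = loc_integrable_borel[OF li(1)]
    have sm: "h \<in> borel_measurable lebesgue" if "smooth_fun h" for h :: "real^'n \<Rightarrow> real"
      using smooth_fun_borel[OF that] by (intro measurable_completion) simp
    \<comment> \<open>Only points of \<open>ball 0 r\<close> matter, and there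
      \<open>- \<zeta>\<close> is the \<open>i\<close>-th partial derivative of \<psi>. The minus
      sign is absorbed by the extra order of differentiation.\<close>
    have "(\<integral>x. v x * iter_pderiv is \<zeta> x \<partial>lebesgue) = (\<integral>x. - (v x * iter_pderiv (is @ [i]) \<psi> x) \<partial>lebesgue)"
    proof (rule integral_cong_AE)
      show "AE x in lebesgue. v x * iter_pderiv is \<zeta> x = - (v x * iter_pderiv (is @ [i]) \<psi> x)"
        using v0 by eventually_elim (use \<psi>'' in fastforce)
      show "(\<lambda>x. v x * iter_pderiv is \<zeta> x) \<in> borel_measurable lebesgue"
        using sm[OF smooth_fun_iter_pderiv[OF test_fun_smooth[OF \<zeta>]]] by measurable
      show "(\<lambda>x. - (v x * iter_pderiv (is @ [i]) \<psi> x)) \<in> borel_measurable lebesgue"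
        using sm[OF smooth_fun_iter_pderiv[OF \<psi>_smooth]] by measurable
    qed
    also have "\<dots> = - ((-1) ^ length (is @ [i]) * (\<integral>x. g x * \<psi> x \<partial>lebesgue))"
      using w \<psi> unfolding weak_deriv_def by (simp add: set_lebesgue_integral_def)
    also have "\<dots> = (-1) ^ length is * (\<integral>x. g x * \<psi> x \<partial>lebesgue)" by simp
    also have "(\<integral>x. g x * \<psi> x \<partial>lebesgue) = (\<integral>x. g x * \<psi> x \<partial>lborel)"
      using smooth_fun_borel[OF \<psi>_smooth] by (intro integral_completion) auto
    also have "\<dots> = (\<integral>y. F y * \<phi> y \<partial>lborel)"
      unfolding \<psi>_def F_def by (rule swap(1)[OF _ _ \<phi>])
    also have "\<dots> = (\<integral>y. F y * \<phi> y \<partial>lebesgue)"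
      using smooth_fun_borel[OF test_fun_smooth[OF \<phi>]] by (intro integral_completion[symmetric]) auto
    finally show "(LINT x:UNIV|lebesgue. v x * iter_pderiv is \<zeta> x) =
        (- 1) ^ length is * (LINT y:UNIV|lebesgue. \<kappa> y * F y * \<zeta> y)"
      by (simp add: set_lebesgue_integral_def \<phi>_def mult_ac)
  qed
  show ?thesis
    by (rule that[OF \<kappa>_test' \<kappa>01]) (use main in \<open>simp add: F_def T_def M_def\<close>)
qed

text \<open>Integration over lines uses Fubini for products of Borel measures, whereas a weak
  derivative is a priori only Lebesgue measurable.\<close>

lemma weak_deriv_borel_representative:
  assumes "weak_deriv UNIV is v f"
  obtains g where "g \<in> borel_measurable borel" "AE x in lborel. f x = g x" "weak_deriv UNIV is v g"
proof -
  have li: "loc_integrable UNIV v" "loc_integrable UNIV f"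
    using assms by (auto simp: weak_deriv_def)
  obtain g where g: "g \<in> borel_measurable lborel" "AE x in lborel. f x = g x"
    using completion_ex_borel_measurable_real[OF loc_integrable_borel[OF li(2)]] by blast
  have "weak_deriv UNIV is v g"
    by (rule weak_deriv_cong_AE[OF assms _ AE_completion[OF g(2)] loc_integrable_borel[OF li(1)] measurable_completion[OF g(1)]]) simp
  then show ?thesis using that g by simp
qed

text \<open>With no remaining directions, the antiderivative lemma and uniqueness say that
  \<open>v\<close> itself is almost everywhere \<kappa> times a line integral of its derivative over
  a fixed length. The bound serves to show that \<open>u\<close> is locally square
  integrable.\<close>

lemma bounded_if_weak_deriv_bounded:
  fixes v :: "real^'n \<Rightarrow> real"
  assumes w: "weak_deriv UNIV [i] v f" and f: "AE x in lebesgue. \<bar>f x\<bar> \<le> L"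
    and v0: "AE x in lebesgue. x \<notin> ball 0 r \<longrightarrow> v x = 0"
  obtains B where "AE x in lebesgue. \<bar>v x\<bar> \<le> B"
proof -
  obtain g0 where g0: "g0 \<in> borel_measurable borel" "AE x in lborel. f x = g0 x" "weak_deriv UNIV [i] v g0"
    using weak_deriv_borel_representative[OF w] by blast
  \<comment> \<open>Truncation turns the almost-everywhere bound into a bound at every point; a null
    set in space could still fill whole lines. The absolute value keeps the truncation levels
    ordered.\<close>
  define g where "g x = min (max (g0 x) (- \<bar>L\<bar>)) \<bar>L\<bar>" for x
  have g [measurable]: "g \<in> borel_measurable borel" unfolding g_def using g0(1) by measurable
  have g_bd: "\<bar>g x\<bar> \<le> \<bar>L\<bar>" for x by (auto simp: g_def)
  have "AE x in lebesgue. g0 x = g x"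
    using f AE_completion[OF g0(2)] by eventually_elim (auto simp: g_def)
  then have wg: "weak_deriv UNIV ([] @ [i]) v g"
    using g0(3) loc_integrable_borel[of v] g0(3) g
    by (simp, intro weak_deriv_cong_AE[OF g0(3)]) (auto simp: weak_deriv_def intro: measurable_completion)
  obtain R \<kappa> where \<kappa>: "test_fun UNIV \<kappa>" "\<And>x. 0 \<le> \<kappa> x" "\<And>x. \<kappa> x \<le> 1"
    and W: "weak_deriv UNIV [] v (\<lambda>y. \<kappa> y * (\<integral>t. g (y + (- t) *\<^sub>R axis i 1) \<partial>restrict_space lborel {0..R}))"
    by (rule weak_deriv_antiderivative[OF wg g v0]) blast
  let ?M = "restrict_space lborel {0..R}"
  have fin: "finite_measure ?M"
    by (intro finite_measureI) (simp add: emeasure_restrict_space space_restrict_space emeasure_lborel_Icc_eq)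
  interpret finite_measure ?M by fact
  have "weak_deriv UNIV [] v v"
    using W by (simp add: weak_deriv_def)
  from weak_deriv_unique[OF this W]
  have "AE y in lebesgue. v y = \<kappa> y * (\<integral>t. g (y + (- t) *\<^sub>R axis i 1) \<partial>?M)" .
  then have "AE y in lebesgue. \<bar>v y\<bar> \<le> \<bar>L\<bar> * measure ?M (space ?M)"
  proof eventually_elim
    case (elim y)
    have "\<bar>\<integral>t. g (y + (- t) *\<^sub>R axis i 1) \<partial>?M\<bar> \<le> (\<integral>t. \<bar>L\<bar> \<partial>?M)"
    proof (rule order_trans[OF integral_abs_bound integral_mono])
      show "integrable ?M (\<lambda>t. \<bar>g (y + (- t) *\<^sub>R axis i 1)\<bar>)"
        by (rule integrable_const_bound[of _ "\<bar>L\<bar>"])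
          (use g_bd in \<open>auto intro!: measurable_restrict_space1\<close>)
    qed (use g_bd in auto)
    then have "\<bar>v y\<bar> \<le> 1 * \<bar>\<integral>t. \<bar>L\<bar> \<partial>?M\<bar>"
      unfolding elim abs_mult using \<kappa>(2,3)[of y] by (intro mult_mono) auto
    then show ?case by (simp add: mult.commute)
  qed
  then show ?thesis using that by blast
qed

text \<open>Jensen moves the power \<open>p\<close> inside the line integral, and Fubini together
  with translation invariance shows that every translate of the derivative contributes the same
  \<open>p\<close>-th power norm. Since \<kappa> is at most 1, the result is finite.\<close>

lemma weak_deriv_Lp_step_down:
  fixes v f :: "real^'n \<Rightarrow> real"
  assumes w: "weak_deriv UNIV (is @ [i]) v f" and f: "Lp_pow UNIV p f < \<infinity>" and p: "p \<ge> 1"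
    and v0: "AE x in lebesgue. x \<notin> ball 0 r \<longrightarrow> v x = 0"
  obtains F where "weak_deriv UNIV is v F" "Lp_pow UNIV p F < \<infinity>"
proof -
  obtain g where g [measurable]: "g \<in> borel_measurable borel" and fg: "AE x in lborel. f x = g x"
    and wg: "weak_deriv UNIV (is @ [i]) v g"
    using weak_deriv_borel_representative[OF w] by blast
  obtain R \<kappa> where \<kappa>: "test_fun UNIV \<kappa>" "\<And>x. 0 \<le> \<kappa> x" "\<And>x. \<kappa> x \<le> 1"
    and W: "weak_deriv UNIV is v (\<lambda>y. \<kappa> y * (\<integral>t. g (y + (- t) *\<^sub>R axis i 1) \<partial>restrict_space lborel {0..R}))"
    by (rule weak_deriv_antiderivative[OF wg g v0]) blast
  let ?M = "restrict_space lborel {0..R}"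
  have fin: "finite_measure ?M"
    by (intro finite_measureI) (simp add: emeasure_restrict_space space_restrict_space emeasure_lborel_Icc_eq)
  interpret finite_measure ?M by fact
  interpret P: pair_sigma_finite "lborel :: (real^'n) measure" ?M
    by (intro pair_sigma_finite.intro sigma_finite_lborel) unfold_locales
  define m where "m = ennreal (measure ?M (space ?M) powr (p - 1))"
  define T :: "real \<Rightarrow> real^'n" where "T t = (- t) *\<^sub>R axis i 1" for t
  have T [measurable]: "T \<in> borel_measurable ?M"
    unfolding T_def by (intro measurable_restrict_space1) measurable
  let ?J = "\<integral>\<^sup>+y. ennreal (\<bar>g y\<bar> powr p) \<partial>lborel"
  have J: "?J < \<infinity>"
  proof -
    have "?J = (\<integral>\<^sup>+y. ennreal (\<bar>f y\<bar> powr p) \<partial>lebesgue)"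
      unfolding nn_integral_completion using fg by (intro nn_integral_cong_AE) auto
    also have "\<dots> < \<infinity>" using f by (simp add: Lp_pow_def)
    finally show ?thesis .
  qed
  have "Lp_pow UNIV p (\<lambda>y. \<kappa> y * (\<integral>t. g (y + T t) \<partial>?M))
      \<le> (\<integral>\<^sup>+y. m * (\<integral>\<^sup>+t. ennreal (\<bar>g (y + T t)\<bar> powr p) \<partial>?M) \<partial>lborel)"
    unfolding Lp_pow_def nn_integral_completion
  proof (rule nn_integral_mono)
    fix y
    have "\<bar>\<kappa> y * (\<integral>t. g (y + T t) \<partial>?M)\<bar> \<le> 1 * \<bar>\<integral>t. g (y + T t) \<partial>?M\<bar>"
      unfolding abs_mult using \<kappa>(2,3)[of y] by (intro mult_right_mono) auto
    then have "\<bar>\<kappa> y * (\<integral>t. g (y + T t) \<partial>?M)\<bar> powr p \<le> \<bar>\<integral>t. g (y + T t) \<partial>?M\<bar> powr p"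
      using p by (intro powr_mono2) auto
    then have "ennreal (\<bar>\<kappa> y * (\<integral>t. g (y + T t) \<partial>?M)\<bar> powr p) \<le> ennreal (\<bar>\<integral>t. g (y + T t) \<partial>?M\<bar> powr p)"
      by (rule ennreal_leI)
    also have "\<dots> \<le> m * (\<integral>\<^sup>+t. ennreal (\<bar>g (y + T t)\<bar> powr p) \<partial>?M)"
      unfolding m_def using p by (intro powr_integral_le) measurable
    finally show "ennreal (norm (\<kappa> y * (\<integral>t. g (y + T t) \<partial>?M)) powr p) * indicator UNIV y
        \<le> m * (\<integral>\<^sup>+t. ennreal (\<bar>g (y + T t)\<bar> powr p) \<partial>?M)" by simp
  qed
  also have "\<dots> = m * (\<integral>\<^sup>+y. (\<integral>\<^sup>+t. ennreal (\<bar>g (y + T t)\<bar> powr p) \<partial>?M) \<partial>lborel)"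
    by (rule nn_integral_cmult) measurable
  also have "(\<integral>\<^sup>+y. (\<integral>\<^sup>+t. ennreal (\<bar>g (y + T t)\<bar> powr p) \<partial>?M) \<partial>lborel)
      = (\<integral>\<^sup>+t. (\<integral>\<^sup>+y. ennreal (\<bar>g (y + T t)\<bar> powr p) \<partial>lborel) \<partial>?M)"
    by (rule P.Fubini'[symmetric]) measurable
  also have "\<dots> = (\<integral>\<^sup>+t. ?J \<partial>?M)"
    using nn_integral_lborel_affine[of "\<lambda>y. ennreal (\<bar>g y\<bar> powr p)" 1 "T t" for t] by (simp add: add.commute)
  also have "m * \<dots> < \<infinity>"
    using J by (simp add: m_def ennreal_mult_less_top emeasure_eq_measure)
  finally show ?thesis using that[OF W] by (simp add: T_def)
qed

lemma weak_deriv_Lp_lower_order: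
  fixes v :: "real^'n \<Rightarrow> real"
  assumes p: "p \<ge> 1" and v0: "AE x in lebesgue. x \<notin> ball 0 r \<longrightarrow> v x = 0"
    and "j \<le> k" "\<And>is. length is = k \<Longrightarrow> \<exists>f. weak_deriv UNIV is v f \<and> Lp_pow UNIV p f < \<infinity>"
  shows "length is = j \<Longrightarrow> \<exists>f. weak_deriv UNIV is v f \<and> Lp_pow UNIV p f < \<infinity>"
  using assms(3,4)
proof (induction k arbitrary: "is")
  case (Suc k)
  have *: "\<exists>f. weak_deriv UNIV is v f \<and> Lp_pow UNIV p f < \<infinity>" if "length is = k" for "is"
  proof -
    \<comment> \<open>The hypothesis covers all lists of full length, so any direction may be
      appended; \<open>undefined\<close> is an arbitrary choice.\<close>
    obtain f where "weak_deriv UNIV (is @ [undefined]) v f" "Lp_pow UNIV p f < \<infinity>"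
      using Suc.prems(3)[of "is @ [undefined]"] \<open>length is = k\<close> by auto
    from weak_deriv_Lp_step_down[OF this p v0] show ?thesis by blast
  qed
  show ?case
  proof (cases "j = Suc k")
    case True
    then show ?thesis using Suc.prems by blast
  next
    case False
    then show ?thesis using Suc.IH[OF Suc.prems(1) _ *] Suc.prems(2) by simp
  qed
qed auto

subsection \<open>Regularity of the boundary\<close>

text \<open>The translates of \<open>S\<close> by multiples of \<open>3\<delta>\<nu>\<close> are disjoint.\<close>

lemma emeasure_strip_le:
  fixes S :: "(real^'n) set" and \<Phi> :: "real^'n \<Rightarrow> real"
  assumes S [measurable]: "S \<in> sets borel" and Sb: "S \<subseteq> ball x0 r"
    and \<Phi>: "\<And>x t. \<Phi> (x + t *\<^sub>R \<nu>) = \<Phi> x + t" and S\<delta>: "\<And>x. x \<in> S \<Longrightarrow> \<bar>\<Phi> x\<bar> \<le> \<delta>"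
    and \<nu>: "norm \<nu> = 1" and \<delta>: "0 < \<delta>" "\<delta> \<le> 1 / 6"
  shows "emeasure lborel S \<le> ennreal (6 * \<delta> * measure lborel (ball x0 (r + 1)))"
proof -
  \<comment> \<open>On the \<open>j\<close>-th translate, \<Phi> stays within \<delta> of
    \<open>3 * \<delta> * j\<close>, which separates the translates. About
    \<open>1 / (3 * \<delta>)\<close> of them fit while the total shift is at most 1, hence the
    radius \<open>r + 1\<close>. As \<open>1 / (3 * \<delta>)\<close> is at least 2, rounding down
    loses at most half, and 3 becomes 6.\<close>
  define N where "N = nat \<lfloor>1 / (3 * \<delta>)\<rfloor>"
  have N: "real N \<le> 1 / (3 * \<delta>)" "1 / (6 * \<delta>) \<le> real N"
  proof -
    have "1 / (6 * \<delta>) \<ge> 1" using \<delta> by (simp add: field_simps)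
    moreover have "1 / (3 * \<delta>) = 2 * (1 / (6 * \<delta>))" by simp
    moreover have "real N = real_of_int \<lfloor>1 / (3 * \<delta>)\<rfloor>" unfolding N_def using \<delta> by simp
    ultimately show "real N \<le> 1 / (3 * \<delta>)" "1 / (6 * \<delta>) \<le> real N"
      by linarith+
  qed
  define A where "A j = (\<lambda>x. x + (3 * \<delta> * real j) *\<^sub>R \<nu>) ` S" for j :: nat
  have A_eq: "A j = (\<lambda>x. - (3 * \<delta> * real j) *\<^sub>R \<nu> + x) -` S" for j
    unfolding A_def by (auto intro!: image_eqI[where x = "_ - (3 * \<delta> * real j) *\<^sub>R \<nu>"])
  have A_sets [measurable]: "A j \<in> sets borel" for j
  proof -
    have "(\<lambda>x. - (3 * \<delta> * real j) *\<^sub>R \<nu> + x) -` S \<inter> space lborel \<in> sets lborel"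
      by (rule measurable_sets[OF _ S]) measurable
    then show ?thesis unfolding A_eq by (simp only: space_lborel space_borel sets_lborel Int_UNIV_right)
  qed
  have A_meas: "emeasure lborel (A j) = emeasure lborel S" for j
  proof -
    have "emeasure lborel S = emeasure (distr lborel borel ((+) (- (3 * \<delta> * real j) *\<^sub>R \<nu>))) S"
      by (simp only: lborel_distr_plus)
    also have "\<dots> = emeasure lborel (A j)"
      unfolding A_eq by (subst emeasure_distr) auto
    finally show ?thesis by simp
  qed
  have disj: "disjoint_family_on A {..<N}"
    unfolding disjoint_family_on_def
  proof (intro ballI impI)
    fix i j :: nat assume "i \<noteq> j"
    have False if "x + (3 * \<delta> * real i) *\<^sub>R \<nu> = y + (3 * \<delta> * real j) *\<^sub>R \<nu>" "x \<in> S" "y \<in> S" for x y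
    proof -
      have "\<Phi> x + 3 * \<delta> * real i = \<Phi> y + 3 * \<delta> * real j"
        using that(1) \<Phi> by metis
      then have "\<bar>3 * \<delta> * real i - 3 * \<delta> * real j\<bar> \<le> 2 * \<delta>"
        using S\<delta>[OF that(2)] S\<delta>[OF that(3)] by linarith
      moreover have "\<bar>3 * \<delta> * real i - 3 * \<delta> * real j\<bar> = 3 * \<delta> * \<bar>real i - real j\<bar>"
        using \<delta> by (simp add: abs_mult right_diff_distrib[symmetric])
      moreover have "\<bar>real i - real j\<bar> \<ge> 1" using \<open>i \<noteq> j\<close> by linarith
      then have "3 * \<delta> * \<bar>real i - real j\<bar> \<ge> 3 * \<delta> * 1" using \<delta> by (intro mult_left_mono) auto
      ultimately show False using \<delta> by linarith
    qed
    then show "A i \<inter> A j = {}" unfolding A_def by blast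
  qed
  have sub: "(\<Union>j<N. A j) \<subseteq> ball x0 (r + 1)"
  proof safe
    fix j x assume j: "j < N" "x \<in> A j"
    then obtain y where y: "y \<in> S" "x = y + (3 * \<delta> * real j) *\<^sub>R \<nu>" by (auto simp: A_def)
    have "3 * \<delta> * real j \<le> 3 * \<delta> * (1 / (3 * \<delta>))"
      using j N(1) \<delta> by (intro mult_left_mono) auto
    then have "norm ((3 * \<delta> * real j) *\<^sub>R \<nu>) \<le> 1" using \<delta> \<nu> by simp
    moreover have "norm (x0 - y) < r" using y Sb by (auto simp: dist_norm)
    moreover have "norm (x0 - x) \<le> norm (x0 - y) + norm ((3 * \<delta> * real j) *\<^sub>R \<nu>)"
      unfolding y(2) by (metis diff_diff_eq norm_triangle_ineq4)
    ultimately show "x \<in> ball x0 (r + 1)" by (simp add: dist_norm)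
  qed
  have "ennreal (real N) * emeasure lborel S = (\<Sum>j<N. emeasure lborel (A j))"
    by (simp add: A_meas ennreal_of_nat_eq_real_of_nat)
  also have "\<dots> = emeasure lborel (\<Union>j<N. A j)"
    by (rule sum_emeasure) (use disj in auto)
  also have "\<dots> \<le> emeasure lborel (ball x0 (r + 1))"
    by (rule emeasure_mono[OF sub]) simp
  also have "\<dots> = ennreal (measure lborel (ball x0 (r + 1)))"
    by (rule emeasure_eq_ennreal_measure) (use emeasure_lborel_ball_finite in \<open>auto simp: top.not_eq_extremum\<close>)
  finally have NS: "ennreal (real N) * emeasure lborel S \<le> ennreal (measure lborel (ball x0 (r + 1)))" .
  have "emeasure lborel S = ennreal (6 * \<delta>) * ennreal (1 / (6 * \<delta>)) * emeasure lborel S"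
    using \<delta> by (simp flip: ennreal_mult)
  also have "\<dots> \<le> ennreal (6 * \<delta>) * ennreal (real N) * emeasure lborel S"
    using N(2) by (intro mult_right_mono mult_left_mono ennreal_leI) auto
  also have "\<dots> \<le> ennreal (6 * \<delta>) * ennreal (measure lborel (ball x0 (r + 1)))"
    using NS by (simp only: mult.assoc) (intro mult_left_mono, auto)
  also have "\<dots> = ennreal (6 * \<delta> * measure lborel (ball x0 (r + 1)))"
    using \<delta> by (simp add: ennreal_mult)
  finally show ?thesis .
qed

text \<open>A globally Lipschitz gradient grows at most linearly and is therefore bounded on each
  ball, which is convex.\<close>

lemma C11_fun_lipschitz_cball:
  fixes \<gamma> :: "real^'n \<Rightarrow> real"
  assumes "C11_fun \<gamma>"
  obtains B where "B \<ge> 0" "\<And>x y. x \<in> cball 0 \<rho> \<Longrightarrow> y \<in> cball 0 \<rho> \<Longrightarrow> \<bar>\<gamma> x - \<gamma> y\<bar> \<le> B * norm (x - y)"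
proof -
  obtain g L where g: "\<And>x. (\<gamma> has_derivative (\<lambda>h. g x \<bullet> h)) (at x)" and L: "L-lipschitz_on UNIV g"
    using assms unfolding C11_fun_def by blast
  have L0: "L \<ge> 0" using L by (rule lipschitz_on_nonneg)
  define B where "B = norm (g 0) + L * \<bar>\<rho>\<bar>"
  have gB: "norm (g x) \<le> B" if "x \<in> cball 0 \<rho>" for x
  proof -
    have "dist (g x) (g 0) \<le> L * dist x 0" by (rule lipschitz_onD[OF L]) auto
    then have "norm (g x - g 0) \<le> L * norm x" by (simp add: dist_norm)
    also have "\<dots> \<le> L * \<bar>\<rho>\<bar>" using that L0 by (intro mult_left_mono) auto
    finally show ?thesis unfolding B_def using norm_triangle_sub[of "g x" "g 0"] by linarith
  qed
  show ?thesis
  proof (rule that[of B])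
    show "B \<ge> 0" using L0 by (simp add: B_def)
    fix x y :: "real^'n" assume xy: "x \<in> cball 0 \<rho>" "y \<in> cball 0 \<rho>"
    have "norm (\<gamma> x - \<gamma> y) \<le> B * norm (x - y)"
    proof (rule differentiable_bound[of "cball 0 \<rho>" \<gamma> "\<lambda>x h. g x \<bullet> h" B x y])
      show "(\<gamma> has_derivative (\<lambda>h. g x \<bullet> h)) (at x within cball 0 \<rho>)" for x
        using g by (rule has_derivative_at_withinI)
      show "onorm (\<lambda>h. g x \<bullet> h) \<le> B" if "x \<in> cball 0 \<rho>" for x
      proof (rule onorm_le)
        fix h
        have "norm (g x \<bullet> h) \<le> norm (g x) * norm h" by (simp add: Cauchy_Schwarz_ineq2)
        also have "\<dots> \<le> B * norm h" using gB[OF that] by (intro mult_right_mono) auto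
        finally show "norm (g x \<bullet> h) \<le> B * norm h" .
      qed
    qed (use xy in auto)
    then show "\<bar>\<gamma> x - \<gamma> y\<bar> \<le> B * norm (x - y)" by simp
  qed
qed

text \<open>An exterior corkscrew condition together with a linear bound on the volume of boundary
  neighbourhoods: exactly the two facts about \<Omega> used in the layer. Localising to
  \<open>T\<close> allows gluing of charts, and the superset \<open>S\<close> allows the strip of a
  chart to be used.\<close>

definition regular_boundary_part :: "(real^'n) set \<Rightarrow> (real^'n) set \<Rightarrow> bool" where
  "regular_boundary_part \<Omega> T \<longleftrightarrow> (\<exists>C>0. \<exists>e1>0. \<forall>e. 0 < e \<and> e < e1 \<longrightarrow>
     (\<forall>z\<in>frontier \<Omega> \<inter> T. \<exists>y. norm (z - y) \<le> C * e \<and> ball y e \<inter> \<Omega> = {}) \<and>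
     (\<exists>S\<in>sets borel. {x. \<exists>z\<in>frontier \<Omega> \<inter> T. norm (x - z) < e} \<subseteq> S \<and> emeasure lborel S \<le> ennreal (C * e)))"

lemma regular_boundary_partI:
  assumes "C > 0" "e1 > 0"
    and "\<And>e z. 0 < e \<Longrightarrow> e < e1 \<Longrightarrow> z \<in> frontier \<Omega> \<inter> T \<Longrightarrow> \<exists>y. norm (z - y) \<le> C * e \<and> ball y e \<inter> \<Omega> = {}"
    and "\<And>e. 0 < e \<Longrightarrow> e < e1 \<Longrightarrow>
      \<exists>S\<in>sets borel. {x. \<exists>z\<in>frontier \<Omega> \<inter> T. norm (x - z) < e} \<subseteq> S \<and> emeasure lborel S \<le> ennreal (C * e)"
  shows "regular_boundary_part \<Omega> T"
  unfolding regular_boundary_part_def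
  by (rule exI[of _ C], intro conjI assms(1), rule exI[of _ e1]) (use assms in blast)

lemma regular_boundary_partE:
  assumes "regular_boundary_part \<Omega> T"
  obtains C e1 where "C > 0" "e1 > 0"
    "\<And>e z. 0 < e \<Longrightarrow> e < e1 \<Longrightarrow> z \<in> frontier \<Omega> \<inter> T \<Longrightarrow> \<exists>y. norm (z - y) \<le> C * e \<and> ball y e \<inter> \<Omega> = {}"
    "\<And>e. 0 < e \<Longrightarrow> e < e1 \<Longrightarrow>
      \<exists>S\<in>sets borel. {x. \<exists>z\<in>frontier \<Omega> \<inter> T. norm (x - z) < e} \<subseteq> S \<and> emeasure lborel S \<le> ennreal (C * e)"
  using assms[unfolded regular_boundary_part_def]
proof (elim exE conjE)
  fix C e1 assume C: "C > 0" "e1 > 0" and *: "\<forall>e. 0 < e \<and> e < e1 \<longrightarrow>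
     (\<forall>z\<in>frontier \<Omega> \<inter> T. \<exists>y. norm (z - y) \<le> C * e \<and> ball y e \<inter> \<Omega> = {}) \<and>
     (\<exists>S\<in>sets borel. {x. \<exists>z\<in>frontier \<Omega> \<inter> T. norm (x - z) < e} \<subseteq> S \<and> emeasure lborel S \<le> ennreal (C * e))"
  note * = *[rule_format, OF conjI]
  show thesis
    by (rule that[OF C]) (erule (1) *[THEN conjunct1, THEN bspec], assumption, erule (1) *[THEN conjunct2])
qed

text \<open>In the chart, \<Phi> is the height over the graph: positive exactly in \<Omega>, locally
  Lipschitz, and increasing at unit speed along \<nu>. Moving a boundary point against \<nu> gives
  exterior balls; neighbourhoods of the boundary lie in strips
  \<open>\<bar>\<Phi>\<bar> \<le> \<Lambda> * e\<close>, to which \<open>emeasure_strip_le\<close>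
  applies.\<close>

lemma regular_boundary_part_local:
  fixes \<Omega> :: "(real^'n) set"
  assumes "C11_domain \<Omega>" "x0 \<in> frontier \<Omega>"
  obtains \<rho> where "\<rho> > 0" "regular_boundary_part \<Omega> (ball x0 \<rho>)"
proof -
  obtain r \<nu> \<gamma> where r: "r > 0" and \<nu>: "norm \<nu> = 1" and \<gamma>: "C11_fun \<gamma>"
    and graph: "\<Omega> \<inter> ball x0 r = {y \<in> ball x0 r. \<gamma> (y - (y \<bullet> \<nu>) *\<^sub>R \<nu>) < y \<bullet> \<nu>}"
    using assms unfolding C11_domain_def by blast
  have op: "open \<Omega>" using assms unfolding C11_domain_def by blast
  have \<nu>\<nu>: "\<nu> \<bullet> \<nu> = 1" using \<nu> by (simp add: norm_eq_1)
  define P where "P y = y - (y \<bullet> \<nu>) *\<^sub>R \<nu>" for y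
  define \<Phi> where "\<Phi> y = y \<bullet> \<nu> - \<gamma> (P y)" for y
  have P_lip: "norm (P x - P y) \<le> 2 * norm (x - y)" for x y
  proof -
    have "P x - P y = (x - y) - ((x - y) \<bullet> \<nu>) *\<^sub>R \<nu>" by (simp add: P_def inner_diff_left scaleR_diff_left)
    also have "norm \<dots> \<le> norm (x - y) + norm (((x - y) \<bullet> \<nu>) *\<^sub>R \<nu>)" by (rule norm_triangle_ineq4)
    also have "norm (((x - y) \<bullet> \<nu>) *\<^sub>R \<nu>) \<le> norm (x - y)"
      using Cauchy_Schwarz_ineq2[of "x - y" \<nu>] \<nu> by simp
    finally show ?thesis by simp
  qed
  define \<rho>0 where "\<rho>0 = 2 * (norm x0 + r)"
  have P_ball: "P y \<in> cball 0 \<rho>0" if "y \<in> ball x0 r" for y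
  proof -
    have "norm y \<le> norm x0 + norm (x0 - y)" by (metis norm_triangle_sub norm_minus_commute)
    then have "norm y \<le> norm x0 + r" using that by (simp add: dist_norm)
    moreover have "norm (P y) \<le> 2 * norm y" using P_lip[of y 0] by (simp add: P_def)
    ultimately show ?thesis by (simp add: \<rho>0_def)
  qed
  obtain B where B: "B \<ge> 0" "\<And>x y. x \<in> cball 0 \<rho>0 \<Longrightarrow> y \<in> cball 0 \<rho>0 \<Longrightarrow> \<bar>\<gamma> x - \<gamma> y\<bar> \<le> B * norm (x - y)"
    using C11_fun_lipschitz_cball[OF \<gamma>] by blast
  define \<Lambda> where "\<Lambda> = 1 + 2 * B"
  have \<Lambda>: "\<Lambda> \<ge> 1" using B by (simp add: \<Lambda>_def)
  have lip: "\<bar>\<Phi> x - \<Phi> y\<bar> \<le> \<Lambda> * norm (x - y)" if "x \<in> ball x0 r" "y \<in> ball x0 r" for x y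
  proof -
    have "\<bar>\<gamma> (P x) - \<gamma> (P y)\<bar> \<le> B * (2 * norm (x - y))"
      using B(2)[OF P_ball[OF that(1)] P_ball[OF that(2)]] mult_left_mono[OF P_lip B(1)] by (rule order_trans)
    moreover have "\<bar>x \<bullet> \<nu> - y \<bullet> \<nu>\<bar> \<le> norm (x - y)"
      using Cauchy_Schwarz_ineq2[of "x - y" \<nu>] \<nu> by (simp add: inner_diff_left)
    moreover have "\<Lambda> * norm (x - y) = norm (x - y) + B * (2 * norm (x - y))"
      by (simp add: \<Lambda>_def distrib_right)
    ultimately show ?thesis unfolding \<Phi>_def by linarith
  qed
  have \<Phi>_shift: "\<Phi> (x + t *\<^sub>R \<nu>) = \<Phi> x + t" for x t
    by (simp add: \<Phi>_def P_def inner_add_left \<nu>\<nu> scaleR_add_left)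
  have \<Omega>_iff: "y \<in> \<Omega> \<longleftrightarrow> \<Phi> y > 0" if "y \<in> ball x0 r" for y
  proof -
    have "y \<in> \<Omega> \<inter> ball x0 r \<longleftrightarrow> y \<in> {y \<in> ball x0 r. \<gamma> (P y) < y \<bullet> \<nu>}"
      unfolding P_def graph ..
    then show ?thesis using that unfolding \<Phi>_def by simp
  qed
  \<comment> \<open>A frontier point is not in the open set \<Omega>, so its height is at most 0.
    Strictly negative height would persist on a neighbourhood disjoint from \<Omega>.\<close>
  have \<Phi>0: "\<Phi> z = 0" if z: "z \<in> frontier \<Omega>" "z \<in> ball x0 r" for z
  proof (rule ccontr)
    assume "\<Phi> z \<noteq> 0"
    moreover have "z \<notin> \<Omega>" using z(1) op by (simp add: frontier_def interior_open)
    ultimately have neg: "\<Phi> z < 0" using \<Omega>_iff[OF z(2)] by linarith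
    define d where "d = min (- \<Phi> z / \<Lambda>) (r - dist x0 z)"
    have "d > 0" using neg \<Lambda> z(2) by (simp add: d_def divide_neg_pos)
    have "y \<notin> \<Omega>" if "dist y z < d" for y
    proof -
      have "dist x0 y \<le> dist x0 z + dist y z" by (metis dist_commute dist_triangle)
      then have y: "y \<in> ball x0 r" using that by (simp add: d_def)
      have "\<Lambda> * norm (y - z) < - \<Phi> z"
      proof -
        have "norm (y - z) < - \<Phi> z / \<Lambda>" using that unfolding d_def dist_norm by (rule min_less_iff_conj[THEN iffD1, THEN conjunct1])
        then have "norm (y - z) * \<Lambda> < - \<Phi> z" using \<Lambda> by (subst (asm) pos_less_divide_eq) auto
        then show ?thesis by (simp add: mult.commute)
      qed
      then show ?thesis using lip[OF y z(2)] \<Omega>_iff[OF y] by linarith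
    qed
    then have "z \<notin> closure \<Omega>" using \<open>d > 0\<close> closure_approachable by blast
    then show False using z(1) by (simp add: frontier_def)
  qed
  have \<gamma>_cont: "continuous_on UNIV \<gamma>"
    using \<gamma> unfolding C11_fun_def
    by (metis continuous_at_imp_continuous_on has_derivative_continuous)
  have "continuous_on UNIV \<Phi>"
    unfolding \<Phi>_def P_def by (intro continuous_intros continuous_on_compose2[OF \<gamma>_cont]) auto
  then have [measurable]: "\<Phi> \<in> borel_measurable borel" by (rule borel_measurable_continuous_onI)
  define V where "V = measure lborel (ball x0 (r + 1))"
  \<comment> \<open>\<open>6 * \<Lambda> * V\<close> comes from the strip estimate with \<delta> =
    \<open>\<Lambda> * e\<close>, and \<open>2 * \<Lambda>\<close> from the displacement of a
    boundary point. The bound \<open>e1\<close> keeps displaced balls inside the chart and makes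
    \<open>\<Lambda> * e\<close> at most 1/6.\<close>
  define C where "C = 6 * \<Lambda> * V + 2 * \<Lambda>"
  define e1 where "e1 = min (r / 2 / (2 * \<Lambda> + 1)) (1 / (6 * \<Lambda>))"
  have V: "V \<ge> 0" by (simp add: V_def)
  have "regular_boundary_part \<Omega> (ball x0 (r / 2))"
  proof (rule regular_boundary_partI)
    show "C > 0" using V \<Lambda> by (simp add: C_def add_nonneg_pos)
    show "e1 > 0" using r \<Lambda> by (simp add: e1_def)
    fix e assume e0: "0 < e" "e < e1"
    then have e: "0 < e \<and> e < e1" by simp
    have e2: "(2 * \<Lambda> + 1) * e < r / 2" using e \<Lambda> by (simp add: e1_def field_simps)
    have e3: "\<Lambda> * e \<le> 1 / 6" using e \<Lambda> by (simp add: e1_def field_simps)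
    show "\<exists>y. norm (z - y) \<le> C * e \<and> ball y e \<inter> \<Omega> = {}" if z: "z \<in> frontier \<Omega> \<inter> ball x0 (r / 2)" for z
    proof -
      \<comment> \<open>The height at \<open>y\<close> is \<open>- 2 * \<Lambda> * e\<close>; on
        \<open>ball y e\<close> it changes by at most \<open>\<Lambda> * e\<close> and so stays
        negative.\<close>
      define y where "y = z - (2 * \<Lambda> * e) *\<^sub>R \<nu>"
      have zy: "norm (z - y) = 2 * \<Lambda> * e" using e \<Lambda> \<nu> by (simp add: y_def)
      have y_ball: "w \<in> ball x0 r" if "norm (w - y) < e" for w
      proof -
        have "dist x0 w \<le> dist x0 z + norm (z - y) + norm (w - y)"
          using dist_triangle[of x0 w z] dist_triangle[of z w y] by (simp add: dist_norm norm_minus_commute)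
        then show ?thesis using z e2 zy that by (simp add: distrib_right)
      qed
      have "w \<notin> \<Omega>" if "w \<in> ball y e" for w
      proof -
        have wy: "norm (w - y) < e" using that by (simp add: dist_norm norm_minus_commute)
        have zb: "z \<in> ball x0 r" using z r by simp
        have "\<Phi> y = - (2 * \<Lambda> * e)"
          using \<Phi>_shift[of z "- (2 * \<Lambda> * e)"] \<Phi>0[OF _ zb] z by (simp add: y_def)
        moreover have "\<bar>\<Phi> w - \<Phi> y\<bar> \<le> \<Lambda> * norm (w - y)"
          using lip[OF y_ball[OF wy] y_ball[of y]] e by simp
        moreover have "\<Lambda> * norm (w - y) \<le> \<Lambda> * e" using wy \<Lambda> by (intro mult_left_mono) auto
        moreover have "\<Lambda> * e > 0" using e \<Lambda> by simp
        ultimately show ?thesis using \<Omega>_iff[OF y_ball[OF wy]] by linarith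
      qed
      moreover have "norm (z - y) \<le> C * e"
        unfolding zy C_def using e V \<Lambda> by (simp add: distrib_right)
      ultimately show ?thesis by blast
    qed
    define S where "S = {x \<in> ball x0 r. \<bar>\<Phi> x\<bar> \<le> \<Lambda> * e}"
    have S [measurable]: "S \<in> sets borel" unfolding S_def by measurable
    have "emeasure lborel S \<le> ennreal (6 * (\<Lambda> * e) * V)"
      unfolding V_def
      by (rule emeasure_strip_le[of S x0 r \<Phi> \<nu>]) (use S \<Phi>_shift \<nu> e \<Lambda> e3 in \<open>auto simp: S_def\<close>)
    also have "\<dots> \<le> ennreal (C * e)"
      unfolding C_def using e \<Lambda> by (intro ennreal_leI) (simp add: algebra_simps)
    finally have 1: "emeasure lborel S \<le> ennreal (C * e)" .
    have 2: "x \<in> S" if z: "z \<in> frontier \<Omega> \<inter> ball x0 (r / 2)" "norm (x - z) < e" for x z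
    proof -
      have "dist x0 x \<le> dist x0 z + norm (x - z)" by (metis dist_commute dist_norm dist_triangle)
      moreover have "e \<le> (2 * \<Lambda> + 1) * e" using e \<Lambda> by (simp add: mult_le_cancel_right1)
      ultimately have x: "x \<in> ball x0 r" using z e2 by simp
      have zb: "z \<in> ball x0 r" using z r by simp
      have "\<bar>\<Phi> x - \<Phi> z\<bar> \<le> \<Lambda> * norm (x - z)" by (rule lip[OF x zb])
      also have "\<dots> \<le> \<Lambda> * e" using z \<Lambda> by (intro mult_left_mono) auto
      finally show ?thesis using x \<Phi>0[OF _ zb] z by (simp add: S_def)
    qed
    show "\<exists>S\<in>sets borel. {x. \<exists>z\<in>frontier \<Omega> \<inter> ball x0 (r / 2). norm (x - z) < e} \<subseteq> S \<and> emeasure lborel S \<le> ennreal (C * e)"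
      using S 1 2 by blast
  qed
  then show ?thesis using that r by (metis half_gt_zero)
qed

lemma regular_boundary_part_Un:
  assumes "regular_boundary_part \<Omega> T1" "regular_boundary_part \<Omega> T2"
  shows "regular_boundary_part \<Omega> (T1 \<union> T2)"
proof -
  obtain C1 d1 where 1: "C1 > 0" "d1 > 0"
    "\<And>e z. 0 < e \<Longrightarrow> e < d1 \<Longrightarrow> z \<in> frontier \<Omega> \<inter> T1 \<Longrightarrow> \<exists>y. norm (z - y) \<le> C1 * e \<and> ball y e \<inter> \<Omega> = {}"
    "\<And>e. 0 < e \<Longrightarrow> e < d1 \<Longrightarrow>
      \<exists>S\<in>sets borel. {x. \<exists>z\<in>frontier \<Omega> \<inter> T1. norm (x - z) < e} \<subseteq> S \<and> emeasure lborel S \<le> ennreal (C1 * e)"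
    using assms(1) by (elim regular_boundary_partE) (rule that)
  obtain C2 d2 where 2: "C2 > 0" "d2 > 0"
    "\<And>e z. 0 < e \<Longrightarrow> e < d2 \<Longrightarrow> z \<in> frontier \<Omega> \<inter> T2 \<Longrightarrow> \<exists>y. norm (z - y) \<le> C2 * e \<and> ball y e \<inter> \<Omega> = {}"
    "\<And>e. 0 < e \<Longrightarrow> e < d2 \<Longrightarrow>
      \<exists>S\<in>sets borel. {x. \<exists>z\<in>frontier \<Omega> \<inter> T2. norm (x - z) < e} \<subseteq> S \<and> emeasure lborel S \<le> ennreal (C2 * e)"
    using assms(2) by (elim regular_boundary_partE) (rule that)
  show ?thesis
  proof (rule regular_boundary_partI)
    show "C1 + C2 > 0" "min d1 d2 > 0" using 1 2 by auto
    fix e assume e0: "0 < e" "e < min d1 d2"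
    then have e: "0 < e \<and> e < min d1 d2" by simp
    have le: "C1 * e \<le> (C1 + C2) * e" "C2 * e \<le> (C1 + C2) * e" using e 1 2 by simp_all
    show "\<exists>y. norm (z - y) \<le> (C1 + C2) * e \<and> ball y e \<inter> \<Omega> = {}" if zT: "z \<in> frontier \<Omega> \<inter> (T1 \<union> T2)" for z
    proof (cases "z \<in> T1")
      case True
      then obtain y where "norm (z - y) \<le> C1 * e" "ball y e \<inter> \<Omega> = {}" using 1(3)[of e z] e zT by auto
      then show ?thesis using le(1) order_trans by blast
    next
      case False
      then obtain y where "norm (z - y) \<le> C2 * e" "ball y e \<inter> \<Omega> = {}" using 2(3)[of e z] e zT by auto
      then show ?thesis using le(2) order_trans by blast
    qed
    obtain S1 where S1: "S1 \<in> sets borel" "{x. \<exists>z\<in>frontier \<Omega> \<inter> T1. norm (x - z) < e} \<subseteq> S1" "emeasure lborel S1 \<le> ennreal (C1 * e)"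
      using 1(4)[of e] e by auto
    obtain S2 where S2: "S2 \<in> sets borel" "{x. \<exists>z\<in>frontier \<Omega> \<inter> T2. norm (x - z) < e} \<subseteq> S2" "emeasure lborel S2 \<le> ennreal (C2 * e)"
      using 2(4)[of e] e by auto
    have "emeasure lborel (S1 \<union> S2) \<le> emeasure lborel S1 + emeasure lborel S2"
      using S1 S2 by (intro emeasure_subadditive) auto
    also have "\<dots> \<le> ennreal (C1 * e) + ennreal (C2 * e)" using S1 S2 by (intro add_mono)
    also have "\<dots> = ennreal ((C1 + C2) * e)" using 1 2 e by (simp add: ennreal_plus[symmetric] distrib_right del: ennreal_plus)
    finally show "\<exists>S\<in>sets borel. {x. \<exists>z\<in>frontier \<Omega> \<inter> (T1 \<union> T2). norm (x - z) < e} \<subseteq> S \<and> emeasure lborel S \<le> ennreal ((C1 + C2) * e)"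
      using S1 S2 by (intro bexI[of _ "S1 \<union> S2"]) auto
  qed
qed

text \<open>The frontier of a bounded set is compact, so finitely many charts cover it and are glued
  by \<open>regular_boundary_part_Un\<close>.\<close>

lemma regular_boundary:
  fixes \<Omega> :: "(real^'n) set"
  assumes \<Omega>: "C11_domain \<Omega>" "bounded \<Omega>"
  obtains C e1 where "C > 0" "e1 > 0"
    "\<And>e z. 0 < e \<Longrightarrow> e < e1 \<Longrightarrow> z \<in> frontier \<Omega> \<Longrightarrow> \<exists>y. norm (z - y) \<le> C * e \<and> ball y e \<inter> \<Omega> = {}"
    "\<And>e. 0 < e \<Longrightarrow> e < e1 \<Longrightarrow> \<exists>S\<in>sets borel. {x. \<exists>z\<in>frontier \<Omega>. norm (x - z) < e} \<subseteq> S \<and> emeasure lborel S \<le> ennreal (C * e)"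
proof -
  have "\<exists>\<rho>>0. regular_boundary_part \<Omega> (ball x0 \<rho>)" if "x0 \<in> frontier \<Omega>" for x0
    using regular_boundary_part_local[OF \<Omega>(1) that] by metis
  then obtain \<rho> where \<rho>: "\<And>x. x \<in> frontier \<Omega> \<Longrightarrow> \<rho> x > 0 \<and> regular_boundary_part \<Omega> (ball x (\<rho> x))"
    by metis
  have "compact (frontier \<Omega>)" using \<Omega>(2) by (rule compact_frontier_bounded)
  then obtain D where D: "D \<subseteq> frontier \<Omega>" "finite D" "frontier \<Omega> \<subseteq> (\<Union>x\<in>D. ball x (\<rho> x))"
    by (rule compactE_image[of _ "frontier \<Omega>" "\<lambda>x. ball x (\<rho> x)"]) (use \<rho> in force)+
  have empty: "regular_boundary_part \<Omega> {}"
    by (rule regular_boundary_partI[of 1 1]) (auto intro!: bexI[of _ "{}"])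
  have "regular_boundary_part \<Omega> (\<Union>x\<in>D. ball x (\<rho> x))"
    using D(2,1)
  proof (induction D)
    case (insert x D)
    then show ?case using \<rho> regular_boundary_part_Un[of \<Omega> "ball x (\<rho> x)" "\<Union>x\<in>D. ball x (\<rho> x)"] by auto
  qed (use empty in simp)
  then obtain C e1 where *: "C > 0" "e1 > 0"
    "\<And>e z. 0 < e \<Longrightarrow> e < e1 \<Longrightarrow> z \<in> frontier \<Omega> \<inter> (\<Union>x\<in>D. ball x (\<rho> x)) \<Longrightarrow> \<exists>y. norm (z - y) \<le> C * e \<and> ball y e \<inter> \<Omega> = {}"
    "\<And>e. 0 < e \<Longrightarrow> e < e1 \<Longrightarrow>
      \<exists>S\<in>sets borel. {x. \<exists>z\<in>frontier \<Omega> \<inter> (\<Union>x\<in>D. ball x (\<rho> x)). norm (x - z) < e} \<subseteq> S \<and> emeasure lborel S \<le> ennreal (C * e)"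
    by (elim regular_boundary_partE) (rule that)
  have eq: "frontier \<Omega> \<inter> (\<Union>x\<in>D. ball x (\<rho> x)) = frontier \<Omega>" using D(3) by blast
  show ?thesis by (rule that[OF *[unfolded eq]])
qed

subsection \<open>Mollification and the Gagliardo seminorm\<close>

text \<open>There are finitely many direction lists of length at most \<open>m\<close>, so the sum
  of the individual constants works for all.\<close>

lemma iter_pderiv_mollifier_bound_length:
  obtains C where "C > 0"
    "\<And>is \<epsilon> x. length is \<le> m \<Longrightarrow> \<epsilon> > 0 \<Longrightarrow> \<bar>iter_pderiv is (mollifier \<epsilon>) (x :: real^'n)\<bar> \<le> C / \<epsilon> ^ (CARD('n) + length is)"
proof -
  have "\<exists>C. \<forall>is. C is > 0 \<and> (\<forall>\<epsilon> x. \<epsilon> > 0 \<longrightarrow> \<bar>iter_pderiv is (mollifier \<epsilon>) (x :: real^'n)\<bar> \<le> C is / \<epsilon> ^ (CARD('n) + length is))"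
  proof (intro choice allI)
    fix "is" :: "'n list"
    obtain C where "C > 0" "\<And>\<epsilon> x. \<epsilon> > 0 \<Longrightarrow> \<bar>iter_pderiv is (mollifier \<epsilon>) (x :: real^'n)\<bar> \<le> C / \<epsilon> ^ (CARD('n) + length is)"
      by (rule iter_pderiv_mollifier_bound[of "is"]) (rule that)
    then show "\<exists>C>0. \<forall>\<epsilon> x. \<epsilon> > 0 \<longrightarrow> \<bar>iter_pderiv is (mollifier \<epsilon>) (x :: real^'n)\<bar> \<le> C / \<epsilon> ^ (CARD('n) + length is)"
      by blast
  qed
  then obtain C where C: "\<And>is. C is > 0"
    "\<And>is \<epsilon> x. \<epsilon> > 0 \<Longrightarrow> \<bar>iter_pderiv is (mollifier \<epsilon>) (x :: real^'n)\<bar> \<le> C is / \<epsilon> ^ (CARD('n) + length is)"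
    by blast
  let ?I = "{is :: 'n list. length is \<le> m}"
  have fin: "finite ?I" using finite_lists_length_le[of "UNIV :: 'n set" m] by simp
  show ?thesis
  proof (rule that[of "sum C ?I"])
    have le: "C is \<le> sum C ?I" if "length is \<le> m" for "is"
      using that fin C(1) by (intro member_le_sum) (auto intro: less_imp_le)
    from le[of "[]"] C(1)[of "[]"] show "sum C ?I > 0" by simp
    fix "is" :: "'n list" and \<epsilon> :: real and x :: "real^'n"
    assume *: "length is \<le> m" "\<epsilon> > 0"
    have "C is / \<epsilon> ^ (CARD('n) + length is) \<le> sum C ?I / \<epsilon> ^ (CARD('n) + length is)"
      using le[OF *(1)] *(2) by (intro divide_right_mono) auto
    with C(2)[OF *(2), of "is" x] show "\<bar>iter_pderiv is (mollifier \<epsilon>) x\<bar> \<le> sum C ?I / \<epsilon> ^ (CARD('n) + length is)"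
      by (rule order_trans)
  qed
qed

text \<open>The kernel is at most of order \<open>\<epsilon>\<close> to the power
  \<open>- CARD('n) - length is\<close> on a ball of volume of order
  \<open>\<epsilon> ^ CARD('n)\<close>. The constant is uniform in \<open>f\<close> and
  \<epsilon>.\<close>

lemma conv_mollifier_bound:
  obtains C where "C > 0"
    "\<And>is \<epsilon> L f x. length is \<le> m \<Longrightarrow> \<epsilon> > 0 \<Longrightarrow> (\<And>y. \<bar>f y\<bar> \<le> L) \<Longrightarrow>
       \<bar>conv lborel (\<lambda>y. y) f (iter_pderiv is (mollifier \<epsilon>)) (x :: real^'n)\<bar> \<le> C * L / \<epsilon> ^ length is"
proof -
  obtain C where C: "C > 0" "\<And>is \<epsilon> x. length is \<le> m \<Longrightarrow> \<epsilon> > 0 \<Longrightarrow>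
      \<bar>iter_pderiv is (mollifier \<epsilon>) (x :: real^'n)\<bar> \<le> C / \<epsilon> ^ (CARD('n) + length is)"
    by (rule iter_pderiv_mollifier_bound_length) (rule that)
  define c where "c = unit_ball_vol (real CARD('n)) * real CARD('n) ^ CARD('n)"
  have c: "c > 0" by (simp add: c_def)
  show ?thesis
  proof (rule that[of "C * c"])
    show "C * c > 0" using C c by simp
    fix "is" :: "'n list" and \<epsilon> L :: real and f :: "real^'n \<Rightarrow> real" and x :: "real^'n"
    assume len: "length is \<le> m" and e: "\<epsilon> > 0" and f: "\<And>y. \<bar>f y\<bar> \<le> L"
    let ?K = "C / \<epsilon> ^ (CARD('n) + length is)"
    let ?B = "cball x (real CARD('n) * \<epsilon>)"
    have L: "L \<ge> 0" using f[of 0] by linarith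
    have K: "?K \<ge> 0" using C e by simp
    have int: "integrable lborel (\<lambda>y. L * ?K * indicator ?B y)"
      using emeasure_lborel_cball_finite[of x "real CARD('n) * \<epsilon>"] by (intro integrable_mult_right integrable_real_indicator) auto
    have "\<bar>conv lborel (\<lambda>y. y) f (iter_pderiv is (mollifier \<epsilon>)) x\<bar> \<le> (\<integral>y. \<bar>f y * iter_pderiv is (mollifier \<epsilon>) (x - y)\<bar> \<partial>lborel)"
      unfolding conv_def by (rule integral_abs_bound)
    also have "\<dots> \<le> (\<integral>y. L * ?K * indicator ?B y \<partial>lborel)"
    proof (rule integral_mono'[OF int])
      fix y
      show "L * ?K * indicator ?B y \<ge> 0" by (intro mult_nonneg_nonneg L K) simp
      show "\<bar>f y * iter_pderiv is (mollifier \<epsilon>) (x - y)\<bar> \<le> L * ?K * indicator ?B y"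
      proof (cases "y \<in> ?B")
        case True
        have "\<bar>f y * iter_pderiv is (mollifier \<epsilon>) (x - y)\<bar> \<le> L * ?K"
          unfolding abs_mult by (intro mult_mono f C(2)[OF len e] L) auto
        then show ?thesis using True by simp
      next
        case False
        then have "iter_pderiv is (mollifier \<epsilon>) (x - y) = 0"
          by (intro iter_pderiv_mollifier_eq_0[OF e]) (simp add: dist_norm)
        then show ?thesis using False by simp
      qed
    qed
    also have "\<dots> = L * ?K * (c * \<epsilon> ^ CARD('n))"
      using e content_cball[of "real CARD('n) * \<epsilon>" x] by (simp add: c_def power_mult_distrib)
    also have "\<dots> = C * c * L / \<epsilon> ^ length is"
      using e by (simp add: power_add field_simps)
    finally show "\<bar>conv lborel (\<lambda>y. y) f (iter_pderiv is (mollifier \<epsilon>)) x\<bar> \<le> C * c * L / \<epsilon> ^ length is" .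
  qed
qed

text \<open>The weak derivative is tested with \<open>y \<mapsto> \<phi> (x - y)\<close>; the sign
  from this reflection cancels the one from integration by parts.\<close>

lemma iter_pderiv_conv_weak_deriv:
  fixes v f :: "real^'n \<Rightarrow> real"
  assumes v: "integrable lborel v" and f: "integrable lborel f" and w: "weak_deriv UNIV [j] v f" and \<phi>: "test_fun S \<phi>"
  shows "pderiv_dir j (conv lborel (\<lambda>y. y) v \<phi>) = conv lborel (\<lambda>y. y) f \<phi>"
proof
  fix x
  have \<phi>': "test_fun UNIV (\<lambda>y. \<phi> (x + (-1) *\<^sub>R y))"
    by (rule test_fun_affine[OF \<phi>]) simp
  have vm [measurable]: "v \<in> borel_measurable borel" "f \<in> borel_measurable borel" using v f by auto
  have [measurable]: "\<phi> \<in> borel_measurable borel" "pderiv_dir j \<phi> \<in> borel_measurable borel"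
    using smooth_fun_borel smooth_fun_pderiv_dir test_fun_smooth[OF \<phi>] by blast+
  have "(\<integral>y. v y * iter_pderiv [j] (\<lambda>y. \<phi> (x + (-1) *\<^sub>R y)) y \<partial>lebesgue) = (-1) * (\<integral>y. f y * \<phi> (x + (-1) *\<^sub>R y) \<partial>lebesgue)"
    using w \<phi>' unfolding weak_deriv_def by (simp add: set_lebesgue_integral_def)
  then have "(\<integral>y. v y * pderiv_dir j \<phi> (x - y) \<partial>lebesgue) = (\<integral>y. f y * \<phi> (x - y) \<partial>lebesgue)"
    unfolding iter_pderiv_affine[OF test_fun_smooth[OF \<phi>]] by simp
  then have "conv lborel (\<lambda>y. y) v (pderiv_dir j \<phi>) x = conv lborel (\<lambda>y. y) f \<phi> x"
    unfolding conv_def by (simp add: integral_completion)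
  then show "pderiv_dir j (conv lborel (\<lambda>y. y) v \<phi>) x = conv lborel (\<lambda>y. y) f \<phi> x"
    using iter_pderiv_conv[OF v _ \<phi>, of "\<lambda>y. y" "[j]"] by simp
qed

text \<open>Mean zero is what lets the second derivatives of the mollified function be written
  through increments of its gradient.\<close>

lemma integral_pderiv_mollifier:
  assumes "\<epsilon> > 0"
  shows "(\<integral>y. pderiv_dir k (mollifier \<epsilon>) (y :: real^'n) \<partial>lborel) = 0"
proof -
  have t: "test_fun UNIV (mollifier \<epsilon> :: real^'n \<Rightarrow> real)" by (rule test_fun_mollifier[OF assms])
  obtain C where "smooth_fun (mollifier \<epsilon> :: real^'n \<Rightarrow> real)" "compact C" "\<And>is (x :: real^'n). x \<notin> C \<Longrightarrow> iter_pderiv is (mollifier \<epsilon>) x = 0"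
    using test_funE[OF t] by metis
  from this(1,2) this(3)[of _ "[]"] show ?thesis
    by (intro integral_pderiv_dir_eq_0[of _ _ C] smooth_fun_differentiable smooth_fun_continuous smooth_fun_pderiv_dir) auto
qed

text \<open>Compared with \<open>gagliardo_pow\<close>, a single scalar function and
  \<open>lborel\<close> replace the tensor and Lebesgue measure, so that Borel measurability in both
  variables is at hand.\<close>

definition gagliardo_integral :: "real \<Rightarrow> real \<Rightarrow> (real^'n \<Rightarrow> real) \<Rightarrow> ennreal" where
  "gagliardo_integral s p f =
     (\<integral>\<^sup>+x. (\<integral>\<^sup>+y. ennreal (\<bar>f x - f y\<bar> powr p / norm (x - y) powr (real CARD('n) + s * p)) \<partial>lborel) \<partial>lborel)"

text \<open>Jensen on the ball of radius \<delta> moves the power inside. There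
  \<open>\<delta> / norm (x - y)\<close> is at least 1, so its power \<open>CARD('n) + s * p\<close>
  may be inserted as a factor, which produces the Gagliardo integrand.\<close>

lemma gagliardo_kernel_estimate:
  fixes f k :: "real^'n \<Rightarrow> real"
  assumes f [measurable]: "f \<in> borel_measurable borel" and k [measurable]: "k \<in> borel_measurable borel"
    and kK: "\<And>z. \<bar>k z\<bar> \<le> K" and k0: "\<And>z. norm z > \<delta> \<Longrightarrow> k z = 0"
    and pos: "p \<ge> 1" "s > 0" "\<delta> > 0"
  shows "(\<integral>\<^sup>+x. ennreal (\<bar>\<integral>y. k (x - y) * (f y - f x) \<partial>lborel\<bar> powr p) \<partial>lborel)
    \<le> ennreal ((unit_ball_vol (real CARD('n)) * \<delta> ^ CARD('n)) powr (p - 1) * (K powr p * \<delta> powr (real CARD('n) + s * p)))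
        * gagliardo_integral s p f"
proof -
  let ?m = "unit_ball_vol (real CARD('n)) * \<delta> ^ CARD('n)"
  let ?q = "real CARD('n) + s * p"
  have K: "K \<ge> 0" using kK[of 0] by linarith
  have q: "?q > 0" using pos by (simp add: add_pos_pos)
  have pt: "ennreal (\<bar>\<integral>y. k (x - y) * (f y - f x) \<partial>lborel\<bar> powr p)
      \<le> ennreal (?m powr (p - 1) * (K powr p * \<delta> powr ?q)) * (\<integral>\<^sup>+y. ennreal (\<bar>f x - f y\<bar> powr p / norm (x - y) powr ?q) \<partial>lborel)" for x
  proof -
    let ?B = "cball x \<delta>"
    let ?M = "restrict_space lborel ?B"
    have fin: "finite_measure ?M"
      using emeasure_lborel_cball_finite[of x \<delta>]
      by (intro finite_measureI) (simp add: emeasure_restrict_space space_restrict_space)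
    interpret finite_measure ?M by fact
    have m: "measure ?M (space ?M) = ?m"
      using pos content_cball[of \<delta> x] by (simp add: space_restrict_space measure_restrict_space)
    have "(\<integral>y. k (x - y) * (f y - f x) \<partial>lborel) = (\<integral>y. indicator ?B y *\<^sub>R (k (x - y) * (f y - f x)) \<partial>lborel)"
      using k0 by (intro Bochner_Integration.integral_cong) (auto simp: indicator_def dist_norm)
    also have "\<dots> = (\<integral>y. k (x - y) * (f y - f x) \<partial>?M)"
      by (subst integral_restrict_space) auto
    finally have "ennreal (\<bar>\<integral>y. k (x - y) * (f y - f x) \<partial>lborel\<bar> powr p) = ennreal (\<bar>\<integral>y. k (x - y) * (f y - f x) \<partial>?M\<bar> powr p)"
      by simp
    also have "\<dots> \<le> ennreal (?m powr (p - 1)) * (\<integral>\<^sup>+y. ennreal (\<bar>k (x - y) * (f y - f x)\<bar> powr p) \<partial>?M)"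
      unfolding m[symmetric] using pos by (intro powr_integral_le measurable_restrict_space1) auto
    also have "(\<integral>\<^sup>+y. ennreal (\<bar>k (x - y) * (f y - f x)\<bar> powr p) \<partial>?M)
        \<le> (\<integral>\<^sup>+y. ennreal (K powr p * \<delta> powr ?q) * ennreal (\<bar>f x - f y\<bar> powr p / norm (x - y) powr ?q) \<partial>lborel)"
    proof (subst nn_integral_restrict_space, simp, rule nn_integral_mono)
      fix y
      show "ennreal (\<bar>k (x - y) * (f y - f x)\<bar> powr p) * indicator ?B y
          \<le> ennreal (K powr p * \<delta> powr ?q) * ennreal (\<bar>f x - f y\<bar> powr p / norm (x - y) powr ?q)"
      \<comment> \<open>The diagonal is separated because the quotient is by a norm equal to 0
        there; the left side vanishes as the increment does.\<close>
      proof (cases "y \<in> ?B \<and> y \<noteq> x")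
        case True
        then have d: "0 < norm (x - y)" "norm (x - y) \<le> \<delta>" by (auto simp: dist_norm)
        have "\<bar>k (x - y) * (f y - f x)\<bar> powr p \<le> (K * \<bar>f x - f y\<bar>) powr p"
          using kK[of "x - y"] pos by (intro powr_mono2) (auto simp: abs_mult abs_minus_commute intro!: mult_right_mono)
        also have "\<dots> = K powr p * \<bar>f x - f y\<bar> powr p * 1" using K by (simp add: powr_mult)
        also have "\<dots> \<le> K powr p * \<bar>f x - f y\<bar> powr p * (\<delta> powr ?q / norm (x - y) powr ?q)"
          using d q by (intro mult_left_mono) (auto simp: le_divide_eq intro!: powr_mono2)
        also have "\<dots> = K powr p * \<delta> powr ?q * (\<bar>f x - f y\<bar> powr p / norm (x - y) powr ?q)" by simp
        finally have "ennreal (\<bar>k (x - y) * (f y - f x)\<bar> powr p) \<le> ennreal (K powr p * \<delta> powr ?q * (\<bar>f x - f y\<bar> powr p / norm (x - y) powr ?q))"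
          by (rule ennreal_leI)
        also have "\<dots> = ennreal (K powr p * \<delta> powr ?q) * ennreal (\<bar>f x - f y\<bar> powr p / norm (x - y) powr ?q)"
          by (rule ennreal_mult) auto
        finally show ?thesis using True by simp
      qed (auto simp: indicator_def)
    qed
    also have "\<dots> = ennreal (K powr p * \<delta> powr ?q) * (\<integral>\<^sup>+y. ennreal (\<bar>f x - f y\<bar> powr p / norm (x - y) powr ?q) \<partial>lborel)"
      by (rule nn_integral_cmult) measurable
    also have "ennreal (?m powr (p - 1)) * \<dots> = ennreal (?m powr (p - 1) * (K powr p * \<delta> powr ?q)) * (\<integral>\<^sup>+y. ennreal (\<bar>f x - f y\<bar> powr p / norm (x - y) powr ?q) \<partial>lborel)"
      by (subst ennreal_mult) (auto simp: mult.assoc)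
    finally show ?thesis by (simp add: mult_left_mono)
  qed
  have "(\<integral>\<^sup>+x. ennreal (\<bar>\<integral>y. k (x - y) * (f y - f x) \<partial>lborel\<bar> powr p) \<partial>lborel)
      \<le> (\<integral>\<^sup>+x. ennreal (?m powr (p - 1) * (K powr p * \<delta> powr ?q)) * (\<integral>\<^sup>+y. ennreal (\<bar>f x - f y\<bar> powr p / norm (x - y) powr ?q) \<partial>lborel) \<partial>lborel)"
    by (intro nn_integral_mono pt)
  also have "\<dots> = ennreal (?m powr (p - 1) * (K powr p * \<delta> powr ?q)) * gagliardo_integral s p f"
    unfolding gagliardo_integral_def by (rule nn_integral_cmult) measurable
  finally show ?thesis .
qed

text \<open>The kernel estimate is applied to the mollifier, of mean 1, and to \<epsilon> times its
  derivative, of mean 0. Both are of order \<open>\<epsilon>\<close> to the power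
  \<open>- CARD('n)\<close> and supported in a ball of radius \<open>CARD('n) * \<epsilon>\<close>,
  so both errors decay at the same rate.\<close>

lemma gagliardo_mollifier_estimate:
  assumes p: "p \<ge> 1" and s: "s > 0"
  obtains C where "C > 0"
    "\<And>f \<epsilon>. integrable lborel f \<Longrightarrow> \<epsilon> > 0 \<Longrightarrow>
       (\<integral>\<^sup>+x. ennreal (\<bar>conv lborel (\<lambda>y. y) f (mollifier \<epsilon>) x - f x\<bar> powr p) \<partial>lborel)
         \<le> ennreal (C * \<epsilon> powr (s * p)) * gagliardo_integral s p (f :: real^'n \<Rightarrow> real)"
    "\<And>f \<epsilon> k. integrable lborel f \<Longrightarrow> \<epsilon> > 0 \<Longrightarrow>
       (\<integral>\<^sup>+x. ennreal ((\<epsilon> * \<bar>conv lborel (\<lambda>y. y) f (pderiv_dir k (mollifier \<epsilon>)) x\<bar>) powr p) \<partial>lborel)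
         \<le> ennreal (C * \<epsilon> powr (s * p)) * gagliardo_integral s p (f :: real^'n \<Rightarrow> real)"
proof -
  obtain c where c: "c > 0" "\<And>is \<epsilon> x. length is \<le> 1 \<Longrightarrow> \<epsilon> > 0 \<Longrightarrow>
      \<bar>iter_pderiv is (mollifier \<epsilon>) (x :: real^'n)\<bar> \<le> c / \<epsilon> ^ (CARD('n) + length is)"
    by (rule iter_pderiv_mollifier_bound_length) (rule that)
  let ?n = "real CARD('n)"
  define V where "V = unit_ball_vol ?n"
  have V: "V > 0" by (simp add: V_def)
  define C where "C = (V * ?n ^ CARD('n)) powr (p - 1) * (c powr p * ?n powr (?n + s * p))"
  have C: "C > 0" using V c by (simp add: C_def)
  \<comment> \<open>With n the dimension, the exponents of \<epsilon> are n(p - 1) from the volume,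
    -np from the kernel and n + sp from the weight; they add up to sp.\<close>
  have const: "(V * (?n * \<epsilon>) ^ CARD('n)) powr (p - 1) * ((c / \<epsilon> ^ CARD('n)) powr p * (?n * \<epsilon>) powr (?n + s * p)) = C * \<epsilon> powr (s * p)"
    if "\<epsilon> > 0" for \<epsilon>
  proof -
    have "(V * (?n * \<epsilon>) ^ CARD('n)) powr (p - 1) = (V * ?n ^ CARD('n)) powr (p - 1) * (\<epsilon> powr ?n) powr (p - 1)"
      using V that by (simp add: power_mult_distrib powr_mult powr_realpow)
    note 1 = this
    have 2: "(c / \<epsilon> ^ CARD('n)) powr p = c powr p / (\<epsilon> powr ?n) powr p"
      using c that by (simp add: powr_divide powr_realpow)
    have 3: "(?n * \<epsilon>) powr (?n + s * p) = ?n powr (?n + s * p) * \<epsilon> powr (?n + s * p)"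
      using that by (simp add: powr_mult)
    have 4: "(\<epsilon> powr ?n) powr (p - 1) * (\<epsilon> powr (?n + s * p) / (\<epsilon> powr ?n) powr p) = \<epsilon> powr (s * p)"
      by (simp add: powr_powr powr_add[symmetric] powr_diff[symmetric] algebra_simps)
    show ?thesis unfolding 1 2 3 4[symmetric] C_def by (simp add: mult_ac)
  qed
  show ?thesis
  proof (rule that[OF C])
    fix f :: "real^'n \<Rightarrow> real" and \<epsilon> :: real assume f: "integrable lborel f" and e: "\<epsilon> > 0"
    have [measurable]: "f \<in> borel_measurable borel" using f by auto
    note tm = test_fun_mollifier[OF e, where 'n='n]
    have m [measurable]: "(mollifier \<epsilon> :: real^'n \<Rightarrow> real) \<in> borel_measurable borel"
      and m' [measurable]: "\<And>k. (pderiv_dir k (mollifier \<epsilon>) :: real^'n \<Rightarrow> real) \<in> borel_measurable borel"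
      using smooth_fun_borel smooth_fun_pderiv_dir test_fun_smooth[OF tm] by blast+
    \<comment> \<open>Subtracting \<open>f x\<close> times the mean of the kernel leaves only
      increments: the left side is the mollification error for mean 1 and the convolution itself for
      mean 0.\<close>
    have diff: "conv lborel (\<lambda>y. y) f k x - f x * (\<integral>y. k y \<partial>lborel) = (\<integral>y. k (x - y) * (f y - f x) \<partial>lborel)"
      if k: "test_fun UNIV k" for k x
    proof -
      have km: "k \<in> borel_measurable borel" by (rule smooth_fun_borel[OF test_fun_smooth[OF k]])
      obtain K where K: "smooth_fun k" "compact K" "\<And>is x. x \<notin> K \<Longrightarrow> iter_pderiv is k x = 0"
        using test_funE[OF k] by metis
      have "integrable lborel k"
        using K(3)[of _ "[]"] by (intro integrable_compact_support[OF smooth_fun_continuous[OF K(1)] K(2)]) auto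
      then have i: "integrable lborel (\<lambda>y. k (x - y))" using integrable_lborel_affine[OF km, of "-1" x] by simp
      have "(\<integral>y. k y \<partial>lborel) = (\<integral>y. k (x - y) \<partial>lborel)" using integral_lborel_affine[OF km, of "-1" x] by simp
      then have "conv lborel (\<lambda>y. y) f k x - f x * (\<integral>y. k y \<partial>lborel) = (\<integral>y. f y * k (x - y) - f x * k (x - y) \<partial>lborel)"
        unfolding conv_def using i integrable_conv[OF f _ k, of "\<lambda>y. y" x] by simp
      then show ?thesis by (simp add: algebra_simps)
    qed
    have d1: "conv lborel (\<lambda>y. y) f (mollifier \<epsilon>) x - f x = (\<integral>y. mollifier \<epsilon> (x - y) * (f y - f x) \<partial>lborel)" for x
      using diff[OF tm] integral_mollifier[OF e, where 'n='n] by simp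
    have ne: "?n * \<epsilon> > 0" using e by simp
    show "(\<integral>\<^sup>+x. ennreal (\<bar>conv lborel (\<lambda>y. y) f (mollifier \<epsilon>) x - f x\<bar> powr p) \<partial>lborel)
         \<le> ennreal (C * \<epsilon> powr (s * p)) * gagliardo_integral s p f"
      unfolding d1 const[OF e, symmetric] V_def
      by (rule gagliardo_kernel_estimate) (use c(2)[of "[]"] mollifier_eq_0[OF e, where 'n='n] p s ne e in auto)
    fix k
    have d2: "\<epsilon> * \<bar>conv lborel (\<lambda>y. y) f (pderiv_dir k (mollifier \<epsilon>)) x\<bar> = \<bar>\<integral>y. \<epsilon> * pderiv_dir k (mollifier \<epsilon>) (x - y) * (f y - f x) \<partial>lborel\<bar>" for x
      using diff[OF test_fun_pderiv_dir[OF tm, of k]] integral_pderiv_mollifier[OF e, where 'n='n] e by (simp add: abs_mult mult.assoc)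
    have bd: "\<bar>\<epsilon> * pderiv_dir k (mollifier \<epsilon>) z\<bar> \<le> c / \<epsilon> ^ CARD('n)" for z :: "real^'n"
      using mult_left_mono[OF c(2)[of "[k]" \<epsilon> z], of \<epsilon>] e by (simp add: abs_mult)
    show "(\<integral>\<^sup>+x. ennreal ((\<epsilon> * \<bar>conv lborel (\<lambda>y. y) f (pderiv_dir k (mollifier \<epsilon>)) x\<bar>) powr p) \<partial>lborel)
         \<le> ennreal (C * \<epsilon> powr (s * p)) * gagliardo_integral s p f"
      unfolding d2 const[OF e, symmetric] V_def
    proof (rule gagliardo_kernel_estimate)
      show "\<epsilon> * pderiv_dir k (mollifier \<epsilon>) z = 0" if "norm z > ?n * \<epsilon>" for z :: "real^'n"
        using iter_pderiv_mollifier_eq_0[OF e that, of "[k]"] by simp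
    qed (use bd p s ne in auto)
  qed
qed

section \<open>Construction of the smooth competitor\<close>

lemma power2_le_powr:
  fixes a F p :: real
  assumes "0 \<le> a" "a \<le> F" "p \<le> 2"
  shows "a\<^sup>2 \<le> F powr (2 - p) * a powr p"
proof (cases "a = 0")
  case False
  with assms have "a > 0" by simp
  then have "a\<^sup>2 = a powr (2 - p) * a powr p" by (simp add: powr_add[symmetric])
  also have "\<dots> \<le> F powr (2 - p) * a powr p" using assms by (intro mult_right_mono powr_mono2) auto
  finally show ?thesis .
qed simp

text \<open>Common bookkeeping for the elastic and the surface term: \<open>g\<close> carries the
  Gagliardo bound, and \<open>S\<close> is the boundary layer, where only the measure is
  small.\<close>

lemma nn_integral_split_le:
  fixes h g :: "'a \<Rightarrow> real"
  assumes le: "\<And>x. x \<in> \<Omega> \<Longrightarrow> h x \<le> c1 * g x + c2 * indicator S x" and g0: "\<And>x. 0 \<le> g x" and c: "0 \<le> c1" "0 \<le> c2"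
    and g [measurable]: "g \<in> borel_measurable M" and S [measurable]: "S \<in> sets M"
    and G: "(\<integral>\<^sup>+x. ennreal (g x) \<partial>M) \<le> ennreal a" and m: "emeasure M S \<le> ennreal b" and ab: "0 \<le> a" "0 \<le> b"
  shows "(\<integral>\<^sup>+x. ennreal (h x) * indicator \<Omega> x \<partial>M) \<le> ennreal (c1 * a + c2 * b)"
proof -
  have "(\<integral>\<^sup>+x. ennreal (h x) * indicator \<Omega> x \<partial>M) \<le> (\<integral>\<^sup>+x. ennreal c1 * ennreal (g x) + ennreal c2 * indicator S x \<partial>M)"
  proof (rule nn_integral_mono)
    fix x
    have "ennreal (c1 * g x + c2 * indicator S x) = ennreal c1 * ennreal (g x) + ennreal c2 * indicator S x"
      using c g0[of x] by (subst ennreal_plus) (auto simp: ennreal_mult indicator_def)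
    then show "ennreal (h x) * indicator \<Omega> x \<le> ennreal c1 * ennreal (g x) + ennreal c2 * indicator S x"
      using ennreal_leI[OF le[of x]] by (auto simp: indicator_def)
  qed
  also have "\<dots> = ennreal c1 * (\<integral>\<^sup>+x. ennreal (g x) \<partial>M) + ennreal c2 * emeasure M S"
    by (simp add: nn_integral_add nn_integral_cmult)
  also have "\<dots> \<le> ennreal c1 * ennreal a + ennreal c2 * ennreal b"
    using G m by (intro add_mono mult_left_mono) auto
  also have "\<dots> = ennreal (c1 * a + c2 * b)"
    using c ab by (simp add: ennreal_mult)
  finally show ?thesis .
qed

text \<open>An open ball missing \<Omega> also misses its closure, so the mollifier centred at
  \<open>y\<close> sees only zeros of \<open>v\<close>.\<close>

lemma conv_mollifier_eq_0:
  fixes v :: "real^'n \<Rightarrow> real"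
  assumes "\<epsilon> > 0" and v [measurable]: "v \<in> borel_measurable borel" and v0: "AE x in lborel. x \<notin> closure \<Omega> \<longrightarrow> v x = 0"
    and y: "ball y (real CARD('n) * \<epsilon>) \<inter> \<Omega> = {}"
  shows "conv lborel (\<lambda>y. y) v (mollifier \<epsilon>) y = 0"
proof -
  have "ball y (real CARD('n) * \<epsilon>) \<inter> closure \<Omega> = {}"
    using y open_Int_closure_eq_empty[OF open_ball] by blast
  then have far: "z \<in> ball y (real CARD('n) * \<epsilon>) \<Longrightarrow> z \<notin> closure \<Omega>" for z by blast
  have "AE z in lborel. v z * mollifier \<epsilon> (y - z) = 0"
    using v0
  proof eventually_elim
    case (elim z)
    show ?case
    proof (cases "z \<in> ball y (real CARD('n) * \<epsilon>)")
      case True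
      then show ?thesis using elim far by simp
    next
      case False
      then show ?thesis using mollifier_eq_0[OF assms(1), of "y - z"] by (simp add: dist_norm)
    qed
  qed
  then show ?thesis unfolding conv_def by (rule integral_eq_zero_AE)
qed

text \<open>The segment from \<open>x\<close> to a nearest point outside \<Omega> must cross the
  frontier.\<close>

lemma boundary_layer_near_frontier:
  fixes \<Omega> :: "(real^'n) set"
  assumes "open \<Omega>" "\<Omega> \<noteq> UNIV" "x \<in> \<Omega>" "infdist x (- \<Omega>) < d"
  obtains z where "z \<in> frontier \<Omega>" "norm (x - z) < d"
proof -
  obtain y where y: "y \<in> - \<Omega>" "infdist x (- \<Omega>) = dist x y"
    using assms infdist_attains_inf[of "- \<Omega>" x] by auto
  have "closed_segment x y \<inter> frontier \<Omega> \<noteq> {}"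
    using assms y by (intro connected_Int_frontier) auto
  then obtain z where z: "z \<in> closed_segment x y" "z \<in> frontier \<Omega>" by blast
  have "norm (x - z) \<le> norm (x - y)"
    using segment_bound[OF z(1)] by (simp add: norm_minus_commute)
  then show ?thesis using that[OF z(2)] y assms by (simp add: dist_norm)
qed

text \<open>The competitor is \<open>\<eta> \<cdot> v\<^sub>\<epsilon>\<close>, with \<open>v\<^sub>\<epsilon>\<close> the mollification of \<open>v\<close> and \<open>\<eta>\<close> a cutoff equal to 1 outside
  a boundary layer of width of order \<open>\<epsilon>\<close>. The layer has measure \<open>O(\<epsilon>)\<close>, and on it \<open>v\<^sub>\<epsilon> = O(\<epsilon>)\<close> since
  \<open>v\<^sub>\<epsilon>\<close> is Lipschitz and vanishes at points outside \<open>\<Omega>\<close> at distance of order \<open>\<epsilon>\<close> from the boundary.\<close>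

lemma smooth_competitor:
  fixes v :: "real^'n \<Rightarrow> real" and f :: "'n \<Rightarrow> real^'n \<Rightarrow> real" and \<Omega> :: "(real^'n) set"
  assumes \<Omega>: "C11_domain \<Omega>" "bounded \<Omega>" and p: "1 \<le> p" "p \<le> 2" and s: "s > 0"
    and v: "integrable lborel v" and v0: "AE x in lborel. x \<notin> closure \<Omega> \<longrightarrow> v x = 0"
    and f: "\<And>j. integrable lborel (f j)" and fL: "\<And>j x. \<bar>f j x\<bar> \<le> L"
    and w: "\<And>j. weak_deriv UNIV [j] v (f j)" and gag: "\<And>j. gagliardo_integral s p (f j) < \<infinity>"
  obtains C e0 where "C > 0" "e0 > 0"
    "\<And>\<epsilon>. 0 < \<epsilon> \<Longrightarrow> \<epsilon> < e0 \<Longrightarrow> \<exists>w. test_fun \<Omega> w \<and>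
       (\<forall>j. (\<integral>\<^sup>+x. ennreal ((pderiv_dir j w x - f j x)\<^sup>2) * indicator \<Omega> x \<partial>lborel) \<le> ennreal (C * \<epsilon> powr min (s * p) 1)) \<and>
       (\<forall>j k. (\<integral>\<^sup>+x. ennreal ((\<epsilon> * \<bar>pderiv_dir k (pderiv_dir j w) x\<bar>) powr p) * indicator \<Omega> x \<partial>lborel)
          \<le> ennreal (C * \<epsilon> powr min (s * p) 1))"
proof -
  obtain Cg where Cg: "Cg > 0"
    "\<And>g \<epsilon>. integrable lborel g \<Longrightarrow> \<epsilon> > 0 \<Longrightarrow>
       (\<integral>\<^sup>+x. ennreal (\<bar>conv lborel (\<lambda>y. y) g (mollifier \<epsilon>) x - g x\<bar> powr p) \<partial>lborel)
         \<le> ennreal (Cg * \<epsilon> powr (s * p)) * gagliardo_integral s p (g :: real^'n \<Rightarrow> real)"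
    "\<And>g \<epsilon> k. integrable lborel g \<Longrightarrow> \<epsilon> > 0 \<Longrightarrow>
       (\<integral>\<^sup>+x. ennreal ((\<epsilon> * \<bar>conv lborel (\<lambda>y. y) g (pderiv_dir k (mollifier \<epsilon>)) x\<bar>) powr p) \<partial>lborel)
         \<le> ennreal (Cg * \<epsilon> powr (s * p)) * gagliardo_integral s p (g :: real^'n \<Rightarrow> real)"
    by (rule gagliardo_mollifier_estimate[OF p(1) s]) (rule that)
  obtain Cm where Cm: "Cm > 0"
    "\<And>is \<epsilon> L g x. length is \<le> 2 \<Longrightarrow> \<epsilon> > 0 \<Longrightarrow> (\<And>y. \<bar>g y\<bar> \<le> L) \<Longrightarrow>
       \<bar>conv lborel (\<lambda>y. y) g (iter_pderiv is (mollifier \<epsilon>)) (x :: real^'n)\<bar> \<le> Cm * L / \<epsilon> ^ length is"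
    by (rule conv_mollifier_bound[of 2, where 'n='n]) (rule that, assumption, blast)
  obtain Cb e1 where Cb: "Cb > 0" "e1 > 0"
    "\<And>e z. 0 < e \<Longrightarrow> e < e1 \<Longrightarrow> z \<in> frontier \<Omega> \<Longrightarrow> \<exists>y. norm (z - y) \<le> Cb * e \<and> ball y e \<inter> \<Omega> = {}"
    "\<And>e. 0 < e \<Longrightarrow> e < e1 \<Longrightarrow> \<exists>S\<in>sets borel. {x. \<exists>z\<in>frontier \<Omega>. norm (x - z) < e} \<subseteq> S \<and> emeasure lborel S \<le> ennreal (Cb * e)"
    by (rule regular_boundary[OF \<Omega>]) (rule that)
  define N where "N = real CARD('n)"
  have N: "N \<ge> 1" unfolding N_def by (simp add: Suc_leI)
  have op: "open \<Omega>" using \<Omega> by (simp add: C11_domain_def)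
  have not_UNIV: "\<Omega> \<noteq> UNIV" using \<Omega>(2) not_bounded_UNIV by blast
  have L: "L \<ge> 0" using fL[of undefined 0] by linarith
  have [measurable]: "v \<in> borel_measurable borel" "f j \<in> borel_measurable borel" for j
    using v f by auto
  define A where "A = (\<Sum>j\<in>UNIV. enn2real (gagliardo_integral s p (f j)))"
  have A0: "A \<ge> 0" unfolding A_def by (intro sum_nonneg) simp
  have gagA: "gagliardo_integral s p (f j) \<le> ennreal A" for j
  proof -
    have "enn2real (gagliardo_integral s p (f j)) \<le> A"
      unfolding A_def by (rule member_le_sum) auto
    then have "ennreal (enn2real (gagliardo_integral s p (f j))) \<le> ennreal A" by (rule ennreal_leI)
    then show ?thesis using gag[of j] by simp
  qed
  define B where "B = Cm * L"
  \<comment> \<open>\<open>N * B\<close> is a Lipschitz constant of the mollified function. A zero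
    outside \<Omega> is reached from the layer by going at most \<open>5 * N * \<epsilon>\<close> to
    the frontier and then \<open>Cb * (5 * N * \<epsilon>)\<close> to the centre of an exterior
    ball.\<close>
  define D0 where "D0 = N * B * (5 * N + Cb * (5 * N))"
  \<comment> \<open>\<open>E1\<close> and \<open>E2\<close> bound, in the layer, first derivatives
    and \<epsilon> times second derivatives of the cut-off function: one summand for each term of
    the product rule, with the two mixed terms of equal size.\<close>
  define E1 where "E1 = B + Cm * D0"
  define E2 where "E2 = B + 2 * (Cm * B) + Cm * D0"
  \<comment> \<open>The factor from \<open>power2_le_powr\<close>: \<open>B + L\<close> bounds the
    difference between the mollified and the original derivative.\<close>
  define C0 where "C0 = (B + L) powr (2 - p)"
  have nonneg: "B \<ge> 0" "D0 \<ge> 0" "E1 \<ge> 0" "E2 \<ge> 0" "C0 \<ge> 0"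
  proof -
    show B: "B \<ge> 0" using Cm L by (simp add: B_def)
    show D0: "D0 \<ge> 0" unfolding D0_def using B N Cb by (intro mult_nonneg_nonneg add_nonneg_nonneg) auto
    show "E1 \<ge> 0" "E2 \<ge> 0" "C0 \<ge> 0" unfolding E1_def E2_def C0_def using B D0 Cm by auto
  qed
  define C where "C = (C0 + 1) * (Cg * A) + ((E1 + L)\<^sup>2 + E2 powr p) * (Cb * (5 * N)) + 1"
  \<comment> \<open>Makes \<open>5 * N * \<epsilon>\<close> admissible for the boundary estimates
    and ensures \<open>\<epsilon> \<le> 1\<close>, so that smaller exponents give larger
    powers.\<close>
  define e0 where "e0 = min (e1 / (5 * N)) 1"
  show ?thesis
  proof (rule that[of C e0])
    show "C > 0" unfolding C_def using nonneg Cg A0 Cb N by (intro add_nonneg_pos add_nonneg_nonneg mult_nonneg_nonneg) auto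
    show "e0 > 0" using Cb N by (simp add: e0_def)
    fix \<epsilon> :: real assume \<epsilon>: "0 < \<epsilon>" "\<epsilon> < e0"
    have e5: "0 < 5 * N * \<epsilon>" "5 * N * \<epsilon> < e1" "\<epsilon> \<le> 1"
      using \<epsilon> N by (auto simp: e0_def pos_less_divide_eq mult.commute)
    obtain S where S [measurable]: "S \<in> sets borel" and S_sub: "{x. \<exists>z\<in>frontier \<Omega>. norm (x - z) < 5 * N * \<epsilon>} \<subseteq> S"
      and S_meas: "emeasure lborel S \<le> ennreal (Cb * (5 * N * \<epsilon>))"
      using Cb(4)[OF e5(1,2)] by blast
    define dist' where "dist' x = infdist x (- \<Omega>)" for x
    \<comment> \<open>Mollifying an indicator blurs it by \<open>N * \<epsilon>\<close>. With
      threshold 3 the cutoff is 1 at depth beyond \<open>4 * N * \<epsilon>\<close>, while the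
      margin \<open>2 * N * \<epsilon>\<close> of \<open>test_fun_cutoff\<close> stays inside
      \<Omega>. The factor 5 for the frontier estimates makes the distance bound strict.\<close>
    define A' where "A' = {x \<in> \<Omega>. dist' x > 3 * N * \<epsilon>}"
    have dist'_cont: "continuous_on UNIV dist'" unfolding dist'_def by (intro continuous_intros)
    have [measurable]: "dist' \<in> borel_measurable borel" by (rule borel_measurable_continuous_onI[OF dist'_cont])
    have "\<Omega> \<in> sets borel" using op by simp
    then have A'_sets: "A' \<in> sets borel" unfolding A'_def by measurable
    have A'_bdd: "bounded A'" using \<Omega>(2) by (rule bounded_subset) (auto simp: A'_def)
    have dist'_lip: "dist' x \<le> dist' y + norm (x - y)" for x y
      unfolding dist'_def using infdist_triangle[of x "- \<Omega>" y] by (simp add: dist_norm)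
    have dist'_mem: "x \<in> \<Omega>" if "dist' x > 0" for x
      using that unfolding dist'_def by (metis ComplI infdist_zero less_irrefl)
    define \<eta> where "\<eta> = cutoff \<epsilon> A'"
    note cut = \<epsilon>(1) A'_sets A'_bdd
    note mol = test_fun_mollifier[OF \<epsilon>(1), where 'n='n]
    note intA = integrable_indicator_bounded[OF cut]
    have \<eta>_test: "test_fun \<Omega> \<eta>"
      unfolding \<eta>_def
    proof (rule test_fun_cutoff[OF cut])
      fix x y assume xy: "x \<in> A'" "norm (x - y) \<le> 2 * real CARD('n) * \<epsilon>"
      have "dist' y > 0" using xy dist'_lip[of x y] \<epsilon>(1) N unfolding A'_def N_def
        by (smt (verit) mem_Collect_eq mult_right_mono mult_less_cancel_right_disj)
      then show "y \<in> \<Omega>" by (rule dist'_mem)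
    qed
    have \<eta>_smooth: "smooth_fun \<eta>" using \<eta>_test by (rule test_fun_smooth)
    have \<eta>1: "\<eta> x = 1" if "dist' x > 4 * N * \<epsilon>" for x
      unfolding \<eta>_def
    proof (rule cutoff_eq_1[OF cut], rule subsetI)
      fix y assume "y \<in> cball x (real CARD('n) * \<epsilon>)"
      then have "norm (x - y) \<le> N * \<epsilon>" by (simp add: dist_norm N_def)
      then have d: "dist' y > 3 * N * \<epsilon>" using that dist'_lip[of x y] by simp
      have "3 * N * \<epsilon> > 0" using N \<epsilon>(1) by simp
      then have "y \<in> \<Omega>" using d by (intro dist'_mem) linarith
      then show "y \<in> A'" using d by (simp add: A'_def)
    qed
    have \<eta>_iter: "iter_pderiv is \<eta> = conv lborel (\<lambda>y. y) (indicator A') (iter_pderiv is (mollifier \<epsilon>))" for "is"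
      unfolding \<eta>_def cutoff_def by (rule iter_pderiv_conv[OF intA _ mol]) simp
    have \<eta>_bound: "\<bar>iter_pderiv is \<eta> x\<bar> \<le> Cm / \<epsilon> ^ length is" if "length is \<le> 2" for "is" x
      unfolding \<eta>_iter using Cm(2)[OF that \<epsilon>(1), of "indicator A'" 1 x] by (simp add: indicator_def)
    define ve where "ve = conv lborel (\<lambda>y. y) v (mollifier \<epsilon>)"
    have ve_smooth: "smooth_fun ve" unfolding ve_def by (rule smooth_fun_conv[OF v _ mol]) simp
    have ve': "pderiv_dir j ve = conv lborel (\<lambda>y. y) (f j) (mollifier \<epsilon>)" for j
      unfolding ve_def by (rule iter_pderiv_conv_weak_deriv[OF v f w mol])
    have ve'': "pderiv_dir k (pderiv_dir j ve) = conv lborel (\<lambda>y. y) (f j) (pderiv_dir k (mollifier \<epsilon>))" for j k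
      unfolding ve' using iter_pderiv_conv[OF f _ mol, of "\<lambda>y. y" "[k]"] by simp
    have ve'_bound: "\<bar>pderiv_dir j ve x\<bar> \<le> B" for j x
      unfolding ve' B_def using Cm(2)[of "[]" \<epsilon> "f j" L x, OF _ \<epsilon>(1) fL] by simp
    have ve''_bound: "\<bar>pderiv_dir k (pderiv_dir j ve) x\<bar> \<le> B / \<epsilon>" for j k x
      unfolding ve'' B_def using Cm(2)[of "[k]" \<epsilon> "f j" L x, OF _ \<epsilon>(1) fL] by simp
    have ve_layer: "\<bar>ve x\<bar> \<le> D0 * \<epsilon>" "x \<in> S" if x: "x \<in> \<Omega>" "dist' x \<le> 4 * N * \<epsilon>" for x
    proof -
      have "infdist x (- \<Omega>) < 5 * N * \<epsilon>" using x e5(1) unfolding dist'_def by linarith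
      then obtain z where z: "z \<in> frontier \<Omega>" "norm (x - z) < 5 * N * \<epsilon>"
        by (rule boundary_layer_near_frontier[OF op not_UNIV x(1)]) (rule that)
      then show "x \<in> S" using S_sub by blast
      obtain y where y: "norm (z - y) \<le> Cb * (5 * N * \<epsilon>)" "ball y (5 * N * \<epsilon>) \<inter> \<Omega> = {}"
        using Cb(3)[OF e5(1,2) z(1)] by blast
      have "ball y (real CARD('n) * \<epsilon>) \<subseteq> ball y (5 * N * \<epsilon>)"
        using N \<epsilon>(1) by (intro subset_ball) (simp add: N_def)
      then have "ball y (real CARD('n) * \<epsilon>) \<inter> \<Omega> = {}" using y(2) by blast
      then have "ve y = 0"
        unfolding ve_def by (intro conv_mollifier_eq_0[OF \<epsilon>(1) _ v0]) auto
      moreover have "\<bar>ve x - ve y\<bar> \<le> N * B * norm (x - y)"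
        unfolding N_def using smooth_fun_differentiable[OF ve_smooth] ve'_bound by (rule lipschitz_of_pderiv_bound)
      moreover have "norm (x - y) \<le> (5 * N + Cb * (5 * N)) * \<epsilon>"
      proof -
        have "norm (x - y) \<le> norm (x - z) + norm (z - y)" by (rule norm_diff_triangle_le[OF order_refl order_refl])
        then show ?thesis using z(2) y(1) by (simp add: algebra_simps)
      qed
      then have "N * B * norm (x - y) \<le> N * B * ((5 * N + Cb * (5 * N)) * \<epsilon>)"
        using N nonneg by (intro mult_left_mono) auto
      ultimately show "\<bar>ve x\<bar> \<le> D0 * \<epsilon>" by (simp add: D0_def mult.assoc)
    qed
    define w where "w x = ve x * \<eta> x" for x
    have w_test: "test_fun \<Omega> w" unfolding w_def by (rule test_fun_mult[OF ve_smooth \<eta>_test])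
    note d = smooth_fun_differentiable
    note vs = ve_smooth smooth_fun_pderiv_dir[OF ve_smooth]
    note \<eta>s = \<eta>_smooth smooth_fun_pderiv_dir[OF \<eta>_smooth]
    have w': "pderiv_dir j w = (\<lambda>x. ve x * pderiv_dir j \<eta> x + pderiv_dir j ve x * \<eta> x)" for j
      unfolding w_def by (rule ext) (rule pderiv_dir_mult[OF d[OF vs(1)] d[OF \<eta>s(1)]])
    have w'': "pderiv_dir k (pderiv_dir j w) x =
        (ve x * pderiv_dir k (pderiv_dir j \<eta>) x + pderiv_dir k ve x * pderiv_dir j \<eta> x)
        + (pderiv_dir j ve x * pderiv_dir k \<eta> x + pderiv_dir k (pderiv_dir j ve) x * \<eta> x)" for j k x
      unfolding w'
      by (subst pderiv_dir_add) (auto simp: pderiv_dir_mult d[OF vs(1)] d[OF vs(2)] d[OF \<eta>s(1)] d[OF \<eta>s(2)]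
          intro!: d smooth_fun_mult vs \<eta>s)
    have far_eq: "iter_pderiv is w x = iter_pderiv is ve x" if "dist' x > 4 * N * \<epsilon>" for "is" x
    proof (rule iter_pderiv_cong)
      show "open {x. dist' x > 4 * N * \<epsilon>}" using dist'_cont by (intro open_Collect_less continuous_on_const)
    qed (use that \<eta>1 in \<open>auto simp: w_def\<close>)
    have \<eta>01: "\<bar>\<eta> x\<bar> \<le> 1" for x using cutoff_bounds[OF cut] unfolding \<eta>_def by (simp add: abs_le_iff)
    have \<eta>'b: "\<bar>pderiv_dir j \<eta> x\<bar> \<le> Cm / \<epsilon>" for j x using \<eta>_bound[of "[j]"] by simp
    have \<eta>''b: "\<bar>pderiv_dir k (pderiv_dir j \<eta>) x\<bar> \<le> Cm / \<epsilon>\<^sup>2" for j k x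
      using \<eta>_bound[of "[k, j]"] by (simp add: power2_eq_square)
    have w'_layer: "\<bar>pderiv_dir j w x\<bar> \<le> E1" if x: "x \<in> \<Omega>" "dist' x \<le> 4 * N * \<epsilon>" for x j
    proof -
      \<comment> \<open>The decisive cancellation: the bound \<open>D0 * \<epsilon>\<close> on
        \<open>ve\<close> absorbs the factor \<open>1 / \<epsilon>\<close> from the gradient of the
        cutoff.\<close>
      have "\<bar>ve x * pderiv_dir j \<eta> x\<bar> \<le> D0 * \<epsilon> * (Cm / \<epsilon>)"
        unfolding abs_mult using ve_layer(1)[OF x] \<eta>'b nonneg \<epsilon>(1) by (intro mult_mono) auto
      also have "\<dots> = Cm * D0" using \<epsilon>(1) by simp
      finally have 1: "\<bar>ve x * pderiv_dir j \<eta> x\<bar> \<le> Cm * D0" .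
      have "\<bar>pderiv_dir j ve x * \<eta> x\<bar> \<le> B * 1"
        unfolding abs_mult using ve'_bound \<eta>01 nonneg by (intro mult_mono) auto
      with 1 show ?thesis unfolding w' E1_def by linarith
    qed
    have w''_layer: "\<epsilon> * \<bar>pderiv_dir k (pderiv_dir j w) x\<bar> \<le> E2" if x: "x \<in> \<Omega>" "dist' x \<le> 4 * N * \<epsilon>" for x j k
    proof -
      \<comment> \<open>The same cancellation one order higher leaves one factor
        \<open>1 / \<epsilon>\<close>, which the weight \<epsilon> of the second derivatives
        removes.\<close>
      have "\<bar>ve x * pderiv_dir k (pderiv_dir j \<eta>) x\<bar> \<le> D0 * \<epsilon> * (Cm / \<epsilon>\<^sup>2)"
        unfolding abs_mult using ve_layer(1)[OF x] \<eta>''b nonneg \<epsilon>(1) by (intro mult_mono) auto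
      also have "\<dots> = Cm * D0 / \<epsilon>" using \<epsilon>(1) by (simp add: power2_eq_square)
      finally have 1: "\<bar>ve x * pderiv_dir k (pderiv_dir j \<eta>) x\<bar> \<le> Cm * D0 / \<epsilon>" .
      have 2: "\<bar>pderiv_dir i ve x * pderiv_dir j \<eta> x\<bar> \<le> B * (Cm / \<epsilon>)" for i j
        unfolding abs_mult using ve'_bound \<eta>'b nonneg by (intro mult_mono) auto
      have 3: "\<bar>pderiv_dir k (pderiv_dir j ve) x * \<eta> x\<bar> \<le> B / \<epsilon> * 1"
        unfolding abs_mult using ve''_bound \<eta>01 nonneg \<epsilon>(1) by (intro mult_mono) auto
      have "\<bar>pderiv_dir k (pderiv_dir j w) x\<bar> \<le> Cm * D0 / \<epsilon> + B * (Cm / \<epsilon>) + (B * (Cm / \<epsilon>) + B / \<epsilon>)"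
        unfolding w'' using 1 2[of k j] 2[of j k] 3 by linarith
      also have "\<dots> = E2 / \<epsilon>" by (simp add: E2_def add_divide_distrib)
      finally show ?thesis using \<epsilon>(1) by (simp add: pos_le_divide_eq mult.commute)
    qed
    \<comment> \<open>For \<open>\<epsilon> \<le> 1\<close> the interior rate and the layer rate are
      both dominated by the power with the smaller exponent.\<close>
    have powr_le: "\<epsilon> powr (s * p) \<le> \<epsilon> powr min (s * p) 1" "\<epsilon> \<le> \<epsilon> powr min (s * p) 1"
      using \<epsilon>(1) e5(3) powr_mono'[of "min (s * p) 1" "s * p" \<epsilon>] powr_mono'[of "min (s * p) 1" 1 \<epsilon>] by auto
    have G_bound: "ennreal (Cg * \<epsilon> powr (s * p)) * gagliardo_integral s p (f j) \<le> ennreal (Cg * A * \<epsilon> powr (s * p))" for j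
    proof -
      have "ennreal (Cg * \<epsilon> powr (s * p)) * gagliardo_integral s p (f j) \<le> ennreal (Cg * \<epsilon> powr (s * p)) * ennreal A"
        by (intro mult_left_mono gagA) simp
      also have "\<dots> = ennreal (Cg * A * \<epsilon> powr (s * p))"
        using Cg A0 by (simp add: ennreal_mult[symmetric] mult_ac)
      finally show ?thesis .
    qed
    have total: "c1 * (Cg * A * \<epsilon> powr (s * p)) + c2 * (Cb * (5 * N * \<epsilon>)) \<le> C * \<epsilon> powr min (s * p) 1"
      if c: "0 \<le> c1" "c1 \<le> C0 + 1" "0 \<le> c2" "c2 \<le> (E1 + L)\<^sup>2 + E2 powr p" for c1 c2
    proof -
      have "c1 * (Cg * A * \<epsilon> powr (s * p)) \<le> (C0 + 1) * (Cg * A * \<epsilon> powr min (s * p) 1)"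
        using c Cg A0 powr_le by (intro mult_mono mult_left_mono) auto
      moreover have "c2 * (Cb * (5 * N * \<epsilon>)) \<le> ((E1 + L)\<^sup>2 + E2 powr p) * (Cb * (5 * N * \<epsilon> powr min (s * p) 1))"
        using c Cb N powr_le \<epsilon>(1) by (intro mult_mono mult_left_mono) auto
      moreover have "C * q = (C0 + 1) * (Cg * A * q) + ((E1 + L)\<^sup>2 + E2 powr p) * (Cb * (5 * N * q)) + q" for q
        unfolding C_def by (simp add: algebra_simps)
      moreover have "0 \<le> \<epsilon> powr min (s * p) 1" by simp
      ultimately show ?thesis by (simp only:)
    qed
    have CgA: "0 \<le> Cg * A * \<epsilon> powr (s * p)" "0 \<le> Cb * (5 * N * \<epsilon>)"
      using Cg A0 Cb N \<epsilon>(1) by auto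
    have cm [measurable]: "conv lborel (\<lambda>y. y) (f j) (mollifier \<epsilon>) \<in> borel_measurable borel"
      "conv lborel (\<lambda>y. y) (f j) (pderiv_dir k (mollifier \<epsilon>)) \<in> borel_measurable borel" for j k
      using smooth_fun_borel[OF smooth_fun_conv[OF f _ mol]] smooth_fun_borel[OF smooth_fun_conv[OF f _ test_fun_pderiv_dir[OF mol]]]
      by auto
    have S1: "(\<integral>\<^sup>+x. ennreal ((pderiv_dir j w x - f j x)\<^sup>2) * indicator \<Omega> x \<partial>lborel) \<le> ennreal (C * \<epsilon> powr min (s * p) 1)" for j
    proof -
      have "(\<integral>\<^sup>+x. ennreal ((pderiv_dir j w x - f j x)\<^sup>2) * indicator \<Omega> x \<partial>lborel)
          \<le> ennreal (C0 * (Cg * A * \<epsilon> powr (s * p)) + (E1 + L)\<^sup>2 * (Cb * (5 * N * \<epsilon>)))"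
      proof (rule nn_integral_split_le[where S = S])
        show "(\<integral>\<^sup>+x. ennreal (\<bar>conv lborel (\<lambda>y. y) (f j) (mollifier \<epsilon>) x - f j x\<bar> powr p) \<partial>lborel) \<le> ennreal (Cg * A * \<epsilon> powr (s * p))"
          by (rule order_trans[OF Cg(2)[OF f \<epsilon>(1)] G_bound])
        fix x assume x: "x \<in> \<Omega>"
        show "(pderiv_dir j w x - f j x)\<^sup>2
            \<le> C0 * \<bar>conv lborel (\<lambda>y. y) (f j) (mollifier \<epsilon>) x - f j x\<bar> powr p + (E1 + L)\<^sup>2 * indicator S x"
        proof (cases "dist' x \<le> 4 * N * \<epsilon>")
          case True
          have "\<bar>pderiv_dir j w x - f j x\<bar> \<le> E1 + L" using w'_layer[OF x True, of j] fL[of j x] by linarith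
          then have "(pderiv_dir j w x - f j x)\<^sup>2 \<le> (E1 + L)\<^sup>2" by (simp add: abs_le_square_iff[symmetric])
          then show ?thesis using ve_layer(2)[OF x True] nonneg by (simp add: add_increasing)
        next
          case False
          have eq: "pderiv_dir j w x = pderiv_dir j ve x" using far_eq[of x "[j]"] False by simp
          have "\<bar>pderiv_dir j ve x - f j x\<bar> \<le> B + L" using ve'_bound[of j x] fL[of j x] by linarith
          then have "\<bar>pderiv_dir j ve x - f j x\<bar>\<^sup>2 \<le> C0 * \<bar>pderiv_dir j ve x - f j x\<bar> powr p"
            unfolding C0_def using p by (intro power2_le_powr) auto
          then show ?thesis unfolding eq ve' by (simp add: add_increasing2)
        qed
      qed (use nonneg S_meas CgA in auto)
      also have "\<dots> \<le> ennreal (C * \<epsilon> powr min (s * p) 1)"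
        using nonneg by (intro ennreal_leI total) auto
      finally show ?thesis .
    qed
    have S2: "(\<integral>\<^sup>+x. ennreal ((\<epsilon> * \<bar>pderiv_dir k (pderiv_dir j w) x\<bar>) powr p) * indicator \<Omega> x \<partial>lborel) \<le> ennreal (C * \<epsilon> powr min (s * p) 1)" for j k
    proof -
      have "(\<integral>\<^sup>+x. ennreal ((\<epsilon> * \<bar>pderiv_dir k (pderiv_dir j w) x\<bar>) powr p) * indicator \<Omega> x \<partial>lborel)
          \<le> ennreal (1 * (Cg * A * \<epsilon> powr (s * p)) + E2 powr p * (Cb * (5 * N * \<epsilon>)))"
      proof (rule nn_integral_split_le[where S = S])
        show "(\<integral>\<^sup>+x. ennreal ((\<epsilon> * \<bar>conv lborel (\<lambda>y. y) (f j) (pderiv_dir k (mollifier \<epsilon>)) x\<bar>) powr p) \<partial>lborel) \<le> ennreal (Cg * A * \<epsilon> powr (s * p))"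
          by (rule order_trans[OF Cg(3)[OF f \<epsilon>(1)] G_bound])
        fix x assume x: "x \<in> \<Omega>"
        show "(\<epsilon> * \<bar>pderiv_dir k (pderiv_dir j w) x\<bar>) powr p
            \<le> 1 * (\<epsilon> * \<bar>conv lborel (\<lambda>y. y) (f j) (pderiv_dir k (mollifier \<epsilon>)) x\<bar>) powr p + E2 powr p * indicator S x"
        proof (cases "dist' x \<le> 4 * N * \<epsilon>")
          case True
          have "(\<epsilon> * \<bar>pderiv_dir k (pderiv_dir j w) x\<bar>) powr p \<le> E2 powr p"
            using w''_layer[OF x True, of k j] \<epsilon>(1) p by (intro powr_mono2) auto
          then show ?thesis using ve_layer(2)[OF x True] by (simp add: add_increasing)
        next
          case False
          have eq: "pderiv_dir k (pderiv_dir j w) x = pderiv_dir k (pderiv_dir j ve) x" using far_eq[of x "[k, j]"] False by simp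
          show ?thesis unfolding eq ve'' by simp
        qed
      qed (use nonneg S_meas CgA in auto)
      also have "\<dots> \<le> ennreal (C * \<epsilon> powr min (s * p) 1)"
        using nonneg by (intro ennreal_leI total) auto
      finally show ?thesis .
    qed
    show "\<exists>w. test_fun \<Omega> w \<and>
       (\<forall>j. (\<integral>\<^sup>+x. ennreal ((pderiv_dir j w x - f j x)\<^sup>2) * indicator \<Omega> x \<partial>lborel) \<le> ennreal (C * \<epsilon> powr min (s * p) 1)) \<and>
       (\<forall>j k. (\<integral>\<^sup>+x. ennreal ((\<epsilon> * \<bar>pderiv_dir k (pderiv_dir j w) x\<bar>) powr p) * indicator \<Omega> x \<partial>lborel)
          \<le> ennreal (C * \<epsilon> powr min (s * p) 1))"
      using w_test S1 S2 by blast
  qed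
qed

subsection \<open>Energy estimates\<close>

text \<open>The complement of the essential support is an uncountable union of open sets; the
  Lindelof property reduces it to a countable one, for which exceptional null sets may be
  united.\<close>

lemma AE_eq_0_outside_ess_supp:
  assumes "ess_supp f \<subseteq> closure \<Omega>"
  shows "AE x in lebesgue. x \<notin> closure \<Omega> \<longrightarrow> f x = 0"
proof -
  let ?F = "{U. open U \<and> (AE x in lebesgue. x \<in> U \<longrightarrow> f x = 0)}"
  obtain F' where F': "F' \<subseteq> ?F" "countable F'" "\<Union>F' = \<Union>?F"
    by (rule Lindelof[of ?F]) auto
  have "AE x in lebesgue. \<forall>U\<in>F'. x \<in> U \<longrightarrow> f x = 0"
    using F' by (subst AE_ball_countable) auto
  then show ?thesis
  proof eventually_elim
    case (elim x)
    show ?case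
    proof
      assume "x \<notin> closure \<Omega>"
      then have "x \<in> \<Union>?F" using assms unfolding ess_supp_def by blast
      then show "f x = 0" using elim F'(3) by blast
    qed
  qed
qed

section \<open>Extracting scalar derivatives from Sobolev norms\<close>

lemma abs_le_tensor_norm:
  fixes T :: "'n::finite list \<Rightarrow> real"
  assumes "length is = k"
  shows "\<bar>T is\<bar> \<le> tensor_norm k T"
proof -
  have fin: "finite {is :: 'n list. length is = k}"
    using finite_lists_length_eq[of "UNIV :: 'n set" k] by simp
  have "(T is)\<^sup>2 \<le> (\<Sum>is\<in>{is. length is = k}. (T is)\<^sup>2)"
    using assms fin by (intro member_le_sum) auto
  then have "sqrt ((T is)\<^sup>2) \<le> tensor_norm k T"
    unfolding tensor_norm_def L2_set_def by (rule real_sqrt_le_mono)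
  then show ?thesis by simp
qed

lemma Lp_pow_mono:
  assumes "\<And>x. norm (f x) \<le> norm (g x)" "p \<ge> 0"
  shows "Lp_pow S p f \<le> Lp_pow S p g"
  unfolding Lp_pow_def using assms by (intro nn_integral_mono mult_right_mono ennreal_leI powr_mono2) auto

text \<open>Only the top order is extracted, since for noninteger \<open>r\<close> the norm contains
  no intermediate orders. The step down to order 2 is left to
  \<open>weak_deriv_Lp_lower_order\<close>.\<close>

lemma sobolev_space_higher_order:
  fixes f :: "real^'n \<Rightarrow> real"
  assumes "f \<in> sobolev_space r p" "r \<ge> 2" "p \<ge> 1"
  obtains k where "k \<ge> 2" "\<And>is. length is = k \<Longrightarrow> \<exists>g. weak_deriv UNIV is f g \<and> Lp_pow UNIV p g < \<infinity>"
proof -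
  define k where "k = nat \<lfloor>r\<rfloor>"
  have k: "k \<ge> 2" using assms(2) by (simp add: k_def le_nat_iff le_floor_iff)
  have fin: "sobolev_pow r p f < \<infinity>" using assms by (simp add: sobolev_space_def)
  have "\<exists>g. (\<forall>is. length is = k \<longrightarrow> weak_deriv UNIV is f (g is)) \<and> Lp_pow UNIV p (\<lambda>x. tensor_norm k (\<lambda>is. g is x)) < \<infinity>"
  proof (cases "frac r = 0")
    case True
    then obtain g where g: "\<And>is. length is \<le> k \<Longrightarrow> weak_deriv UNIV is f (g is)"
      and sum: "(\<Sum>j\<le>k. Lp_pow UNIV p (\<lambda>x. tensor_norm j (\<lambda>is. g is x))) < \<infinity>"
      using fin unfolding sobolev_pow_def by (auto simp: INF_less_iff k_def[symmetric])
    have "Lp_pow UNIV p (\<lambda>x. tensor_norm k (\<lambda>is. g is x)) \<le> (\<Sum>j\<le>k. Lp_pow UNIV p (\<lambda>x. tensor_norm j (\<lambda>is. g is x)))"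
      by (rule member_le_sum) auto
    then show ?thesis using g sum by (intro exI[of _ g]) auto
  next
    case False
    then obtain g where g: "\<And>is. length is = k \<Longrightarrow> weak_deriv UNIV is f (g is)"
      and sum: "Lp_pow UNIV p f + Lp_pow UNIV p (\<lambda>x. tensor_norm k (\<lambda>is. g is x)) + gagliardo_pow k (frac r) p g < \<infinity>"
      using fin unfolding sobolev_pow_def by (auto simp: INF_less_iff k_def[symmetric])
    then show ?thesis by (intro exI[of _ g]) (auto simp: ennreal_add_less_top)
  qed
  then obtain g where g: "\<And>is. length is = k \<Longrightarrow> weak_deriv UNIV is f (g is)"
    and L: "Lp_pow UNIV p (\<lambda>x. tensor_norm k (\<lambda>is. g is x)) < \<infinity>" by blast
  show ?thesis
  proof (rule that[OF k])
    fix "is" :: "'n list" assume len: "length is = k"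
    have "Lp_pow UNIV p (g is) \<le> Lp_pow UNIV p (\<lambda>x. tensor_norm k (\<lambda>is. g is x))"
      using assms(3) order_trans[OF abs_le_tensor_norm[OF len] abs_ge_self]
      by (intro Lp_pow_mono) auto
    then show "\<exists>g. weak_deriv UNIV is f g \<and> Lp_pow UNIV p g < \<infinity>"
      using g[OF len] L by (auto intro: le_less_trans)
  qed
qed

lemma sobolev_space_gagliardo:
  fixes f :: "real^'n \<Rightarrow> real"
  assumes "f \<in> sobolev_space (1 + s) p" "0 < s" "s < 1"
  obtains g where "\<And>j. weak_deriv UNIV [j] f (g [j])" "gagliardo_pow 1 s p g < \<infinity>"
proof -
  have fr: "\<lfloor>1 + s\<rfloor> = 1" "frac (1 + s) = s" using assms by (auto simp: floor_eq_iff frac_unique_iff frac_def)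
  have "sobolev_pow (1 + s) p f < \<infinity>" using assms by (simp add: sobolev_space_def)
  then obtain g where g: "\<And>is. length is = 1 \<Longrightarrow> weak_deriv UNIV is f (g is)"
    and sum: "Lp_pow UNIV p f + Lp_pow UNIV p (\<lambda>x. tensor_norm 1 (\<lambda>is. g is x)) + gagliardo_pow 1 s p g < \<infinity>"
    using assms(2) unfolding sobolev_pow_def fr by (auto simp: INF_less_iff)
  then show ?thesis using that[of g] by (auto simp: ennreal_add_less_top)
qed

text \<open>A change on a null set is invisible in each of the two variables, and one entry of a
  tensor is bounded by its norm.\<close>

lemma gagliardo_integral_le_pow:
  fixes g :: "'n list \<Rightarrow> real^'n \<Rightarrow> real"
  assumes ae: "AE x in lebesgue. g [j] x = f x" and "p \<ge> 0"
  shows "gagliardo_integral s p f \<le> gagliardo_pow 1 s p g"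
proof -
  have ae': "AE x in lborel. g [j] x = f x" using ae by (simp add: AE_completion_iff)
  show ?thesis
    unfolding gagliardo_integral_def gagliardo_pow_def nn_integral_completion
  proof (rule nn_integral_mono_AE)
    show "AE x in lborel. (\<integral>\<^sup>+y. ennreal (\<bar>f x - f y\<bar> powr p / norm (x - y) powr (real CARD('n) + s * p)) \<partial>lborel)
       \<le> (\<integral>\<^sup>+y. ennreal (tensor_norm 1 (\<lambda>is. g is x - g is y) powr p / norm (x - y) powr (real CARD('n) + s * p)) \<partial>lborel)"
      using ae'
    proof eventually_elim
      case x: (elim x)
      show ?case
      proof (rule nn_integral_mono_AE)
        show "AE y in lborel. ennreal (\<bar>f x - f y\<bar> powr p / norm (x - y) powr (real CARD('n) + s * p))
          \<le> ennreal (tensor_norm 1 (\<lambda>is. g is x - g is y) powr p / norm (x - y) powr (real CARD('n) + s * p))"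
          using ae'
        proof eventually_elim
          case (elim y)
          have "\<bar>f x - f y\<bar> \<le> tensor_norm 1 (\<lambda>is. g is x - g is y)"
            using abs_le_tensor_norm[of "[j]" 1 "\<lambda>is. g is x - g is y"] x elim by simp
          then show ?case using assms(2) by (intro ennreal_leI divide_right_mono powr_mono2) auto
        qed
      qed
    qed
  qed
qed

section \<open>Norms of tensors and local integrability\<close>

lemma norm_vec_powr_le:
  fixes x :: "'b::real_normed_vector^'n"
  assumes "p \<ge> 0"
  shows "norm x powr p \<le> real CARD('n) powr p * (\<Sum>i\<in>UNIV. norm (x $ i) powr p)"
proof -
  \<comment> \<open>The index of the largest entry: the norm is at most \<open>CARD('n)\<close>
    times that entry, whose power is one term of the sum. This covers all \<open>p \<ge> 0\<close>
    without convexity.\<close>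
  obtain m where m: "\<And>i. norm (x $ i) \<le> norm (x $ m)"
  proof -
    have "Max (range (\<lambda>i. norm (x $ i))) \<in> range (\<lambda>i. norm (x $ i))" by (intro Max_in) auto
    then obtain m where "Max (range (\<lambda>i. norm (x $ i))) = norm (x $ m)" by (rule imageE)
    then show ?thesis using that[of m] by (metis Max_ge finite finite_imageI rangeI)
  qed
  have "norm x \<le> (\<Sum>i\<in>UNIV. norm (x $ i))"
    unfolding norm_vec_def by (rule L2_set_le_sum) auto
  also have "\<dots> \<le> real CARD('n) * norm (x $ m)"
    using sum_mono[of UNIV "\<lambda>i. norm (x $ i)" "\<lambda>_. norm (x $ m)"] m by simp
  finally have "norm x powr p \<le> (real CARD('n) * norm (x $ m)) powr p"
    using assms by (intro powr_mono2) auto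
  also have "\<dots> = real CARD('n) powr p * norm (x $ m) powr p" by (simp add: powr_mult)
  also have "\<dots> \<le> real CARD('n) powr p * (\<Sum>i\<in>UNIV. norm (x $ i) powr p)"
    by (intro mult_left_mono member_le_sum[of m UNIV "\<lambda>i. norm (x $ i) powr p"]) auto
  finally show ?thesis .
qed

lemma norm_tensor3_powr_le:
  fixes D :: "real^'n^'n^'n"
  assumes "p \<ge> 0"
  shows "norm D powr p \<le> (real CARD('n) powr p) ^ 3 * (\<Sum>i\<in>UNIV. \<Sum>j\<in>UNIV. \<Sum>k\<in>UNIV. \<bar>D $ i $ j $ k\<bar> powr p)"
proof -
  let ?c = "real CARD('n) powr p"
  have "norm D powr p \<le> ?c * (\<Sum>i\<in>UNIV. norm (D $ i) powr p)" by (rule norm_vec_powr_le[OF assms])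
  also have "\<dots> \<le> ?c * (\<Sum>i\<in>UNIV. ?c * (\<Sum>j\<in>UNIV. norm (D $ i $ j) powr p))"
    by (intro mult_left_mono sum_mono norm_vec_powr_le assms) auto
  also have "\<dots> \<le> ?c * (\<Sum>i\<in>UNIV. ?c * (\<Sum>j\<in>UNIV. ?c * (\<Sum>k\<in>UNIV. norm (D $ i $ j $ k) powr p)))"
    by (intro mult_left_mono sum_mono norm_vec_powr_le assms) auto
  also have "\<dots> = ?c ^ 3 * (\<Sum>i\<in>UNIV. \<Sum>j\<in>UNIV. \<Sum>k\<in>UNIV. \<bar>D $ i $ j $ k\<bar> powr p)"
    by (simp add: sum_distrib_left power3_eq_cube mult_ac)
  finally show ?thesis .
qed

lemma norm_matrix_power2: "(norm (A :: real^'n^'m))\<^sup>2 = (\<Sum>i\<in>UNIV. \<Sum>j\<in>UNIV. (A $ i $ j)\<^sup>2)"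
  by (simp add: norm_vec_def L2_set_def sum_nonneg)

lemma borel_measurable_vecI:
  fixes f :: "'a \<Rightarrow> 'b::euclidean_space^'n"
  assumes "\<And>i. (\<lambda>x. f x $ i) \<in> borel_measurable M"
  shows "f \<in> borel_measurable M"
  unfolding borel_measurable_euclidean_space[of f] Basis_vec_def
  using assms by (auto simp: inner_axis)

lemma in_Lp_bounded:
  fixes f :: "real^'n \<Rightarrow> 'b::euclidean_space"
  assumes f: "f \<in> borel_measurable lebesgue" and S: "S \<in> sets lebesgue" "bounded S"
    and B: "AE x in lebesgue. x \<in> S \<longrightarrow> norm (f x) \<le> B" and p: "p \<ge> 0"
  shows "in_Lp S p f"
proof -
  obtain R where R: "S \<subseteq> cball 0 R" using S(2) unfolding bounded_iff by (metis mem_cball_0 subsetI)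
  have "Lp_pow S p f \<le> (\<integral>\<^sup>+x. ennreal (\<bar>B\<bar> powr p) * indicator (cball (0::real^'n) R) x \<partial>lebesgue)"
    unfolding Lp_pow_def
  proof (rule nn_integral_mono_AE)
    show "AE x in lebesgue. ennreal (norm (f x) powr p) * indicator S x \<le> ennreal (\<bar>B\<bar> powr p) * indicator (cball (0::real^'n) R) x"
      using B
    proof eventually_elim
      case (elim x)
      then show ?case using R p by (auto simp: indicator_def intro!: ennreal_leI powr_mono2)
    qed
  qed
  also have "\<dots> = ennreal (\<bar>B\<bar> powr p) * emeasure lborel (cball (0::real^'n) R)"
    by (simp add: nn_integral_completion nn_integral_cmult_indicator)
  also have "\<dots> < \<infinity>"
    using emeasure_lborel_cball_finite[of "0::real^'n" R] by (simp add: ennreal_mult_less_top)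
  finally show ?thesis
    unfolding in_Lp_def set_borel_measurable_def using f S by (auto intro: borel_measurable_scaleR borel_measurable_indicator)
qed

lemma in_Lp_continuous:
  fixes f :: "real^'n \<Rightarrow> 'b::euclidean_space"
  assumes f: "continuous_on UNIV f" and S: "S \<in> sets lebesgue" "bounded S" and p: "p \<ge> 0"
  shows "in_Lp S p f"
proof -
  have "compact (f ` closure S)"
    using S f by (intro compact_continuous_image) (auto simp: compact_closure intro: continuous_on_subset)
  then obtain B where "\<forall>x\<in>closure S. norm (f x) \<le> B"
    using compact_imp_bounded bounded_iff by (metis image_eqI)
  then have "AE x in lebesgue. x \<in> S \<longrightarrow> norm (f x) \<le> B"
    using closure_subset[of S] by (intro AE_I2) auto
  moreover have "f \<in> borel_measurable lebesgue"
    using borel_measurable_continuous_onI[OF f] by (intro measurable_completion) simp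
  ultimately show ?thesis using S p by (intro in_Lp_bounded)
qed

section \<open>Derivatives of the affine boundary data\<close>

lemma affine_component_has_derivative:
  fixes M :: "real^'n^'n"
  shows "((\<lambda>x. (M *v x) $ i + b $ i) has_derivative (\<lambda>h. \<Sum>j\<in>UNIV. M $ i $ j * h $ j)) (at x)"
  unfolding matrix_vector_mult_def
  by (auto intro!: derivative_eq_intros bounded_linear.has_derivative[OF bounded_linear_vec_nth])

lemma pderiv_dir_affine_component:
  fixes M :: "real^'n^'n"
  shows "pderiv_dir j (\<lambda>x. (M *v x) $ i + b $ i) = (\<lambda>x. M $ i $ j)"
proof
  fix x
  show "pderiv_dir j (\<lambda>x. (M *v x) $ i + b $ i) x = M $ i $ j"
    using pderiv_dirI[OF affine_component_has_derivative[of M i b x], of j] sum_axis_mult[of j "\<lambda>k. M $ i $ k"]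
    by (simp add: mult.commute)
qed

lemma differentiable_affine_component:
  fixes M :: "real^'n^'n"
  shows "(\<lambda>x. (M *v x) $ i + b $ i) differentiable (at x)"
  using affine_component_has_derivative unfolding differentiable_def by blast

lemma weak_deriv_subset:
  assumes "weak_deriv UNIV is f g"
  shows "weak_deriv S is f g"
  unfolding weak_deriv_def
proof (intro conjI allI impI)
  show "loc_integrable S f" "loc_integrable S g"
    using assms by (auto simp: weak_deriv_def loc_integrable_def)
  fix \<phi> assume \<phi>: "test_fun S \<phi>"
  then have "test_fun UNIV \<phi>" by (rule test_fun_mono) simp
  then show "(LINT x:S|lebesgue. f x * iter_pderiv is \<phi> x) = (- 1) ^ length is * (LINT x:S|lebesgue. g x * \<phi> x)"
    using assms unfolding weak_deriv_def set_integral_test_fun[OF \<phi>] by (simp add: set_lebesgue_integral_def)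
qed

lemma not_eventually_powr_le:
  fixes C a t e :: real
  assumes "a < t" "e > 0" and le: "\<And>\<epsilon>. 0 < \<epsilon> \<Longrightarrow> \<epsilon> < e \<Longrightarrow> \<epsilon> powr a \<le> C * \<epsilon> powr t"
  shows False
proof -
  define C' where "C' = \<bar>C\<bar> + 1"
  \<comment> \<open>Chosen so that \<open>\<epsilon> powr (t - a)\<close> is at most
    \<open>1 / (2 * C')\<close>, which makes the right side of the assumed inequality at most half
    of the left.\<close>
  define \<epsilon> where "\<epsilon> = min (e / 2) ((1 / (2 * C')) powr (1 / (t - a)))"
  have C': "C' > 0" by (simp add: C'_def)
  have \<epsilon>: "0 < \<epsilon>" "\<epsilon> < e" using assms C' by (auto simp: \<epsilon>_def)
  have "\<epsilon> powr (t - a) \<le> ((1 / (2 * C')) powr (1 / (t - a))) powr (t - a)"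
    using \<epsilon> assms by (intro powr_mono2) (auto simp: \<epsilon>_def)
  also have "\<dots> = 1 / (2 * C')" using assms C' by (simp add: powr_powr)
  finally have small: "\<epsilon> powr (t - a) \<le> 1 / (2 * C')" .
  have "\<epsilon> powr a \<le> C * (\<epsilon> powr a * \<epsilon> powr (t - a))"
    using le[OF \<epsilon>] by (simp add: powr_add[symmetric])
  also have "\<dots> \<le> C' * (\<epsilon> powr a * \<epsilon> powr (t - a))" by (intro mult_right_mono) (auto simp: C'_def)
  also have "\<dots> \<le> C' * (\<epsilon> powr a * (1 / (2 * C')))" using small C' by (intro mult_left_mono) auto
  also have "\<dots> = \<epsilon> powr a / 2" using C' by simp
  finally show False using \<epsilon> by (simp add: not_le[symmetric])
qed

lemma energy_inf_le:
  assumes "admissible \<Omega> M p u G D"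
  shows "energy_inf \<Omega> M K p \<epsilon> \<le> (\<integral>\<^sup>+x\<in>\<Omega>. ennreal ((infdist (G x) K)\<^sup>2) \<partial>lebesgue) + ennreal (\<epsilon> powr p) * Lp_pow \<Omega> p D"
  unfolding energy_inf_def using assms by (intro INF_lower2[of "(u, G, D)"]) auto

text \<open>Here \<open>u\<close> itself is a competitor, with vanishing elastic energy.\<close>

lemma energy_inf_le_of_second_derivatives:
  fixes \<Omega> :: "(real^'n) set" and u :: "real^'n \<Rightarrow> real^'n" and M :: "real^'n^'n"
  assumes \<Omega>: "open \<Omega>" "bounded \<Omega>" and p: "1 \<le> p"
    and G: "weak_gradient UNIV u G" and GK: "AE x in lebesgue. x \<in> \<Omega> \<longrightarrow> G x \<in> K"
    and GM: "AE x in lebesgue. x \<notin> closure \<Omega> \<longrightarrow> G x = M"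
    and GL: "AE x in lebesgue. norm (G x) \<le> L0"
    and vB: "\<And>i. AE x in lebesgue. \<bar>u x $ i - ((M *v x) $ i + b $ i)\<bar> \<le> B"
    and der: "\<And>i is. length is = 2 \<Longrightarrow>
      \<exists>g. weak_deriv UNIV is (\<lambda>x. u x $ i - ((M *v x) $ i + b $ i)) g \<and> Lp_pow UNIV p g < \<infinity>"
  obtains C where "\<And>\<epsilon>. \<epsilon> > 0 \<Longrightarrow> energy_inf \<Omega> M K p \<epsilon> \<le> ennreal (C * \<epsilon> powr p)"
proof -
  let ?a = "\<lambda>i x. (M *v x) $ i + b $ i"
  have "\<exists>g. \<forall>i. \<forall>is. length is = 2 \<longrightarrow> weak_deriv UNIV is (\<lambda>x. u x $ i - ?a i x) (g i is) \<and> Lp_pow UNIV p (g i is) < \<infinity>"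
    using der by (intro choice allI) (metis (no_types, lifting))
  then obtain g where g: "\<And>i is. length is = 2 \<Longrightarrow> weak_deriv UNIV is (\<lambda>x. u x $ i - ?a i x) (g i is)"
      "\<And>i is. length is = 2 \<Longrightarrow> Lp_pow UNIV p (g i is) < \<infinity>"
    by blast
  define D where "D x = (\<chi> i j k. g i [j, k] x)" for x
  have D_nth: "D x $ i $ j $ k = g i [j, k] x" for x i j k by (simp add: D_def)
  have u_li: "loc_integrable UNIV (\<lambda>x. u x $ i)" for i using G by (auto simp: weak_gradient_def weak_deriv_def)
  have G_li: "loc_integrable UNIV (\<lambda>x. G x $ i $ j)" for i j using G by (auto simp: weak_gradient_def weak_deriv_def)
  have D_li: "loc_integrable UNIV (\<lambda>x. D x $ i $ j $ k)" for i j k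
    using g(1)[of "[j, k]" i] by (simp add: D_nth weak_deriv_def)
  have u_meas: "u \<in> borel_measurable lebesgue"
    by (rule borel_measurable_vecI, rule loc_integrable_borel[OF u_li])
  have G_meas: "G \<in> borel_measurable lebesgue"
    by (rule borel_measurable_vecI, rule borel_measurable_vecI, rule loc_integrable_borel[OF G_li])
  have D_meas: "D \<in> borel_measurable lebesgue"
    by (rule borel_measurable_vecI, rule borel_measurable_vecI, rule borel_measurable_vecI, rule loc_integrable_borel[OF D_li])
  have \<Omega>_sets: "\<Omega> \<in> sets lebesgue" using \<Omega>(1) by simp
  \<comment> \<open>The affine part has zero second derivatives, so the weak Hessian of
    \<open>u\<close> is that of \<open>u\<close> minus its affine part.\<close>
  have a0: "weak_deriv UNIV [j, k] (?a i) (\<lambda>_. 0)" for i j k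
  proof -
    have 1: "weak_deriv UNIV [j] (?a i) (\<lambda>_. M $ i $ j)"
      using weak_deriv_classical[of "?a i" j UNIV] differentiable_affine_component[of M i b]
      unfolding pderiv_dir_affine_component by (simp add: continuous_on_const)
    have 2: "weak_deriv UNIV [k] (\<lambda>_. M $ i $ j) (\<lambda>_. 0)"
      using weak_deriv_classical[of "\<lambda>_. M $ i $ j" k UNIV] by (simp add: continuous_on_const)
    show ?thesis using weak_deriv_append[OF 1 2] by simp
  qed
  have hess: "weak_deriv \<Omega> [j, k] (\<lambda>x. u x $ i) (\<lambda>x. D x $ i $ j $ k)" for i j k
  proof -
    \<comment> \<open>The affine part is added back by subtracting its negative, itself a difference
      with the zero function, so that \<open>weak_deriv_diff\<close> applies twice.\<close>
    have "weak_deriv UNIV [j, k] (\<lambda>x. (u x $ i - ?a i x) - (\<lambda>x. 0 - ?a i x) x) (\<lambda>x. g i [j, k] x - (\<lambda>x. 0 - 0) x)"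
    proof (rule weak_deriv_diff[OF g(1)[of "[j, k]"]])
      have "weak_deriv UNIV [j, k] (\<lambda>_. 0 :: real) (\<lambda>_. 0)"
        unfolding weak_deriv_def by (simp add: loc_integrable_continuous set_lebesgue_integral_def continuous_on_const)
      then show "weak_deriv UNIV [j, k] (\<lambda>x. 0 - ?a i x) (\<lambda>x. 0 - 0)" by (rule weak_deriv_diff[OF _ a0])
    qed simp
    then have "weak_deriv UNIV [j, k] (\<lambda>x. u x $ i) (\<lambda>x. D x $ i $ j $ k)" by (simp add: D_nth)
    then show ?thesis by (rule weak_deriv_subset)
  qed
  have DL: "Lp_pow \<Omega> p D < \<infinity>"
  proof -
    let ?c = "(real CARD('n) powr p) ^ 3"
    have [measurable]: "(\<lambda>x. g i [j, k] x) \<in> borel_measurable lebesgue" for i j k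
      using loc_integrable_borel[OF D_li[of i j k]] by (simp add: D_nth)
    have "Lp_pow \<Omega> p D \<le> (\<integral>\<^sup>+x. ennreal (?c * (\<Sum>i\<in>UNIV. \<Sum>j\<in>UNIV. \<Sum>k\<in>UNIV. \<bar>g i [j, k] x\<bar> powr p)) \<partial>lebesgue)"
      unfolding Lp_pow_def
    proof (rule nn_integral_mono)
      fix x
      have "ennreal (norm (D x) powr p) \<le> ennreal (?c * (\<Sum>i\<in>UNIV. \<Sum>j\<in>UNIV. \<Sum>k\<in>UNIV. \<bar>g i [j, k] x\<bar> powr p))"
        using norm_tensor3_powr_le[of p "D x"] p by (intro ennreal_leI) (simp add: D_nth)
      then show "ennreal (norm (D x) powr p) * indicator \<Omega> x \<le> ennreal (?c * (\<Sum>i\<in>UNIV. \<Sum>j\<in>UNIV. \<Sum>k\<in>UNIV. \<bar>g i [j, k] x\<bar> powr p))"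
        by (auto simp: indicator_def)
    qed
    also have "\<dots> = ennreal ?c * (\<Sum>i\<in>UNIV. \<Sum>j\<in>UNIV. \<Sum>k\<in>UNIV. Lp_pow UNIV p (g i [j, k]))"
      unfolding Lp_pow_def
      by (simp add: ennreal_mult sum_nonneg nn_integral_cmult nn_integral_sum flip: sum_ennreal)
    also have "\<dots> < \<infinity>" using g(2) by (simp add: ennreal_mult_less_top ennreal_sum_less_top)
    finally show ?thesis .
  qed
  have adm: "admissible \<Omega> M p u G D"
    unfolding admissible_def
  proof (intro conjI allI impI G GM)
    fix C :: "(real^'n) set" assume C: "compact C"
    then have Cb: "C \<in> sets lebesgue" "bounded C" by (auto simp: borel_compact compact_imp_bounded)
    show "in_Lp C 2 G" by (rule in_Lp_bounded[OF G_meas Cb, of L0]) (use GL in auto)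
    obtain Ba where Ba: "\<And>x i. x \<in> C \<Longrightarrow> \<bar>?a i x\<bar> \<le> Ba"
    proof -
      have cont: "continuous_on C (\<lambda>x. M *v x + b)"
        by (intro continuous_intros)
      have "bounded ((\<lambda>x. M *v x + b) ` C)" by (rule compact_imp_bounded[OF compact_continuous_image[OF cont C]])
      then obtain Ba where "\<And>x. x \<in> C \<Longrightarrow> norm (M *v x + b) \<le> Ba" unfolding bounded_iff by auto
      then have "\<bar>?a i x\<bar> \<le> Ba" if "x \<in> C" for i x
        using component_le_norm_cart[of "M *v x + b" i] that by fastforce
      then show ?thesis using that by blast
    qed
    have "AE x in lebesgue. \<forall>i\<in>UNIV. \<bar>u x $ i - ?a i x\<bar> \<le> B"
      using vB by (intro AE_finite_allI) auto
    then have "AE x in lebesgue. x \<in> C \<longrightarrow> norm (u x) \<le> real CARD('n) * (B + Ba)"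
    proof eventually_elim
      case (elim x)
      show ?case
      proof
        assume x: "x \<in> C"
        have "\<bar>u x $ i\<bar> \<le> B + Ba" for i using elim[rule_format, of i] Ba[OF x, of i] by simp
        then have "(\<Sum>i\<in>UNIV. \<bar>u x $ i\<bar>) \<le> (\<Sum>i\<in>(UNIV::'n set). B + Ba)" by (intro sum_mono)
        then show "norm (u x) \<le> real CARD('n) * (B + Ba)" using norm_le_l1_cart[of "u x"] by simp
      qed
    qed
    then show "in_Lp C 2 u" by (rule in_Lp_bounded[OF u_meas Cb]) simp
  next
    show "weak_hessian \<Omega> u D" using hess by (simp add: weak_hessian_def)
    show "in_Lp \<Omega> p D"
      unfolding in_Lp_def set_borel_measurable_def using DL D_meas \<Omega>_sets
      by (auto intro: borel_measurable_scaleR borel_measurable_indicator)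
  qed
  show ?thesis
  proof (rule that)
    fix \<epsilon> :: real assume e: "\<epsilon> > 0"
    have "(\<integral>\<^sup>+x\<in>\<Omega>. ennreal ((infdist (G x) K)\<^sup>2) \<partial>lebesgue) = (\<integral>\<^sup>+x. 0 \<partial>(lebesgue :: (real^'n) measure))"
      using GK by (intro nn_integral_cong_AE) (auto simp: indicator_def elim!: eventually_mono)
    then have "energy_inf \<Omega> M K p \<epsilon> \<le> ennreal (\<epsilon> powr p) * Lp_pow \<Omega> p D"
      using energy_inf_le[OF adm, of K \<epsilon>] by simp
    also have "\<dots> = ennreal (enn2real (Lp_pow \<Omega> p D) * \<epsilon> powr p)"
      using DL by (simp add: ennreal_mult mult.commute)
    finally show "energy_inf \<Omega> M K p \<epsilon> \<le> ennreal (enn2real (Lp_pow \<Omega> p D) * \<epsilon> powr p)" .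
  qed
qed

lemma nn_integral_sum2:
  assumes "\<And>i j. h i j \<in> borel_measurable M"
  shows "(\<integral>\<^sup>+x. (\<Sum>i\<in>I. \<Sum>j\<in>J. h i j x) \<partial>M) = (\<Sum>i\<in>I. \<Sum>j\<in>J. \<integral>\<^sup>+x. h i j x \<partial>M)"
  using assms by (simp add: nn_integral_sum)

lemma nn_integral_cmult_sum3:
  assumes "\<And>i j k. h i j k \<in> borel_measurable M"
  shows "(\<integral>\<^sup>+x. c * (\<Sum>i\<in>I. \<Sum>j\<in>J. \<Sum>k\<in>K. h i j k x) \<partial>M) = c * (\<Sum>i\<in>I. \<Sum>j\<in>J. \<Sum>k\<in>K. \<integral>\<^sup>+x. h i j k x \<partial>M)"
  using assms by (simp add: nn_integral_sum nn_integral_cmult)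

text \<open>The competitor is \<open>M *v x\<close> plus the \<open>w i\<close>; their supports in
  \<Omega> keep its gradient equal to \<open>M\<close> outside. As \<open>M + F x\<close> lies in
  \<open>K\<close>, the distance to \<open>K\<close> is at most the error of the derivatives of
  \<open>w\<close> against \<open>F\<close>. The factor counts matrix and tensor entries, with the
  constant of \<open>norm_tensor3_powr_le\<close>.\<close>

lemma energy_inf_le_of_smooth_approximations:
  fixes \<Omega> :: "(real^'n) set" and M :: "real^'n^'n" and w :: "'n \<Rightarrow> real^'n \<Rightarrow> real" and F :: "real^'n \<Rightarrow> real^'n^'n"
  assumes \<Omega>: "open \<Omega>" "bounded \<Omega>" and p: "1 \<le> p" and \<epsilon>: "\<epsilon> > 0"
    and FK: "AE x in lebesgue. x \<in> \<Omega> \<longrightarrow> M + F x \<in> K" and F_meas: "\<And>i j. (\<lambda>x. F x $ i $ j) \<in> borel_measurable borel"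
    and w: "\<And>i. test_fun \<Omega> (w i)"
    and w1: "\<And>i j. (\<integral>\<^sup>+x. ennreal ((pderiv_dir j (w i) x - F x $ i $ j)\<^sup>2) * indicator \<Omega> x \<partial>lborel) \<le> ennreal q"
    and w2: "\<And>i j k. (\<integral>\<^sup>+x. ennreal ((\<epsilon> * \<bar>pderiv_dir k (pderiv_dir j (w i)) x\<bar>) powr p) * indicator \<Omega> x \<partial>lborel) \<le> ennreal q"
    and q: "q \<ge> 0"
  shows "energy_inf \<Omega> M K p \<epsilon> \<le> ennreal ((real CARD('n) ^ 2 + (real CARD('n) powr p) ^ 3 * real CARD('n) ^ 3) * q)"
proof -
  let ?n = "real CARD('n)"
  \<comment> \<open>The offset is chosen as 0, since a constant changes no gradient; it is spelled
    \<open>0 $ i\<close> to fit the lemmas on affine components.\<close>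
  define u where "u x = (\<chi> i. ((M *v x) $ i + 0 $ i) + w i x)" for x
  define G where "G x = (\<chi> i j. M $ i $ j + pderiv_dir j (w i) x)" for x
  define D where "D x = (\<chi> i j k. pderiv_dir k (pderiv_dir j (w i)) x)" for x
  have sm: "smooth_fun (w i)" for i by (rule test_fun_smooth[OF w])
  note sms = sm smooth_fun_pderiv_dir[OF sm] smooth_fun_pderiv_dir[OF smooth_fun_pderiv_dir[OF sm]]
  have u_diff: "(\<lambda>x. u x $ i) differentiable (at x)" for i x
    unfolding u_def using differentiable_affine_component[of M i 0 x] smooth_fun_differentiable[OF sm]
    by (auto intro!: differentiable_add)
  have u': "pderiv_dir j (\<lambda>x. u x $ i) = (\<lambda>x. G x $ i $ j)" for i j
  proof
    fix x
    show "pderiv_dir j (\<lambda>x. u x $ i) x = G x $ i $ j"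
      using pderiv_dir_add[OF differentiable_affine_component[of M i 0 x] smooth_fun_differentiable[OF sm], of j i]
      unfolding pderiv_dir_affine_component by (simp add: u_def G_def)
  qed
  have G': "pderiv_dir k (\<lambda>x. G x $ i $ j) = (\<lambda>x. D x $ i $ j $ k)" for i j k
  proof
    fix x
    show "pderiv_dir k (\<lambda>x. G x $ i $ j) x = D x $ i $ j $ k"
      using pderiv_dir_add[of "\<lambda>x. M $ i $ j" x "pderiv_dir j (w i)" k] smooth_fun_differentiable[OF sms(2)]
      by (simp add: G_def D_def)
  qed
  have cont: "continuous_on UNIV G" "continuous_on UNIV D" "continuous_on UNIV u"
  proof -
    show "continuous_on UNIV G" unfolding G_def
      by (intro continuous_on_vec_lambda continuous_intros smooth_fun_continuous sms)
    show "continuous_on UNIV D" unfolding D_def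
      by (intro continuous_on_vec_lambda smooth_fun_continuous sms)
    have "continuous_on UNIV (\<lambda>x. (M *v x) $ i + 0 $ i)" for i
      using differentiable_affine_component[of M i 0]
      by (simp add: continuous_at_imp_continuous_on differentiable_imp_continuous_within)
    then show "continuous_on UNIV u" unfolding u_def
      by (intro continuous_on_vec_lambda continuous_on_add[OF _ smooth_fun_continuous[OF sm]])
  qed
  have contG: "continuous_on UNIV (\<lambda>x. G x $ i $ j)" "continuous_on UNIV (\<lambda>x. D x $ i $ j $ k)" for i j k
    using cont by (auto intro!: continuous_intros)
  have grad: "weak_deriv S [j] (\<lambda>x. u x $ i) (\<lambda>x. G x $ i $ j)" for S i j
    using weak_deriv_classical[OF u_diff, of j i S] contG unfolding u' by simp
  have G_diff: "(\<lambda>x. G x $ i $ j) differentiable (at x)" for i j x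
    unfolding G_def using smooth_fun_differentiable[OF sms(2)] by (auto intro!: differentiable_add)
  have hess: "weak_deriv S [k] (\<lambda>x. G x $ i $ j) (\<lambda>x. D x $ i $ j $ k)" for S i j k
    using weak_deriv_classical[OF G_diff, of k i j S] contG unfolding G' by simp
  have \<Omega>_sets: "\<Omega> \<in> sets lebesgue" using \<Omega>(1) by simp
  have adm: "admissible \<Omega> M p u G D"
    unfolding admissible_def
  proof (intro conjI allI impI)
    show "weak_gradient UNIV u G" using grad by (simp add: weak_gradient_def)
    show "weak_hessian \<Omega> u D" unfolding weak_hessian_def
      using weak_deriv_append[OF grad hess] by simp
    show "in_Lp \<Omega> p D" using cont \<Omega>_sets \<Omega> p by (intro in_Lp_continuous) auto
    show "in_Lp C 2 u" "in_Lp C 2 G" if "compact C" for C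
      using cont that by (auto intro!: in_Lp_continuous simp: borel_compact compact_imp_bounded)
    have "G x = M" if "x \<notin> closure \<Omega>" for x
    proof -
      have "x \<notin> \<Omega>" using that closure_subset by blast
      have "pderiv_dir j (w i) x = 0" for i j
        using test_funE[OF w[of i]] \<open>x \<notin> \<Omega>\<close> by (metis iter_pderiv.simps subsetD)
      then show ?thesis by (simp add: G_def vec_eq_iff)
    qed
    then show "AE x in lebesgue. x \<notin> closure \<Omega> \<longrightarrow> G x = M" by simp
  qed
  note [measurable] = F_meas
  have [measurable]: "pderiv_dir j (w i) \<in> borel_measurable borel" "pderiv_dir k (pderiv_dir j (w i)) \<in> borel_measurable borel" for i j k
    using sms by (auto intro: smooth_fun_borel)
  have [measurable]: "\<Omega> \<in> sets borel" using \<Omega>(1) by simp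
  have "(\<integral>\<^sup>+x\<in>\<Omega>. ennreal ((infdist (G x) K)\<^sup>2) \<partial>lebesgue)
      \<le> (\<integral>\<^sup>+x. (\<Sum>i\<in>UNIV. \<Sum>j\<in>UNIV. ennreal ((pderiv_dir j (w i) x - F x $ i $ j)\<^sup>2) * indicator \<Omega> x) \<partial>lborel)"
    unfolding nn_integral_completion
  proof (rule nn_integral_mono_AE)
    have "AE x in lborel. x \<in> \<Omega> \<longrightarrow> M + F x \<in> K" using FK by (simp add: AE_completion_iff)
    then show "AE x in lborel. ennreal ((infdist (G x) K)\<^sup>2) * indicator \<Omega> x
        \<le> (\<Sum>i\<in>UNIV. \<Sum>j\<in>UNIV. ennreal ((pderiv_dir j (w i) x - F x $ i $ j)\<^sup>2) * indicator \<Omega> x)"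
    proof eventually_elim
      case (elim x)
      show ?case
      proof (cases "x \<in> \<Omega>")
        case True
        have "infdist (G x) K \<le> norm (G x - (M + F x))"
          using infdist_le[of "M + F x" K "G x"] elim True by (simp add: dist_norm)
        then have "(infdist (G x) K)\<^sup>2 \<le> (norm (G x - (M + F x)))\<^sup>2"
          by (intro power_mono infdist_nonneg)
        also have "\<dots> = (\<Sum>i\<in>UNIV. \<Sum>j\<in>UNIV. (pderiv_dir j (w i) x - F x $ i $ j)\<^sup>2)"
          unfolding norm_matrix_power2 by (simp add: G_def)
        finally show ?thesis using True by (simp add: ennreal_leI sum_nonneg sum_ennreal)
      qed simp
    qed
  qed
  also have "\<dots> = (\<Sum>i\<in>UNIV. \<Sum>j\<in>UNIV. \<integral>\<^sup>+x. ennreal ((pderiv_dir j (w i) x - F x $ i $ j)\<^sup>2) * indicator \<Omega> x \<partial>lborel)"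
    by (rule nn_integral_sum2) measurable
  also have "\<dots> \<le> (\<Sum>i\<in>(UNIV::'n set). \<Sum>j\<in>(UNIV::'n set). ennreal q)"
    by (intro sum_mono w1)
  also have "\<dots> = ennreal (?n ^ 2 * q)"
    using q by (simp add: ennreal_of_nat_eq_real_of_nat ennreal_mult power2_eq_square mult.assoc)
  finally have 1: "(\<integral>\<^sup>+x\<in>\<Omega>. ennreal ((infdist (G x) K)\<^sup>2) \<partial>lebesgue) \<le> ennreal (?n ^ 2 * q)" .
  let ?c = "(?n powr p) ^ 3"
  have "ennreal (\<epsilon> powr p) * Lp_pow \<Omega> p D
      = (\<integral>\<^sup>+x. ennreal (\<epsilon> powr p) * (ennreal (norm (D x) powr p) * indicator \<Omega> x) \<partial>lborel)"
    unfolding Lp_pow_def nn_integral_completion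
    by (rule nn_integral_cmult[symmetric]) (use borel_measurable_continuous_onI[OF cont(2)] in measurable)
  also have "\<dots> \<le> (\<integral>\<^sup>+x. ennreal ?c * (\<Sum>i\<in>UNIV. \<Sum>j\<in>UNIV. \<Sum>k\<in>UNIV.
        ennreal ((\<epsilon> * \<bar>pderiv_dir k (pderiv_dir j (w i)) x\<bar>) powr p) * indicator \<Omega> x) \<partial>lborel)"
  proof (rule nn_integral_mono)
    fix x
    have "\<epsilon> powr p * norm (D x) powr p \<le> \<epsilon> powr p * (?c * (\<Sum>i\<in>UNIV. \<Sum>j\<in>UNIV. \<Sum>k\<in>UNIV. \<bar>D x $ i $ j $ k\<bar> powr p))"
      using p by (intro mult_left_mono norm_tensor3_powr_le) auto
    also have "\<dots> = ?c * (\<Sum>i\<in>UNIV. \<Sum>j\<in>UNIV. \<Sum>k\<in>UNIV. (\<epsilon> * \<bar>pderiv_dir k (pderiv_dir j (w i)) x\<bar>) powr p)"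
      using \<epsilon> by (simp add: sum_distrib_left powr_mult D_def mult_ac)
    finally have "ennreal (\<epsilon> powr p * norm (D x) powr p) \<le> ennreal (?c * (\<Sum>i\<in>UNIV. \<Sum>j\<in>UNIV. \<Sum>k\<in>UNIV. (\<epsilon> * \<bar>pderiv_dir k (pderiv_dir j (w i)) x\<bar>) powr p))"
      by (rule ennreal_leI)
    then have "ennreal (\<epsilon> powr p) * ennreal (norm (D x) powr p)
        \<le> ennreal ?c * (\<Sum>i\<in>UNIV. \<Sum>j\<in>UNIV. \<Sum>k\<in>UNIV. ennreal ((\<epsilon> * \<bar>pderiv_dir k (pderiv_dir j (w i)) x\<bar>) powr p))"
      by (simp add: ennreal_mult sum_nonneg flip: sum_ennreal)
    then show "ennreal (\<epsilon> powr p) * (ennreal (norm (D x) powr p) * indicator \<Omega> x) \<le> ennreal ?c * (\<Sum>i\<in>UNIV. \<Sum>j\<in>UNIV. \<Sum>k\<in>UNIV.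
        ennreal ((\<epsilon> * \<bar>pderiv_dir k (pderiv_dir j (w i)) x\<bar>) powr p) * indicator \<Omega> x)"
      by (cases "x \<in> \<Omega>") auto
  qed
  also have "\<dots> = ennreal ?c * (\<Sum>i\<in>UNIV. \<Sum>j\<in>UNIV. \<Sum>k\<in>UNIV.
        \<integral>\<^sup>+x. ennreal ((\<epsilon> * \<bar>pderiv_dir k (pderiv_dir j (w i)) x\<bar>) powr p) * indicator \<Omega> x \<partial>lborel)"
    by (rule nn_integral_cmult_sum3) measurable
  also have "\<dots> \<le> ennreal ?c * (\<Sum>i\<in>(UNIV::'n set). \<Sum>j\<in>(UNIV::'n set). \<Sum>k\<in>(UNIV::'n set). ennreal q)"
    by (intro mult_left_mono sum_mono w2) auto
  also have "\<dots> = ennreal (?c * ?n ^ 3 * q)"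
    using q by (simp add: ennreal_of_nat_eq_real_of_nat ennreal_mult power3_eq_cube mult.assoc)
  finally have 2: "ennreal (\<epsilon> powr p) * Lp_pow \<Omega> p D \<le> ennreal (?c * ?n ^ 3 * q)" .
  have "energy_inf \<Omega> M K p \<epsilon> \<le> ennreal (?n ^ 2 * q) + ennreal (?c * ?n ^ 3 * q)"
    using energy_inf_le[OF adm] add_mono[OF 1 2] by (rule order_trans)
  also have "\<dots> = ennreal ((?n ^ 2 + ?c * ?n ^ 3) * q)"
    using q by (simp add: ennreal_plus[symmetric] distrib_right del: ennreal_plus)
  finally show ?thesis .
qed

theorem proposition2p3:
  fixes p \<theta> \<theta>c C\<^sub>p \<epsilon>0 \<mu> s :: real
    and \<Omega> :: "(real^'n) set"
    and M :: "real^'n^'n"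
    and \<alpha> :: "real \<Rightarrow> real"
    and m :: nat
    and U :: "nat \<Rightarrow> real \<Rightarrow> real^'n^'n"
    and K :: "(real^'n^'n) set"
    and u :: "real^'n \<Rightarrow> real^'n"
    and b :: "real^'n"
  assumes "1 < p" and "p \<le> 2"
    and "C11_domain \<Omega>" and "bounded \<Omega>"
    and "0 \<le> \<theta>" and "0 \<le> \<theta>c" and "1 \<le> m"
    and "\<And>t. 0 \<le> t \<Longrightarrow> 0 \<le> \<alpha> t"
    and "\<And>j t. j \<in> {1..m} \<Longrightarrow> 0 \<le> t \<Longrightarrow> transpose (U j t) = U j t"
    and "K = energy_wells \<alpha> \<theta>c m U \<theta>"
    and "C\<^sub>p > 1" and "\<epsilon>0 > 0" and "\<mu> \<in> {0<..<1/2}"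
    and "\<And>\<epsilon>. \<epsilon> \<in> {0<..<\<epsilon>0} \<Longrightarrow>
           ennreal (\<epsilon> powr (2 * \<mu>)) \<le> ennreal C\<^sub>p * energy_inf \<Omega> M K p \<epsilon>"
    and "\<exists>G. weak_gradient UNIV u G \<and>
           (AE x in lebesgue. x \<in> \<Omega> \<longrightarrow> G x \<in> K) \<and>
           (AE x in lebesgue. x \<notin> closure \<Omega> \<longrightarrow> G x = M)"
    and "\<And>i. (\<lambda>x. (u x - M *v x - b) $ i) \<in> sobolev_space (1 + s) p"
    and "ess_supp (\<lambda>x. u x - M *v x - b) \<subseteq> closure \<Omega>"
    and "\<exists>H. weak_gradient UNIV (\<lambda>x. u x - M *v x - b) H \<and> in_Linf H"
  shows "s \<le> 2 * \<mu> / p"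
proof (rule ccontr)
  assume "\<not> s \<le> 2 * \<mu> / p"
  then have "2 * \<mu> / p < s" by simp
  then have sp: "2 * \<mu> < s * p" using assms(1) by (simp add: pos_divide_less_eq)
  have \<mu>: "0 < \<mu>" "2 * \<mu> < 1" using assms(13) by auto
  \<comment> \<open>Positivity puts \<open>1 + s\<close> in the range where
    \<open>sobolev_space\<close> is given by finiteness of the norm.\<close>
  have s0: "s > 0"
    using sp \<mu>(1) assms(1) by (smt (verit) mult_nonpos_nonneg)
  have op: "open \<Omega>" using assms(3) by (simp add: C11_domain_def)
  have bdd: "bounded \<Omega>" by fact
  have p1: "1 \<le> p" "0 \<le> p" using assms(1) by auto
  let ?a = "\<lambda>i x. (M *v x) $ i + b $ i"
  let ?v = "\<lambda>i x. u x $ i - ?a i x"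
  have v_eq: "(\<lambda>x. (u x - M *v x - b) $ i) = ?v i" for i by (auto simp: algebra_simps)
  obtain G where G: "weak_gradient UNIV u G" and GK: "AE x in lebesgue. x \<in> \<Omega> \<longrightarrow> G x \<in> K"
    and GM: "AE x in lebesgue. x \<notin> closure \<Omega> \<longrightarrow> G x = M"
    using assms(15) by blast
  obtain H where H: "weak_gradient UNIV (\<lambda>x. u x - M *v x - b) H" and HL: "in_Linf H"
    using assms(18) by blast
  obtain L where L: "AE x in lebesgue. norm (H x) \<le> L" using HL unfolding in_Linf_def by blast
  have sob: "?v i \<in> sobolev_space (1 + s) p" for i using assms(16)[of i] unfolding v_eq .
  have H_deriv: "weak_deriv UNIV [j] (?v i) (\<lambda>x. H x $ i $ j)" for i j
    using H unfolding weak_gradient_def v_eq by blast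
  have v_li: "loc_integrable UNIV (?v i)" for i using H_deriv by (auto simp: weak_deriv_def)
  have v0: "AE x in lebesgue. x \<notin> closure \<Omega> \<longrightarrow> ?v i x = 0" for i
    using AE_eq_0_outside_ess_supp[OF assms(17)]
    by eventually_elim (metis (no_types, lifting) v_eq zero_index)
  obtain r where r: "closure \<Omega> \<subseteq> ball 0 r"
    using bounded_subset_ballD[OF bounded_closure[OF bdd], of 0] by blast
  have v0r: "AE x in lebesgue. x \<notin> ball 0 r \<longrightarrow> ?v i x = 0" for i
    using v0[of i] by eventually_elim (use r in blast)
  \<comment> \<open>The inclusion in \<open>K\<close> and the boundedness are assumed for two a
    priori different weak gradients; uniqueness identifies them up to \<open>M\<close>.\<close>
  have GH: "AE x in lebesgue. G x = M + H x"
  proof -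
    have "AE x in lebesgue. G x $ i $ j - M $ i $ j = H x $ i $ j" for i j
    proof (rule weak_deriv_unique[OF _ H_deriv])
      have "weak_deriv UNIV [j] (?a i) (\<lambda>_. M $ i $ j)"
        using weak_deriv_classical[of "?a i" j UNIV] differentiable_affine_component[of M i b]
        unfolding pderiv_dir_affine_component by (simp add: continuous_on_const)
      then show "weak_deriv UNIV [j] (?v i) (\<lambda>x. G x $ i $ j - M $ i $ j)"
        using G unfolding weak_gradient_def by (intro weak_deriv_diff) auto
    qed
    then have "AE x in lebesgue. \<forall>i\<in>UNIV. \<forall>j\<in>UNIV. G x $ i $ j - M $ i $ j = H x $ i $ j"
      by (intro AE_finite_allI) auto
    then show ?thesis by eventually_elim (simp add: vec_eq_iff algebra_simps)
  qed
  have H_le: "\<bar>A $ i $ j\<bar> \<le> norm A" for A :: "real^'n^'n" and i j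
    using component_le_norm_cart[of "A $ i" j] Finite_Cartesian_Product.norm_nth_le[of A i] by linarith
  \<comment> \<open>Both regimes are brought to one form: \<open>t = p\<close> for
    \<open>s \<ge> 1\<close> and \<open>t = min (s * p) 1\<close> otherwise. In each case
    \<open>t\<close> exceeds \<open>2 * \<mu>\<close>, since \<open>p > 1 > 2 * \<mu>\<close> and
    \<open>s * p > 2 * \<mu>\<close>.\<close>
  have "\<exists>C e t. e > 0 \<and> 2 * \<mu> < t \<and> (\<forall>\<epsilon>. 0 < \<epsilon> \<and> \<epsilon> < e \<longrightarrow> energy_inf \<Omega> M K p \<epsilon> \<le> ennreal (C * \<epsilon> powr t))"
  proof (cases "s < 1")
    case False
    have der: "\<exists>g. weak_deriv UNIV is (?v i) g \<and> Lp_pow UNIV p g < \<infinity>" if "length is = 2" for i "is"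
    proof -
      obtain k where "k \<ge> 2" "\<And>is. length is = k \<Longrightarrow> \<exists>g. weak_deriv UNIV is (?v i) g \<and> Lp_pow UNIV p g < \<infinity>"
        by (rule sobolev_space_higher_order[OF sob[of i] _ p1(1)]) (use False in auto)
      from weak_deriv_Lp_lower_order[OF p1(1) v0r this that] show ?thesis .
    qed
    have "\<exists>B. \<forall>i. AE x in lebesgue. \<bar>?v i x\<bar> \<le> B i"
    proof (intro choice allI)
      fix i
      \<comment> \<open>One direction suffices to bound \<open>u\<close> minus its affine part by
        line integrals, and any will do.\<close>
      have "AE x in lebesgue. \<bar>H x $ i $ undefined\<bar> \<le> L"
        using L by eventually_elim (use H_le order_trans in blast)
      from bounded_if_weak_deriv_bounded[OF H_deriv this v0r] show "\<exists>B. AE x in lebesgue. \<bar>?v i x\<bar> \<le> B" by blast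
    qed
    then obtain B where B: "\<And>i. AE x in lebesgue. \<bar>?v i x\<bar> \<le> B i" by blast
    have vB: "AE x in lebesgue. \<bar>?v i x\<bar> \<le> (\<Sum>i\<in>UNIV. \<bar>B i\<bar>)" for i
      using B[of i]
    proof eventually_elim
      case (elim x)
      have "\<bar>B i\<bar> \<le> (\<Sum>i\<in>UNIV. \<bar>B i\<bar>)" by (rule member_le_sum) auto
      then show ?case using elim by linarith
    qed
    have GL: "AE x in lebesgue. norm (G x) \<le> norm M + L"
      using GH L by eventually_elim (metis add_left_mono norm_triangle_le)
    obtain C where "\<And>\<epsilon>. \<epsilon> > 0 \<Longrightarrow> energy_inf \<Omega> M K p \<epsilon> \<le> ennreal (C * \<epsilon> powr p)"
      by (rule energy_inf_le_of_second_derivatives[OF op bdd p1(1) G GK GM GL vB der]) (assumption, rule that)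
    then show ?thesis
      using \<mu> assms(1) by (intro exI[of _ C] exI[of _ 1] exI[of _ p]) auto
  next
    case True
    \<comment> \<open>Borel representatives bounded at every point, as
      \<open>smooth_competitor\<close> requires, not merely almost everywhere.\<close>
    have "\<exists>f. \<forall>i j. f i j \<in> borel_measurable borel \<and> (\<forall>x. \<bar>f i j x\<bar> \<le> \<bar>L\<bar>) \<and> (AE x in lebesgue. H x $ i $ j = f i j x)"
    proof (intro choice allI)
      fix i j
      obtain g where g [measurable]: "g \<in> borel_measurable borel" and Hg: "AE x in lborel. H x $ i $ j = g x"
        by (rule weak_deriv_borel_representative[OF H_deriv]) (rule that)
      let ?f = "\<lambda>x. min (max (g x) (- \<bar>L\<bar>)) \<bar>L\<bar>"
      have "AE x in lebesgue. H x $ i $ j = ?f x"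
        using AE_completion[OF Hg] L
      proof eventually_elim
        case (elim x)
        then show ?case using H_le[of "H x" i j] by (auto simp: min_def max_def)
      qed
      then show "\<exists>f. f \<in> borel_measurable borel \<and> (\<forall>x. \<bar>f x\<bar> \<le> \<bar>L\<bar>) \<and> (AE x in lebesgue. H x $ i $ j = f x)"
        by (intro exI[of _ ?f]) auto
    qed
    then obtain f0 where f0: "\<And>i j. f0 i j \<in> borel_measurable borel" "\<And>i j x. \<bar>f0 i j x\<bar> \<le> \<bar>L\<bar>"
      "\<And>i j. AE x in lebesgue. H x $ i $ j = f0 i j x" by blast
    \<comment> \<open>Setting the values outside the closure to 0 alters the representative on a
      null set only and makes it integrable, the closure being bounded.\<close>
    define f where "f i j x = (if x \<in> closure \<Omega> then f0 i j x else 0)" for i j x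
    have f_meas [measurable]: "f i j \<in> borel_measurable borel" for i j
      unfolding f_def using f0(1) by (intro measurable_If_set) auto
    have fL: "\<bar>f i j x\<bar> \<le> \<bar>L\<bar>" for i j x using f0(2) by (simp add: f_def)
    have GHM: "AE x in lebesgue. x \<notin> closure \<Omega> \<longrightarrow> H x = 0"
      using GH GM by eventually_elim simp
    have Hf: "AE x in lebesgue. H x $ i $ j = f i j x" for i j
      using f0(3)[of i j] GHM by eventually_elim (auto simp: f_def)
    have bounded_int: "integrable lborel g" if g [measurable]: "g \<in> borel_measurable borel"
      and "\<And>x. \<bar>g x\<bar> \<le> \<bar>L\<bar> * indicator (closure \<Omega>) x" for g :: "real^'n \<Rightarrow> real"
    proof (rule Bochner_Integration.integrable_bound)
      show "integrable lborel (\<lambda>x. \<bar>L\<bar> * indicator (closure \<Omega>) x)"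
        using emeasure_bounded_finite[OF bounded_closure[OF bdd]] by (intro integrable_mult_right integrable_real_indicator) auto
      show "AE x in lborel. norm (g x) \<le> norm (\<bar>L\<bar> * indicator (closure \<Omega>) x)"
        using that(2) by (auto intro!: AE_I2 order_trans[OF that(2)])
    qed simp
    have f_int: "integrable lborel (f i j)" for i j
      by (rule bounded_int[OF f_meas]) (use f0(2)[of i j] in \<open>auto simp: f_def indicator_def\<close>)
    have "\<exists>w. \<forall>i. w i \<in> borel_measurable borel \<and> (AE x in lborel. ?v i x = w i x)"
    proof (intro choice allI)
      fix i
      show "\<exists>w. w \<in> borel_measurable borel \<and> (AE x in lborel. ?v i x = w x)"
        using completion_ex_borel_measurable_real[OF loc_integrable_borel[OF v_li[of i]]] by auto
    qed
    then obtain v where v [measurable]: "\<And>i. v i \<in> borel_measurable borel" and v_ae: "\<And>i. AE x in lborel. ?v i x = v i x"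
      by blast
    have v_ae': "AE x in lebesgue. ?v i x = v i x" for i by (rule AE_completion[OF v_ae])
    have leb: "v i \<in> borel_measurable lebesgue" "f i j \<in> borel_measurable lebesgue" for i j
      using v f_meas by (auto intro: measurable_completion)
    have v_deriv: "weak_deriv UNIV [j] (v i) (f i j)" for i j
      by (rule weak_deriv_cong_AE[OF H_deriv v_ae' Hf leb])
    have v0': "AE x in lborel. x \<notin> closure \<Omega> \<longrightarrow> v i x = 0" for i
    proof -
      have "AE x in lborel. x \<notin> closure \<Omega> \<longrightarrow> ?v i x = 0" using v0[of i] by (simp only: AE_completion_iff)
      with v_ae[of i] show ?thesis by eventually_elim auto
    qed
    have v_int: "integrable lborel (v i)" for i
    proof -
      have "loc_integrable UNIV (v i)" using v_deriv by (auto simp: weak_deriv_def)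
      then have "integrable lebesgue (\<lambda>x. indicator (closure \<Omega>) x *\<^sub>R v i x)"
        using bdd unfolding loc_integrable_def set_integrable_def by (simp add: compact_closure)
      then have i: "integrable lborel (\<lambda>x. indicator (closure \<Omega>) x *\<^sub>R v i x)"
        by (subst (asm) integrable_completion) auto
      show ?thesis
        by (rule integrable_cong_AE_imp[OF i]) (use v0'[of i] in \<open>auto simp: indicator_def elim!: eventually_mono\<close>)
    qed
    have gag: "gagliardo_integral s p (f i j) < \<infinity>" for i j
    proof -
      obtain g where g: "\<And>j. weak_deriv UNIV [j] (?v i) (g [j])" "gagliardo_pow 1 s p g < \<infinity>"
        by (rule sobolev_space_gagliardo[OF sob[of i] s0 True]) (rule that)
      have "AE x in lebesgue. g [j] x = f i j x"
        using weak_deriv_unique[OF g(1)[of j] H_deriv[of j i]] Hf[of i j] by eventually_elim simp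
      from gagliardo_integral_le_pow[where g = g and j = j, OF this p1(2), of s] g(2) show ?thesis by (rule le_less_trans)
    qed
    let ?t = "min (s * p) 1"
    let ?P = "\<lambda>i C \<epsilon> w. test_fun \<Omega> w \<and>
       (\<forall>j. (\<integral>\<^sup>+x. ennreal ((pderiv_dir j w x - f i j x)\<^sup>2) * indicator \<Omega> x \<partial>lborel) \<le> ennreal (C * \<epsilon> powr ?t)) \<and>
       (\<forall>j k. (\<integral>\<^sup>+x. ennreal ((\<epsilon> * \<bar>pderiv_dir k (pderiv_dir j w) x\<bar>) powr p) * indicator \<Omega> x \<partial>lborel)
          \<le> ennreal (C * \<epsilon> powr ?t))"
    \<comment> \<open>The constant and the threshold of each component are packed into a pair so
      that one choice over \<open>i\<close> produces both; afterwards their sum and minimum serve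
      all components.\<close>
    have "\<exists>Ce. \<forall>i. fst (Ce i) > 0 \<and> snd (Ce i) > 0 \<and> (\<forall>\<epsilon>. 0 < \<epsilon> \<longrightarrow> \<epsilon> < snd (Ce i) \<longrightarrow> (\<exists>w. ?P i (fst (Ce i)) \<epsilon> w))"
    proof (intro choice allI)
      fix i
      obtain C e where "C > 0" "e > 0" "\<And>\<epsilon>. 0 < \<epsilon> \<Longrightarrow> \<epsilon> < e \<Longrightarrow> \<exists>w. ?P i C \<epsilon> w"
        by (rule smooth_competitor[OF assms(3) bdd p1(1) assms(2) s0 v_int[of i] v0' f_int fL v_deriv gag]) (rule that)
      then show "\<exists>Ce. fst Ce > 0 \<and> snd Ce > 0 \<and> (\<forall>\<epsilon>. 0 < \<epsilon> \<longrightarrow> \<epsilon> < snd Ce \<longrightarrow> (\<exists>w. ?P i (fst Ce) \<epsilon> w))"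
        by (intro exI[of _ "(C, e)"]) auto
    qed
    then obtain Ce where Ce: "\<And>i. fst (Ce i) > 0" "\<And>i. snd (Ce i) > 0"
      "\<And>i \<epsilon>. 0 < \<epsilon> \<Longrightarrow> \<epsilon> < snd (Ce i) \<Longrightarrow> \<exists>w. ?P i (fst (Ce i)) \<epsilon> w"
      by blast
    define C where "C = (\<Sum>i\<in>UNIV. fst (Ce i))"
    define e where "e = Min (range (\<lambda>i. snd (Ce i)))"
    have C_ge: "fst (Ce i) \<le> C" for i
      unfolding C_def using Ce(1) by (intro member_le_sum) (auto intro: less_imp_le)
    have e0: "e > 0" unfolding e_def using Ce(2) by (subst Min_gr_iff) auto
    have e_le: "e \<le> snd (Ce i)" for i unfolding e_def by (rule Min_le) auto
    let ?N = "real CARD('n) ^ 2 + (real CARD('n) powr p) ^ 3 * real CARD('n) ^ 3"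
    have "energy_inf \<Omega> M K p \<epsilon> \<le> ennreal (?N * C * \<epsilon> powr ?t)" if \<epsilon>: "0 < \<epsilon>" "\<epsilon> < e" for \<epsilon>
    proof -
      have "\<exists>w. \<forall>i. ?P i (fst (Ce i)) \<epsilon> (w i)"
        using Ce(3)[OF \<epsilon>(1) less_le_trans[OF \<epsilon>(2) e_le]] by (intro choice allI)
      then obtain w where w: "\<And>i. ?P i (fst (Ce i)) \<epsilon> (w i)" by blast
      define F where "F x = (\<chi> i j. f i j x)" for x
      have F_nth: "F x $ i $ j = f i j x" for x i j by (simp add: F_def)
      have le: "ennreal (fst (Ce i) * \<epsilon> powr ?t) \<le> ennreal (C * \<epsilon> powr ?t)" for i
        using C_ge by (intro ennreal_leI mult_right_mono) auto
      have "AE x in lebesgue. \<forall>i\<in>UNIV. \<forall>j\<in>UNIV. H x $ i $ j = f i j x"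
        using Hf by (intro AE_finite_allI) auto
      then have FK: "AE x in lebesgue. x \<in> \<Omega> \<longrightarrow> M + F x \<in> K"
        using GH GK
      proof eventually_elim
        case (elim x)
        have "F x = H x" using elim(1) by (simp add: vec_eq_iff F_nth)
        then show ?case using elim by simp
      qed
      have "energy_inf \<Omega> M K p \<epsilon> \<le> ennreal (?N * (C * \<epsilon> powr ?t))"
      proof (rule energy_inf_le_of_smooth_approximations[OF op bdd p1(1) \<epsilon>(1) FK, where w = w])
        show "(\<lambda>x. F x $ i $ j) \<in> borel_measurable borel" for i j unfolding F_nth by (rule f_meas)
        show "test_fun \<Omega> (w i)" for i using w by blast
        show "(\<integral>\<^sup>+x. ennreal ((pderiv_dir j (w i) x - F x $ i $ j)\<^sup>2) * indicator \<Omega> x \<partial>lborel) \<le> ennreal (C * \<epsilon> powr ?t)" for i j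
          unfolding F_nth using w le order_trans by blast
        show "(\<integral>\<^sup>+x. ennreal ((\<epsilon> * \<bar>pderiv_dir k (pderiv_dir j (w i)) x\<bar>) powr p) * indicator \<Omega> x \<partial>lborel) \<le> ennreal (C * \<epsilon> powr ?t)" for i j k
          using w le order_trans by blast
        show "0 \<le> C * \<epsilon> powr ?t"
          unfolding C_def using Ce(1) by (intro mult_nonneg_nonneg sum_nonneg) (auto intro: less_imp_le)
      qed
      then show ?thesis by (simp add: mult.assoc)
    qed
    then show ?thesis using e0 sp \<mu> by (intro exI[of _ "?N * C"] exI[of _ e] exI[of _ ?t]) auto
  qed
  then obtain C e t where e: "e > 0" and t: "2 * \<mu> < t"
    and E: "\<And>\<epsilon>. 0 < \<epsilon> \<Longrightarrow> \<epsilon> < e \<Longrightarrow> energy_inf \<Omega> M K p \<epsilon> \<le> ennreal (C * \<epsilon> powr t)" by blast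
  show False
  \<comment> \<open>The absolute value is taken because the sign of \<open>C\<close> was not
    recorded, and products of extended nonnegative reals need nonnegative factors.\<close>
  proof (rule not_eventually_powr_le[OF t, of "min e \<epsilon>0" "C\<^sub>p * \<bar>C\<bar>"])
    show "min e \<epsilon>0 > 0" using e assms(12) by simp
    fix \<epsilon> :: real assume \<epsilon>: "0 < \<epsilon>" "\<epsilon> < min e \<epsilon>0"
    have "ennreal (\<epsilon> powr (2 * \<mu>)) \<le> ennreal C\<^sub>p * energy_inf \<Omega> M K p \<epsilon>"
      using \<epsilon> by (intro assms(14)) auto
    also have "\<dots> \<le> ennreal C\<^sub>p * ennreal (C * \<epsilon> powr t)"
      using \<epsilon> by (intro mult_left_mono E) auto
    also have "\<dots> \<le> ennreal C\<^sub>p * ennreal (\<bar>C\<bar> * \<epsilon> powr t)"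
      by (intro mult_left_mono ennreal_leI mult_right_mono) auto
    also have "\<dots> = ennreal (C\<^sub>p * \<bar>C\<bar> * \<epsilon> powr t)"
      using assms(11) by (simp add: ennreal_mult[symmetric] mult.assoc)
    finally show "\<epsilon> powr (2 * \<mu>) \<le> C\<^sub>p * \<bar>C\<bar> * \<epsilon> powr t"
      using assms(11) by (subst (asm) ennreal_le_iff) auto
  qed
qed

end
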